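(* For Lebesgue-almost every $t\in S^1=\mathbb{R}/\mathbb{Z}$, the map $F_t$ is dynamically trivial.
   Context: Let $D=[0,1)$ and let $F:D\to D$ be the bijection given by $F(x)=2x+\frac16$ if $x\in[0,\frac16)$; $F(x)=\frac12(x-\frac16)$ if $x\in[\frac16,\frac12)$; $F(x)=\frac12(x-\frac12)+\frac56$ if $x\in[\frac12,\frac56)$; $F(x)=2(x-\frac56)+\frac12$ if $x\in[\frac56,1)$. For $t\in S^1=\mathbb{R}/\mathbb{Z}$, let $r_t:[0,1)\to[0,1)$ be the translation by $t$ modulo $1$, and let $F_t=F\circ r_t$. The orbit of a point $x$ under a map $f$ is $\mathcal{O}(x)=\{f^n(x)\mid n\in\mathbb{N}\}$, and the $\omega$-limit of $x$ is the set of accumulation points of the sequence $(f^n(x))_{n\in\mathbb{N}}$. $F_t$ is called dynamically trivial if there exist two periodic points $x^+,x^-\in D$ of $F_t$, of orders $p,q\in\mathbb{N}$ respectively, such that $(F_t^p)'(x^+)<1$, $(F_t^q)'(x^-)>1$, and for every $z\in D$ which is not in the orbit of $x^-$, the $\omega$-limit of $z$ under $F_t$ is equal to $\mathcal{O}(x^+)$. *)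

theory Defs
  imports "HOL-Analysis.Analysis"
begin

definition D :: "real set" where
  "D = {0..<1}"

text \<open>Only the values on \<^term>\<open>D\<close> matter: \<open>F\<close> is always applied after a rotation,
  whose values lie in \<^term>\<open>D\<close>.\<close>

definition F :: "real \<Rightarrow> real" where
  "F x = (if x < 1/6 then 2 * x + 1/6
          else if x < 1/2 then (x - 1/6) / 2
          else if x < 5/6 then (x - 1/2) / 2 + 5/6
          else 2 * (x - 5/6) + 1/2)"

definition rotation :: "real \<Rightarrow> real \<Rightarrow> real" where
  "rotation t x = frac (x + t)"

definition F_rot :: "real \<Rightarrow> real \<Rightarrow> real" where
  "F_rot t = F \<circ> rotation t"

lemma bij_betw_F: "bij_betw F D D"
proof -
  have "\<forall>x\<in>D. F (F x) = x" "F ` D \<subseteq> D"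
    by (auto simp: F_def D_def field_simps)
  then show ?thesis
    by (intro bij_betw_byWitness[where f' = F])
qed

lemma rotation_in_D: "rotation t x \<in> D"
  by (simp add: rotation_def D_def frac_lt_1)

text \<open>The map depends only on the class of \<open>t\<close> in \<open>\<real>/\<int>\<close>.\<close>

lemma F_rot_add_of_int: "F_rot (t + of_int n) = F_rot t"
proof -
  have "frac (x + (t + of_int n)) = frac (x + t)" for x
    unfolding frac_def add.assoc[symmetric] by simp
  then show ?thesis
    by (simp add: F_rot_def rotation_def fun_eq_iff)
qed

definition forward_orbit :: "('a \<Rightarrow> 'a) \<Rightarrow> 'a \<Rightarrow> 'a set" where
  "forward_orbit f x = {(f ^^ n) x | n. True}"

definition omega_limit :: "('a::topological_space \<Rightarrow> 'a) \<Rightarrow> 'a \<Rightarrow> 'a set" where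
  "omega_limit f x =
     {y. \<forall>U. open U \<longrightarrow> y \<in> U \<longrightarrow> (\<exists>\<^sub>F n in sequentially. (f ^^ n) x \<in> U)}"

definition periodic_of_order :: "('a \<Rightarrow> 'a) \<Rightarrow> nat \<Rightarrow> 'a \<Rightarrow> bool" where
  "periodic_of_order f p x \<longleftrightarrow>
     0 < p \<and> (f ^^ p) x = x \<and> (\<forall>k. 0 < k \<and> k < p \<longrightarrow> (f ^^ k) x \<noteq> x)"

text \<open>Derivatives are those of maps on \<^term>\<open>D\<close>: two-sided in the interior, one-sided at \<open>0\<close>.
  They are required to exist, so the derivative conditions exclude break points. Accumulation
  points are taken in \<open>\<real>\<close>, so the orbit of \<open>z\<close> may not accumulate at \<open>1 \<notin> D\<close> either.\<close>

definition dynamically_trivial :: "(real \<Rightarrow> real) \<Rightarrow> bool" where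
  "dynamically_trivial f \<longleftrightarrow>
     (\<exists>x_plus \<in> D. \<exists>x_minus \<in> D. \<exists>p q :: nat.
        periodic_of_order f p x_plus \<and>
        periodic_of_order f q x_minus \<and>
        (\<exists>d. ((f ^^ p) has_real_derivative d) (at x_plus within D) \<and> d < 1) \<and>
        (\<exists>d. ((f ^^ q) has_real_derivative d) (at x_minus within D) \<and> d > 1) \<and>
        (\<forall>z \<in> D. z \<notin> forward_orbit f x_minus \<longrightarrow>
           omega_limit f z = forward_orbit f x_plus))"

end

theory Submission
  imports Defs
begin

text \<open>Suspending \<open>F_rot t\<close> gives the flow in direction \<open>(t, 1)\<close> on a dilation surface made of four
  rectangles. Its return map to the horizontal sides depends on \<open>t\<close> modulo 1; the return map to the
  vertical sides depends on \<open>1/t\<close> modulo 9, because these rectangles also form two vertical cylinders.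
  Having one attracting and one repelling cycle that organise all orbits passes between a system and its
  return maps, so the set of good angles is invariant under \<open>t \<mapsto> t + 1\<close>, \<open>t \<mapsto> - t\<close> and
  \<open>1/t \<mapsto> 1/t + 9\<close>. These moves bring every angle into \<open>(2/9, 7/9)\<close>, except for a null set: the
  inverse branches of the renormalization on \<open>[-2/9, 2/9]\<close> multiply Lebesgue measure by at most \<open>64/81\<close>
  in total. On \<open>(2/9, 1/3)\<close> the cycles are fixed points. On \<open>(1/3, 2/3)\<close> the map contracts an arc, where
  it is a rotation composed with the contraction by \<open>1/2\<close>. Such a map has a globally attracting cycle
  unless its break point never enters a gap of the images; in that case the itinerary of 0 determines the
  rotation parameter, and since there are only polynomially many itineraries of length \<open>n\<close>, each
  fixing the parameter up to \<open>2^(-n)\<close>, this is exceptional.\<close>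

section \<open>Transfer between a map and its return maps\<close>

text \<open>What is passed between systems is deliberately weak: a point only has to come
  arbitrarily near each point of the cycle (\<open>approaches\<close>). This survives a change of
  section with no control of return times. The strong statement about \<omega>-limits is recovered
  once, at the end: cycles avoid the break points, so the map is affine near them, and one close
  approach to a contracting cycle forces convergence. The condition on backward orbits makes the
  notion symmetric under time reversal, which the move \<open>t \<mapsto> - t\<close> uses.
  Derivatives are carried as products of slopes along orbits, which agree over matching returns.
  Origin of the constants: crossing a cylinder of width \<open>1/6\<close> raises a flow line by
  \<open>1 / (6 * t)\<close>, and the circumference is \<open>3/2\<close>, whence the modulus 9.
  Reducing \<open>1/t\<close> modulo 9 to absolute value at most \<open>9/2\<close> gives an angle
  of absolute value at least \<open>2/9\<close>. A branch with nonzero \<open>m\<close>,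
  \<open>n\<close> multiplies measure by at most \<open>1 / (36 * m^2 * n^2)\<close>; as the sum of
  \<open>1/m^2\<close> over \<open>m > 0\<close> is at most \<open>8/3\<close>, the four choices of
  signs give \<open>4/36 * (8/3)^2 = 64/81\<close>.\<close>

definition cocycle :: "('a \<Rightarrow> 'a) \<Rightarrow> ('a \<Rightarrow> real) \<Rightarrow> nat \<Rightarrow> 'a \<Rightarrow> real" where
  "cocycle f s n z = (\<Prod>j<n. s ((f ^^ j) z))"

definition approaches :: "('a::metric_space \<Rightarrow> 'a) \<Rightarrow> 'a \<Rightarrow> 'a set \<Rightarrow> bool" where
  "approaches f z P \<longleftrightarrow> (\<forall>y\<in>P. \<forall>\<epsilon>>0. \<exists>n. dist ((f ^^ n) z) y < \<epsilon>)"

text \<open>Here \<open>g\<close> is the inverse of \<open>f\<close>, \<open>s\<close> is the slope of \<open>f\<close>, and \<open>Z\<close> is met by every cycle that runs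
  through a break point.\<close>

definition sink_source ::
  "('a::metric_space \<Rightarrow> 'a) \<Rightarrow> ('a \<Rightarrow> 'a) \<Rightarrow> 'a set \<Rightarrow> 'a set \<Rightarrow> ('a \<Rightarrow> real) \<Rightarrow> 'a \<Rightarrow> 'a \<Rightarrow> bool" where
  "sink_source f g S Z s p q \<longleftrightarrow> p \<in> S \<and> q \<in> S \<and>
     (\<exists>m>0. (f ^^ m) p = p \<and> cocycle f s m p < 1) \<and>
     (\<exists>m>0. (f ^^ m) q = q \<and> cocycle f s m q > 1) \<and>
     forward_orbit f p \<inter> Z = {} \<and> forward_orbit f q \<inter> Z = {} \<and>
     (\<forall>z\<in>S. z \<in> forward_orbit f q \<or> approaches f z (forward_orbit f p)) \<and>
     (\<forall>z\<in>S. z \<in> forward_orbit f p \<or> approaches g z (forward_orbit f q))"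

definition trivial_dynamics ::
  "('a::metric_space \<Rightarrow> 'a) \<Rightarrow> ('a \<Rightarrow> 'a) \<Rightarrow> 'a set \<Rightarrow> 'a set \<Rightarrow> ('a \<Rightarrow> real) \<Rightarrow> bool" where
  "trivial_dynamics f g S Z s \<longleftrightarrow> (\<exists>p q. sink_source f g S Z s p q)"

section \<open>Orbits, periods and cocycles\<close>

lemma cocycle_0 [simp]: "cocycle f s 0 z = 1"
  by (simp add: cocycle_def)

lemma cocycle_add: "cocycle f s (m + n) z = cocycle f s m z * cocycle f s n ((f ^^ m) z)"
  by (induction n) (simp_all add: cocycle_def funpow_add[symmetric, THEN fun_cong, unfolded o_def] add.commute)

lemma cocycle_Suc: "cocycle f s (Suc n) z = s z * cocycle f s n (f z)"
  using cocycle_add[of f s 1 n z] by (simp add: cocycle_def)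

lemma cocycle_Suc_right: "cocycle f s (Suc n) z = cocycle f s n z * s ((f ^^ n) z)"
  by (simp add: cocycle_def)

lemma funpow_plus: "(f ^^ (m + n)) x = (f ^^ m) ((f ^^ n) x)"
  by (simp add: funpow_add)

lemma orbit_self [simp]: "x \<in> forward_orbit f x"
  unfolding forward_orbit_def by (auto intro: exI[of _ 0])

lemma orbit_funpow [simp]: "(f ^^ n) x \<in> forward_orbit f x"
  unfolding forward_orbit_def by blast

lemma orbitE:
  assumes "y \<in> forward_orbit f x" obtains n where "y = (f ^^ n) x"
  using assms unfolding forward_orbit_def by blast

lemma orbit_trans:
  assumes "z \<in> forward_orbit f y" "y \<in> forward_orbit f x" shows "z \<in> forward_orbit f x"
  using assms by (metis orbitE orbit_funpow funpow_plus)

lemma orbit_mono: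
  assumes "y \<in> forward_orbit f x" shows "forward_orbit f y \<subseteq> forward_orbit f x"
  using orbit_trans[OF _ assms] by blast

text \<open>Induction step of the first-return computations for the suspension flow: a passage
  through one rectangle that ends off the section is put in front of a hit already found.\<close>

lemma first_hit_Suc:
  assumes "f z = z'" "z' \<notin> W" "(f ^^ n) z' = y" "cocycle f s n z' = b"
    "\<And>j. 0 < j \<Longrightarrow> j < n \<Longrightarrow> (f ^^ j) z' \<notin> W"
  shows "\<exists>n>0. (f ^^ n) z = y \<and> (\<forall>j. 0 < j \<longrightarrow> j < n \<longrightarrow> (f ^^ j) z \<notin> W) \<and> cocycle f s n z = s z * b"
proof (intro exI[of _ "Suc n"] conjI allI impI)
  fix j assume "0 < j" "j < Suc n"
  then obtain i where i: "j = Suc i" "i < n" by (cases j) auto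
  show "(f ^^ j) z \<notin> W"
    by (cases "i = 0") (use assms(1,2) assms(5)[of i] i in \<open>simp_all add: funpow_swap1\<close>)
qed (use assms in \<open>simp_all add: funpow_swap1 cocycle_Suc\<close>)

lemma periodic_mult:
  assumes "(f ^^ m) p = p" shows "(f ^^ (k * m)) p = p"
  by (induction k) (simp_all add: funpow_plus assms)

lemma cocycle_mult:
  assumes "(f ^^ m) p = p" shows "cocycle f s (k * m) p = cocycle f s m p ^ k"
  by (induction k) (simp_all add: cocycle_add assms)

lemma periodic_orbit_return:
  assumes "(f ^^ m) p = p" "0 < m" "y \<in> forward_orbit f p"
  shows "p \<in> forward_orbit f y"
proof -
  obtain j where j: "y = (f ^^ j) p" using assms(3) orbitE by metis
  \<comment> \<open>Since \<open>0 < m\<close>, another \<open>j * m - j\<close> steps complete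
    \<open>j\<close> full periods.\<close>
  have "(f ^^ (j * m - j)) y = (f ^^ (j * m)) p"
    unfolding j funpow_plus[symmetric] using assms(2) by simp
  then show ?thesis using periodic_mult[OF assms(1)] by (metis orbit_funpow)
qed

lemma periodic_orbit_eq:
  assumes "(f ^^ m) p = p" "0 < m" "y \<in> forward_orbit f p"
  shows "forward_orbit f y = forward_orbit f p"
  by (intro subset_antisym orbit_mono periodic_orbit_return[OF assms] assms(3))

lemma periodic_orbit_point:
  assumes "(f ^^ m) p = p" "y \<in> forward_orbit f p"
  shows "(f ^^ m) y = y"
  using assms by (metis orbitE funpow_plus add.commute)

text \<open>The cocycle over a period is a product along a closed loop; moving the base point by one
  step moves the factor \<open>s x\<close> from the front of the product to its end.\<close>

lemma cocycle_shift:
  assumes "(f ^^ m) p = p" "y \<in> forward_orbit f p"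
  shows "cocycle f s m y = cocycle f s m p"
proof -
  have step: "cocycle f s m (f x) = cocycle f s m x" if "(f ^^ m) x = x" for x
  proof (cases m)
    case (Suc k)
    have "(f ^^ k) (f x) = x" using that Suc by (simp add: funpow_swap1)
    then show ?thesis unfolding Suc cocycle_Suc[of _ _ k x] cocycle_Suc_right[of _ _ k "f x"] by simp
  qed simp
  have "cocycle f s m ((f ^^ j) p) = cocycle f s m p" for j
  proof (induction j)
    case (Suc j)
    have "(f ^^ m) ((f ^^ j) p) = (f ^^ j) p"
      using periodic_orbit_point[OF assms(1)] by simp
    from step[OF this] Suc show ?case by simp
  qed simp
  then show ?thesis using assms(2) by (metis orbitE)
qed

lemma periodic_orbit_finite:
  assumes "(f ^^ m) p = p" "0 < m" shows "forward_orbit f p = (\<lambda>j. (f ^^ j) p) ` {..<m}"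
proof -
  have "(f ^^ j) p = (f ^^ (j mod m)) p" for j
    by (metis periodic_mult[OF assms(1)] funpow_plus mod_div_mult_eq)
  then have "(f ^^ j) p \<in> (\<lambda>j. (f ^^ j) p) ` {..<m}" for j
    using assms(2) by (metis imageI lessThan_iff mod_less_divisor)
  then show ?thesis unfolding forward_orbit_def by auto
qed

section \<open>Invertible maps and time reversal\<close>

locale invertible_map =
  fixes f g :: "'a::metric_space \<Rightarrow> 'a" and S :: "'a set"
  assumes f_in: "z \<in> S \<Longrightarrow> f z \<in> S" and g_in: "z \<in> S \<Longrightarrow> g z \<in> S"
    and gf: "z \<in> S \<Longrightarrow> g (f z) = z" and fg: "z \<in> S \<Longrightarrow> f (g z) = z"
begin

lemma swap: "invertible_map g f S"
  by unfold_locales (simp_all add: f_in g_in gf fg)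

lemma f_pow_in: "z \<in> S \<Longrightarrow> (f ^^ n) z \<in> S"
  by (induction n) (auto simp: f_in)

lemma g_pow_in: "z \<in> S \<Longrightarrow> (g ^^ n) z \<in> S"
  by (induction n) (auto simp: g_in)

lemma g_pow_f_pow: "z \<in> S \<Longrightarrow> (g ^^ n) ((f ^^ n) z) = z"
  by (induction n arbitrary: z) (simp_all add: funpow_swap1 f_in f_pow_in gf f_in[THEN f_pow_in])

lemma f_pow_g_pow: "z \<in> S \<Longrightarrow> (f ^^ n) ((g ^^ n) z) = z"
  by (rule invertible_map.g_pow_f_pow[OF swap])

lemma orbit_subset: "z \<in> S \<Longrightarrow> forward_orbit f z \<subseteq> S"
  by (auto elim!: orbitE simp: f_pow_in)

lemma periodic_g:
  assumes "p \<in> S" "(f ^^ m) p = p" shows "(g ^^ m) p = p"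
  using assms g_pow_f_pow by metis

lemma g_pow_orbit:
  assumes "p \<in> S" "(f ^^ m) p = p" "0 < m" shows "(g ^^ n) p \<in> forward_orbit f p"
proof -
  \<comment> \<open>Adding \<open>n\<close> full periods supplies enough forward steps for
    \<open>g\<close> to cancel.\<close>
  have "(g ^^ n) p = (g ^^ n) ((f ^^ (n * m)) p)"
    using periodic_mult[OF assms(2)] by simp
  also have "\<dots> = (g ^^ n) ((f ^^ n) ((f ^^ (n * m - n)) p))"
    unfolding funpow_plus[symmetric] using assms(3) by simp
  also have "\<dots> = (f ^^ (n * m - n)) p"
    using assms(1) g_pow_f_pow f_pow_in by blast
  finally show ?thesis by simp
qed

text \<open>Invertibility makes cycles backward closed: inverse iterates of a cycle point stay on
  the cycle.\<close>

lemma orbit_pull_back: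
  assumes "p \<in> S" "(f ^^ m) p = p" "0 < m" "z \<in> S" "(f ^^ n) z \<in> forward_orbit f p"
  shows "z \<in> forward_orbit f p"
proof -
  let ?w = "(f ^^ n) z"
  have w: "?w \<in> S" "(f ^^ m) ?w = ?w"
    using assms f_pow_in periodic_orbit_point by metis+
  have "z = (g ^^ n) ?w" using assms(4) g_pow_f_pow by simp
  then have "z \<in> forward_orbit f ?w" using g_pow_orbit[OF w assms(3)] by metis
  then show ?thesis using assms(5) orbit_trans by metis
qed

lemma orbit_g_eq:
  assumes "p \<in> S" "(f ^^ m) p = p" "0 < m"
  shows "forward_orbit g p = forward_orbit f p"
proof
  show "forward_orbit g p \<subseteq> forward_orbit f p"
    using g_pow_orbit[OF assms] by (auto elim!: orbitE)
  interpret sw: invertible_map g f S by (rule swap)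
  show "forward_orbit f p \<subseteq> forward_orbit g p"
    using sw.g_pow_orbit[OF assms(1) periodic_g[OF assms(1,2)] assms(3)] by (auto elim!: orbitE)
qed

lemma cocycle_inverse:
  assumes "z \<in> S" shows "cocycle g (\<lambda>z. 1 / s (g z)) n z = 1 / cocycle f s n ((g ^^ n) z)"
proof (induction n)
  case (Suc n)
  let ?w = "g ((g ^^ n) z)"
  have "f ?w = (g ^^ n) z" using assms g_pow_in fg by simp
  then show ?case
    using cocycle_Suc[of f s n ?w] by (simp add: cocycle_Suc_right Suc)
qed simp

lemma cocycle_inverse_periodic:
  assumes "p \<in> S" "(f ^^ m) p = p"
  shows "cocycle g (\<lambda>z. 1 / s (g z)) m p = 1 / cocycle f s m p"
  using cocycle_inverse[OF assms(1)] periodic_g[OF assms] by simp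

text \<open>The slope of \<open>g\<close> at \<open>z\<close> is \<open>1 / s (g z)\<close>, so
  cocycles over a period are inverted and the contracting and the expanding cycle exchange
  roles.\<close>

lemma sink_source_inverse:
  assumes "sink_source f g S Z s p q" and pos: "\<And>z. z \<in> S \<Longrightarrow> s z > 0"
  shows "sink_source g f S Z (\<lambda>z. 1 / s (g z)) q p"
proof -
  note A = assms(1)[unfolded sink_source_def]
  obtain m n where m: "m > 0" "(f ^^ m) p = p" "cocycle f s m p < 1"
    and n: "n > 0" "(f ^^ n) q = q" "cocycle f s n q > 1" using A by blast
  have p: "p \<in> S" and q: "q \<in> S" using A by auto
  have "cocycle f s m p > 0"
    unfolding cocycle_def by (intro prod_pos) (use p f_pow_in pos in auto)
  then have 1: "cocycle g (\<lambda>z. 1 / s (g z)) m p > 1"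
    using m by (simp add: cocycle_inverse_periodic[OF p m(2)])
  have 2: "cocycle g (\<lambda>z. 1 / s (g z)) n q < 1"
    using n by (simp add: cocycle_inverse_periodic[OF q n(2)])
  show ?thesis
    unfolding sink_source_def orbit_g_eq[OF p m(2,1)] orbit_g_eq[OF q n(2,1)]
    using A 1 2 m(1) n(1) periodic_g[OF p m(2)] periodic_g[OF q n(2)] by auto
qed

lemma trivial_dynamics_inverse:
  assumes "trivial_dynamics f g S Z s" and "\<And>z. z \<in> S \<Longrightarrow> s z > 0"
  shows "trivial_dynamics g f S Z (\<lambda>z. 1 / s (g z))"
  using sink_source_inverse assms unfolding trivial_dynamics_def by blast

end

text \<open>Continuity is demanded only at points that avoid \<open>Z\<close> together with their
  image, because the two directions of the flow break on different sides: forwards where the value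
  is a corner line, backwards where the argument is one.\<close>

lemma funpow_continuous_at_avoiding:
  fixes f :: "'a::metric_space \<Rightarrow> 'a"
  assumes in_S: "\<And>z. z \<in> S \<Longrightarrow> f z \<in> S"
    and cont: "\<And>z. z \<in> S \<Longrightarrow> z \<notin> Z \<Longrightarrow> f z \<notin> Z \<Longrightarrow> continuous (at z within S) f"
    and w: "w \<in> S" "forward_orbit f w \<inter> Z = {}" and e: "\<epsilon> > 0"
  shows "\<exists>\<delta>>0. \<forall>z\<in>S. dist z w < \<delta> \<longrightarrow> dist ((f ^^ j) z) ((f ^^ j) w) < \<epsilon>"
  using e
proof (induction j arbitrary: \<epsilon>)
  case (Suc j)
  let ?v = "(f ^^ j) w"
  have av: "?v \<notin> Z" "f ?v \<notin> Z" 
    using w(2) orbit_funpow[of j f w] orbit_funpow[of "Suc j" f w]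
    unfolding funpow.simps o_def by blast+
  have pow_S: "(f ^^ j) z \<in> S" if "z \<in> S" for z
    by (induction j) (auto simp: in_S that)
  from cont[OF pow_S[OF w(1)] av] obtain d where d: "d > 0"
    "\<And>z. z \<in> S \<Longrightarrow> dist z ?v < d \<Longrightarrow> dist (f z) (f ?v) < \<epsilon>"
    using Suc.prems unfolding continuous_within_eps_delta by metis
  from Suc.IH[OF d(1)] obtain \<delta> where "\<delta> > 0" "\<forall>z\<in>S. dist z w < \<delta> \<longrightarrow> dist ((f ^^ j) z) ?v < d"
    by blast
  then show ?case using d(2) pow_S by (auto intro!: exI[of _ \<delta>])
qed auto

text \<open>\<open>n\<close> and \<open>n'\<close> are the first return times to \<open>W\<close> and \<open>W'\<close>.\<close>

definition matching_returns ::
  "('a \<Rightarrow> 'a) \<Rightarrow> ('a \<Rightarrow> real) \<Rightarrow> 'a set \<Rightarrow> ('b \<Rightarrow> 'b) \<Rightarrow> ('b \<Rightarrow> real) \<Rightarrow> 'b set \<Rightarrow> ('a \<Rightarrow> 'b) \<Rightarrow> 'a \<Rightarrow> bool" where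
  "matching_returns f s W f' s' W' \<phi> z \<longleftrightarrow> (\<exists>n>0. \<exists>n'>0.
     (f ^^ n) z \<in> W \<and> (\<forall>j. 0 < j \<longrightarrow> j < n \<longrightarrow> (f ^^ j) z \<notin> W) \<and>
     (f' ^^ n') (\<phi> z) = \<phi> ((f ^^ n) z) \<and> (\<forall>j. 0 < j \<longrightarrow> j < n' \<longrightarrow> (f' ^^ j) (\<phi> z) \<notin> W') \<and>
     cocycle f' s' n' (\<phi> z) = cocycle f s n z)"

section \<open>Systems that share a first-return map\<close>

lemma matching_returns_1:
  assumes "f z \<in> W" "0 < n'" "(f' ^^ n') (\<phi> z) = \<phi> (f z)"
    "\<And>j. 0 < j \<Longrightarrow> j < n' \<Longrightarrow> (f' ^^ j) (\<phi> z) \<notin> W'" "cocycle f' s' n' (\<phi> z) = s z"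
  shows "matching_returns f s W f' s' W' \<phi> z"
  unfolding matching_returns_def
  by (rule exI[of _ 1], rule conjI, simp, rule exI[of _ n']) (use assms in \<open>simp add: cocycle_def\<close>)

lemma matching_returns_1_1:
  assumes "f z \<in> W" "f' (\<phi> z) = \<phi> (f z)" "s' (\<phi> z) = s z"
  shows "matching_returns f s W f' s' W' \<phi> z"
  by (rule matching_returns_1[where n' = 1]) (use assms in \<open>simp_all add: cocycle_def\<close>)

text \<open>The two systems have the same first-return map, read through \<open>\<phi>\<close>, with
  equal accumulated slopes but possibly different return times. Nothing topological is required,
  which keeps the relation symmetric.\<close>

locale conjugate_returns =
  A: invertible_map f g S + B: invertible_map f' g' S'
  for f g :: "'a::metric_space \<Rightarrow> 'a" and S
    and f' g' :: "'b::metric_space \<Rightarrow> 'b" and S' +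
  fixes s :: "'a \<Rightarrow> real" and W :: "'a set" and s' :: "'b \<Rightarrow> real" and W' :: "'b set"
    and \<phi> :: "'a \<Rightarrow> 'b" and \<psi> :: "'b \<Rightarrow> 'a"
  assumes W: "W \<subseteq> S" and W': "W' \<subseteq> S'"
    and \<phi>: "z \<in> W \<Longrightarrow> \<phi> z \<in> W'" and \<psi>: "z' \<in> W' \<Longrightarrow> \<psi> z' \<in> W"
    and \<phi>\<psi>: "z' \<in> W' \<Longrightarrow> \<phi> (\<psi> z') = z'" and \<psi>\<phi>: "z \<in> W \<Longrightarrow> \<psi> (\<phi> z) = z"
    and first_return: "z \<in> W \<Longrightarrow> matching_returns f s W f' s' W' \<phi> z"
begin

lemma swap: "conjugate_returns f' g' S' f g S s' W' s W \<psi> \<phi>"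
proof unfold_locales
  fix z' assume z': "z' \<in> W'"
  from first_return[OF \<psi>[OF z']] obtain n n' where *: "n > 0" "n' > 0"
    "(f ^^ n) (\<psi> z') \<in> W" "\<forall>j. 0 < j \<longrightarrow> j < n \<longrightarrow> (f ^^ j) (\<psi> z') \<notin> W"
    "(f' ^^ n') (\<phi> (\<psi> z')) = \<phi> ((f ^^ n) (\<psi> z'))"
    "\<forall>j. 0 < j \<longrightarrow> j < n' \<longrightarrow> (f' ^^ j) (\<phi> (\<psi> z')) \<notin> W'"
    "cocycle f' s' n' (\<phi> (\<psi> z')) = cocycle f s n (\<psi> z')"
    unfolding matching_returns_def by blast
  then show "matching_returns f' s' W' f s W \<psi> z'"
    unfolding matching_returns_def using \<phi> \<phi>\<psi> \<psi>\<phi> z' by (intro exI[of _ n'] exI[of _ n] conjI) auto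
qed (use W W' \<phi> \<psi> \<phi>\<psi> \<psi>\<phi> in simp_all)

text \<open>Any later visit to \<open>W\<close> is reached by a chain of first returns, each of
  which is matched; strong induction on the time splits off the first one.\<close>

lemma return:
  assumes "z \<in> W" "0 < n" "(f ^^ n) z \<in> W"
  shows "\<exists>n'>0. (f' ^^ n') (\<phi> z) = \<phi> ((f ^^ n) z) \<and> cocycle f' s' n' (\<phi> z) = cocycle f s n z"
  using assms
proof (induction n arbitrary: z rule: less_induct)
  case (less n)
  obtain k k' where k: "k > 0" "k' > 0" "(f ^^ k) z \<in> W"
    "\<forall>j. 0 < j \<longrightarrow> j < k \<longrightarrow> (f ^^ j) z \<notin> W"
    "(f' ^^ k') (\<phi> z) = \<phi> ((f ^^ k) z)" "cocycle f' s' k' (\<phi> z) = cocycle f s k z"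
    using first_return[OF less.prems(1)] unfolding matching_returns_def by blast
  have "k \<le> n" using k less.prems by (meson not_le)
  show ?case
  proof (cases "k = n")
    case False
    then obtain i where i: "n = k + i" "0 < i" "i < n"
      using \<open>k \<le> n\<close> k(1) by (metis le_neq_implies_less less_add_same_cancel2 less_imp_add_positive)
    have fi: "(f ^^ i) ((f ^^ k) z) = (f ^^ n) z" by (simp add: i funpow_plus[symmetric] add.commute)
    obtain i' where i': "i' > 0" "(f' ^^ i') (\<phi> ((f ^^ k) z)) = \<phi> ((f ^^ n) z)"
      "cocycle f' s' i' (\<phi> ((f ^^ k) z)) = cocycle f s i ((f ^^ k) z)"
      using less.IH[OF i(3) k(3) i(2)] less.prems(3) fi by auto
    show ?thesis
    proof (intro exI[of _ "k' + i'"] conjI)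
      show "0 < k' + i'" using i' by simp
      show "(f' ^^ (k' + i')) (\<phi> z) = \<phi> ((f ^^ n) z)"
        unfolding add.commute[of k'] funpow_plus k i'(2) ..
      show "cocycle f' s' (k' + i') (\<phi> z) = cocycle f s n z"
        unfolding cocycle_add i(1) k(5,6) i'(3) ..
    qed
  next
    case True
    show ?thesis by (intro exI[of _ k'] conjI) (use k True in simp_all)
  qed
qed

lemma orbit_image:
  assumes "z \<in> W" "y \<in> W" "y \<in> forward_orbit f z" shows "\<phi> y \<in> forward_orbit f' (\<phi> z)"
proof -
  obtain n where n: "y = (f ^^ n) z" using assms(3) orbitE by metis
  show ?thesis
  proof (cases "n = 0")
    case False
    then show ?thesis using return[of z n] n assms by (metis gr0I orbit_funpow)
  qed (use n in simp)
qed

lemma orbit_image':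
  assumes "z' \<in> W'" "y' \<in> W'" "y' \<in> forward_orbit f' z'" shows "\<psi> y' \<in> forward_orbit f (\<psi> z')"
  by (rule conjugate_returns.orbit_image[OF swap assms])

end

text \<open>The conditions added to matching returns are directed from the first system to the
  second. \<open>\<phi>\<close> has to be continuous at periodic points whose cycle avoids
  \<open>Z\<close>, and a neighbourhood in all of \<open>S\<close> must lie in the section, so that
  an approach is seen there. \<open>singular\<close> says that a cycle through \<open>Z'\<close>
  comes from a cycle through \<open>Z\<close>. Continuity of \<open>f'\<close> and \<open>g'\<close>
  serves cycle points outside \<open>W'\<close>, hence the alternative
  \<open>W' = S'\<close>.\<close>

locale section_conjugacy = conjugate_returns f g S f' g' S' s W s' W' \<phi> \<psi>
  for f g :: "'a::metric_space \<Rightarrow> 'a" and S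
    and f' g' :: "'b::metric_space \<Rightarrow> 'b" and S' and s W s' W' \<phi> \<psi> +
  fixes Z :: "'a set" and Z' :: "'b set"
  assumes hits: "z \<in> S \<Longrightarrow> \<exists>n. (f ^^ n) z \<in> W"
    and hits_back: "z \<in> S \<Longrightarrow> \<exists>n. (g ^^ n) z \<in> W"
    and hits': "z' \<in> S' \<Longrightarrow> \<exists>n. (f' ^^ n) z' \<in> W'"
    and hits_back': "z' \<in> S' \<Longrightarrow> \<exists>n. (g' ^^ n) z' \<in> W'"
    and singular: "z' \<in> S' \<Longrightarrow> z' \<in> Z' \<Longrightarrow>
      \<exists>w'\<in>W'. \<psi> w' \<in> Z \<and> (z' \<in> forward_orbit f' w' \<or> w' \<in> forward_orbit f' z')"
    and \<phi>_continuous: "p \<in> W \<Longrightarrow> 0 < m \<Longrightarrow> (f ^^ m) p = p \<Longrightarrow> forward_orbit f p \<inter> Z = {} \<Longrightarrow> \<epsilon> > 0 \<Longrightarrow>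
      \<exists>\<delta>>0. \<forall>z\<in>S. dist z p < \<delta> \<longrightarrow> z \<in> W \<and> dist (\<phi> z) (\<phi> p) < \<epsilon>"
    and f'_continuous: "W' = S' \<or>
      (\<forall>z\<in>S'. z \<notin> Z' \<longrightarrow> f' z \<notin> Z' \<longrightarrow> continuous (at z within S') f') \<and>
      (\<forall>z\<in>S'. z \<notin> Z' \<longrightarrow> g' z \<notin> Z' \<longrightarrow> continuous (at z within S') g')"
begin

text \<open>The base point is moved along the cycle into the section, where a full period is a chain
  of matched returns. The new cycle avoids \<open>Z'\<close>, as \<open>singular\<close> would
  otherwise put a point of \<open>Z\<close> on the old one.\<close>

lemma periodic_image:
  assumes p: "p \<in> S" "0 < m" "(f ^^ m) p = p" "forward_orbit f p \<inter> Z = {}"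
  obtains p1 m' where "p1 \<in> W" "p1 \<in> forward_orbit f p" "0 < m'" "(f' ^^ m') (\<phi> p1) = \<phi> p1"
    "cocycle f' s' m' (\<phi> p1) = cocycle f s m p" "forward_orbit f' (\<phi> p1) \<inter> Z' = {}"
proof -
  obtain a where a: "(f ^^ a) p \<in> W" using hits p by blast
  define p1 where "p1 = (f ^^ a) p"
  have p1: "p1 \<in> W" "p1 \<in> forward_orbit f p" using a by (simp_all add: p1_def)
  have per: "(f ^^ m) p1 = p1" using periodic_orbit_point p1 p by metis
  obtain m' where m': "m' > 0" "(f' ^^ m') (\<phi> p1) = \<phi> p1"
      "cocycle f' s' m' (\<phi> p1) = cocycle f s m p1"
    using return[OF p1(1) p(2)] per p1(1) by metis
  have avoid: False if z': "z' \<in> forward_orbit f' (\<phi> p1)" "z' \<in> Z'" for z'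
  proof -
    have S': "\<phi> p1 \<in> S'" using \<phi> p1 W' by blast
    then have z'S: "z' \<in> S'" using B.orbit_subset z' by blast
    obtain w' where w': "w' \<in> W'" "\<psi> w' \<in> Z"
      "z' \<in> forward_orbit f' w' \<or> w' \<in> forward_orbit f' z'"
      using singular[OF z'S z'(2)] by blast
    have w'S: "w' \<in> S'" using w' W' by blast
    have "w' \<in> forward_orbit f' (\<phi> p1)"
      using w'(3)
    proof
      \<comment> \<open>Here \<open>w'\<close> precedes a point of the cycle, and cycles are
        backward closed.\<close>
      assume "z' \<in> forward_orbit f' w'"
      then obtain k where "z' = (f' ^^ k) w'" using orbitE by metis
      then show ?thesis using B.orbit_pull_back[OF S' m'(2,1) w'S] z' by metis
    qed (use z' orbit_trans in metis)
    then have "\<psi> w' \<in> forward_orbit f (\<psi> (\<phi> p1))"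
      using orbit_image' w'(1) \<phi>[OF p1(1)] by blast
    then show False
      using \<psi>\<phi>[OF p1(1)] p1(2) orbit_trans w'(2) p(4) by fastforce
  qed
  show thesis
    by (rule that[OF p1 m'(1,2)]) (use m' cocycle_shift[OF p(3) p1(2)] avoid in auto)
qed

text \<open>Points of the orbit of \<open>\<phi> p\<close> outside the section are approached because iterates are continuous
  along orbits that avoid \<open>Z'\<close>.\<close>

lemma approaches_image:
  assumes p: "p \<in> W" "0 < m" "(f ^^ m) p = p" "forward_orbit f p \<inter> Z = {}"
    and p': "0 < m'" "(f' ^^ m') (\<phi> p) = \<phi> p" "forward_orbit f' (\<phi> p) \<inter> Z' = {}"
    and z: "z \<in> W" "approaches f z (forward_orbit f p)"
    and z': "z' \<in> S'" "(f' ^^ a) z' = \<phi> z"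
  shows "approaches f' z' (forward_orbit f' (\<phi> p))"
  unfolding approaches_def
proof (intro ballI allI impI)
  fix y' \<epsilon> assume y': "y' \<in> forward_orbit f' (\<phi> p)" and e: "(\<epsilon>::real) > 0"
  have S': "\<phi> p \<in> S'" using \<phi> p W' by blast
  have y'S: "y' \<in> S'" using B.orbit_subset[OF S'] y' by blast
  obtain w' j where w': "w' \<in> W'" "w' \<in> forward_orbit f' (\<phi> p)" "(f' ^^ j) w' = y'"
    and cont: "\<exists>\<delta>>0. \<forall>x\<in>S'. dist x w' < \<delta> \<longrightarrow> dist ((f' ^^ j) x) y' < \<epsilon>"
  proof (cases "W' = S'")
    case True
    show thesis by (rule that[of y' 0]) (use True y' y'S e in auto)
  next
    case False
    obtain n where n: "(g' ^^ n) y' \<in> W'" using hits_back'[OF y'S] by blast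
    let ?w = "(g' ^^ n) y'"
    have w: "(f' ^^ n) ?w = y'" using B.f_pow_g_pow y'S by blast
    have wS: "?w \<in> S'" using n W' by blast
    have wo: "?w \<in> forward_orbit f' (\<phi> p)"
      using B.orbit_pull_back[OF S' p'(2,1) wS] w y' by metis
    then have "forward_orbit f' ?w \<inter> Z' = {}"
      using p'(3) orbit_mono by fast
    then have "\<exists>\<delta>>0. \<forall>z\<in>S'. dist z ?w < \<delta> \<longrightarrow> dist ((f' ^^ n) z) ((f' ^^ n) ?w) < \<epsilon>"
      using f'_continuous False by (intro funpow_continuous_at_avoiding[OF B.f_in _ wS _ e]) auto
    then show thesis using that[OF n wo w] w by simp
  qed
  obtain d where d: "d > 0" "\<And>x. x \<in> S' \<Longrightarrow> dist x w' < d \<Longrightarrow> dist ((f' ^^ j) x) y' < \<epsilon>"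
    using cont by blast
  define y where "y = \<psi> w'"
  have y: "y \<in> W" "\<phi> y = w'" using w' \<psi> \<phi>\<psi> by (auto simp: y_def)
  have yo: "y \<in> forward_orbit f p"
    using orbit_image'[OF \<phi>[OF p(1)] w'(1,2)] \<psi>\<phi>[OF p(1)] by (simp add: y_def)
  have "forward_orbit f y \<inter> Z = {}" using orbit_mono[OF yo] p(4) by fast
  from \<phi>_continuous[OF y(1) p(2) periodic_orbit_point[OF p(3) yo] this d(1)] obtain d' where d': "d' > 0"
    "\<And>x. x \<in> S \<Longrightarrow> dist x y < d' \<Longrightarrow> x \<in> W \<and> dist (\<phi> x) w' < d" using y(2) by auto
  obtain n where n: "dist ((f ^^ n) z) y < d'" using z(2) yo d'(1) unfolding approaches_def by blast
  have "(f ^^ n) z \<in> S" using z W A.f_pow_in by blast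
  with d'(2) n have x: "(f ^^ n) z \<in> W" "dist (\<phi> ((f ^^ n) z)) w' < d" by auto
  then have "\<phi> ((f ^^ n) z) \<in> forward_orbit f' (\<phi> z)" using orbit_image z by simp
  then obtain n' where n': "\<phi> ((f ^^ n) z) = (f' ^^ n') (\<phi> z)" using orbitE by metis
  have "dist ((f' ^^ j) (\<phi> ((f ^^ n) z))) y' < \<epsilon>"
    using d(2) x \<phi> W' by blast
  then have "dist ((f' ^^ (j + (n' + a))) z') y' < \<epsilon>"
    unfolding funpow_plus z'(2) n' .
  then show "\<exists>n. dist ((f' ^^ n) z') y' < \<epsilon>" ..
qed

text \<open>One of the two convergence clauses; the other one is this lemma for the inverse systems,
  with \<open>p\<close> and \<open>q\<close> exchanged.\<close>

lemma half_transfer: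
  assumes p: "p \<in> W" "0 < m" "(f ^^ m) p = p" "forward_orbit f p \<inter> Z = {}"
    and p': "0 < m'" "(f' ^^ m') (\<phi> p) = \<phi> p" "forward_orbit f' (\<phi> p) \<inter> Z' = {}"
    and q: "q \<in> W" "0 < n'" "(f' ^^ n') (\<phi> q) = \<phi> q"
    and all: "\<And>z. z \<in> S \<Longrightarrow> z \<in> forward_orbit f q \<or> approaches f z (forward_orbit f p)"
    and z': "z' \<in> S'"
  shows "z' \<in> forward_orbit f' (\<phi> q) \<or> approaches f' z' (forward_orbit f' (\<phi> p))"
proof -
  obtain a where a: "(f' ^^ a) z' \<in> W'" using hits' z' by blast
  define z where "z = \<psi> ((f' ^^ a) z')"
  have z: "z \<in> W" "(f' ^^ a) z' = \<phi> z" using a \<psi> \<phi>\<psi> by (auto simp: z_def)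
  have "\<phi> q \<in> S'" using \<phi> q W' by blast
  show ?thesis
  proof (cases "z \<in> forward_orbit f q")
    case True
    then have "(f' ^^ a) z' \<in> forward_orbit f' (\<phi> q)" using orbit_image z q by metis
    then show ?thesis using B.orbit_pull_back[OF \<open>\<phi> q \<in> S'\<close> q(3,2) z'] by blast
  next
    case False
    then have "approaches f z (forward_orbit f p)" using all z(1) W by blast
    from approaches_image[OF p p' z(1) this z' z(2)] show ?thesis ..
  qed
qed

text \<open>A first return of the inverse map is a first return of the map traversed backwards, so
  the same two sections match in reversed time.\<close>

lemma inverse: "section_conjugacy g f S g' f' S'
  (\<lambda>z. 1 / s (g z)) W (\<lambda>z. 1 / s' (g' z)) W' \<phi> \<psi> Z Z'"
proof -
  interpret A': invertible_map g f S by (rule A.swap)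
  interpret B': invertible_map g' f' S' by (rule B.swap)
  show ?thesis
  proof unfold_locales
    fix z assume z: "z \<in> W"
    then have zS: "z \<in> S" using W by blast
    obtain n0 where "(g ^^ n0) (g z) \<in> W" using hits_back A.g_in zS by blast
    then have "\<exists>n. 0 < n \<and> (g ^^ n) z \<in> W"
      by (intro exI[of _ "Suc n0"]) (simp add: funpow_swap1)
    then obtain n where n: "0 < n" "(g ^^ n) z \<in> W"
      and least: "\<And>j. 0 < j \<Longrightarrow> j < n \<Longrightarrow> (g ^^ j) z \<notin> W"
      unfolding exists_least_iff[of "\<lambda>n. 0 < n \<and> (g ^^ n) z \<in> W"] by blast
    define y where "y = (g ^^ n) z"
    have fy: "(f ^^ j) y = (g ^^ (n - j)) z" if "j \<le> n" for j
    proof -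
      have "(g ^^ n) z = (g ^^ j) ((g ^^ (n - j)) z)"
        unfolding funpow_plus[symmetric] using that by simp
      then show ?thesis using A.f_pow_g_pow A.g_pow_in zS by (simp add: y_def)
    qed
    obtain k k' where k: "k > 0" "k' > 0" "(f ^^ k) y \<in> W"
      "\<And>j. 0 < j \<Longrightarrow> j < k \<Longrightarrow> (f ^^ j) y \<notin> W"
      "(f' ^^ k') (\<phi> y) = \<phi> ((f ^^ k) y)"
      "\<And>j. 0 < j \<Longrightarrow> j < k' \<Longrightarrow> (f' ^^ j) (\<phi> y) \<notin> W'"
      "cocycle f' s' k' (\<phi> y) = cocycle f s k y"
      using first_return[of y] n(2) unfolding y_def matching_returns_def by metis
    \<comment> \<open>The forward return time of \<open>y\<close> equals the backward return time of
      \<open>z\<close>: if one were shorter, the other path would meet \<open>W\<close> too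
      early.\<close>
    have "k = n"
    proof (rule antisym)
      show "k \<le> n" using k(4)[of n] n fy[of n] z by force
      show "n \<le> k"
      proof (rule ccontr)
        assume "\<not> n \<le> k"
        then show False using fy[of k] k(1,3) least[of "n - k"] by simp
      qed
    qed
    have fz: "(f' ^^ k') (\<phi> y) = \<phi> z" using k(5) fy[of n] \<open>k = n\<close> by simp
    have yS: "\<phi> y \<in> S'" using \<phi> n(2) W' by (auto simp: y_def)
    have zS': "\<phi> z \<in> S'" using \<phi> z W' by auto
    have gj: "(g' ^^ j) (\<phi> z) = (f' ^^ (k' - j)) (\<phi> y)" if "j \<le> k'" for j
    proof -
      have "\<phi> z = (f' ^^ j) ((f' ^^ (k' - j)) (\<phi> y))"
        unfolding funpow_plus[symmetric] using that fz by simp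
      then show ?thesis using B.g_pow_f_pow B.f_pow_in yS by simp
    qed
    have gy: "(g' ^^ k') (\<phi> z) = \<phi> y" using gj[of k'] by simp
    show "matching_returns g (\<lambda>z. 1 / s (g z)) W g' (\<lambda>z. 1 / s' (g' z)) W' \<phi> z"
      unfolding matching_returns_def
    proof (rule exI[of _ n], rule conjI[OF n(1)], rule exI[of _ k'], intro conjI allI impI n k(2) least)
      show "(g' ^^ k') (\<phi> z) = \<phi> ((g ^^ n) z)" using gy by (simp add: y_def)
      show "(g' ^^ j) (\<phi> z) \<notin> W'" if "0 < j" "j < k'" for j
        using that gj[of j] k(6)[of "k' - j"] by simp
      show "cocycle g' (\<lambda>z. 1 / s' (g' z)) k' (\<phi> z) = cocycle g (\<lambda>z. 1 / s (g z)) n z"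
        unfolding A.cocycle_inverse[OF zS] B.cocycle_inverse[OF zS'] gy
        using k(7) \<open>k = n\<close> by (simp add: y_def)
    qed
  next
    fix z' assume z': "z' \<in> S'" "z' \<in> Z'"
    obtain w' where w': "w' \<in> W'" "\<psi> w' \<in> Z" "z' \<in> forward_orbit f' w' \<or> w' \<in> forward_orbit f' z'"
      using singular[OF z'] by blast
    have "w' \<in> S'" using w' W' by blast
    then have "w' \<in> forward_orbit g' z' \<or> z' \<in> forward_orbit g' w'"
      using w'(3) z'(1) B.g_pow_f_pow by (metis orbitE orbit_funpow)
    then show "\<exists>w'\<in>W'. \<psi> w' \<in> Z \<and> (z' \<in> forward_orbit g' w' \<or> w' \<in> forward_orbit g' z')"
      using w' by blast
  next
    fix p m \<epsilon> assume p: "p \<in> W" "0 < m" "(g ^^ m) p = p" "forward_orbit g p \<inter> Z = {}" "(\<epsilon>::real) > 0"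
    have pS: "p \<in> S" using p W by blast
    have per: "(f ^^ m) p = p" using A'.periodic_g[OF pS p(3)] .
    show "\<exists>\<delta>>0. \<forall>z\<in>S. dist z p < \<delta> \<longrightarrow> z \<in> W \<and> dist (\<phi> z) (\<phi> p) < \<epsilon>"
      by (rule \<phi>_continuous[OF p(1,2) per])
        (use p A.orbit_g_eq[OF pS per p(2)] in auto)
  qed (use W W' \<phi> \<psi> \<phi>\<psi> \<psi>\<phi> hits hits' hits_back hits_back' f'_continuous in blast)+
qed

theorem trivial_dynamics_transfer:
  assumes "trivial_dynamics f g S Z s"
  shows "trivial_dynamics f' g' S' Z' s'"
proof -
  interpret I: section_conjugacy g f S g' f' S' "\<lambda>z. 1 / s (g z)" W "\<lambda>z. 1 / s' (g' z)" W' \<phi> \<psi> Z Z'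
    by (rule inverse)
  obtain p q m n where p: "p \<in> S" "0 < m" "(f ^^ m) p = p" "cocycle f s m p < 1"
      "forward_orbit f p \<inter> Z = {}"
    and q: "q \<in> S" "0 < n" "(f ^^ n) q = q" "cocycle f s n q > 1"
      "forward_orbit f q \<inter> Z = {}"
    and conv: "\<And>z. z \<in> S \<Longrightarrow> z \<in> forward_orbit f q \<or> approaches f z (forward_orbit f p)"
      "\<And>z. z \<in> S \<Longrightarrow> z \<in> forward_orbit f p \<or> approaches g z (forward_orbit f q)"
    using assms unfolding trivial_dynamics_def sink_source_def by metis
  obtain p1 m' where p1: "p1 \<in> W" "p1 \<in> forward_orbit f p" "0 < m'" "(f' ^^ m') (\<phi> p1) = \<phi> p1"
    "cocycle f' s' m' (\<phi> p1) = cocycle f s m p" "forward_orbit f' (\<phi> p1) \<inter> Z' = {}"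
    using periodic_image[OF p(1-3,5)] .
  obtain q1 n' where q1: "q1 \<in> W" "q1 \<in> forward_orbit f q" "0 < n'" "(f' ^^ n') (\<phi> q1) = \<phi> q1"
    "cocycle f' s' n' (\<phi> q1) = cocycle f s n q" "forward_orbit f' (\<phi> q1) \<inter> Z' = {}"
    using periodic_image[OF q(1-3,5)] .
  have p1': "(f ^^ m) p1 = p1" "forward_orbit f p1 = forward_orbit f p" "p1 \<in> S"
    using periodic_orbit_point[OF p(3) p1(2)] periodic_orbit_eq[OF p(3,2) p1(2)] W p1(1) by auto
  have q1': "(f ^^ n) q1 = q1" "forward_orbit f q1 = forward_orbit f q" "q1 \<in> S"
    using periodic_orbit_point[OF q(3) q1(2)] periodic_orbit_eq[OF q(3,2) q1(2)] W q1(1) by auto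
  have S': "\<phi> p1 \<in> S'" "\<phi> q1 \<in> S'" using \<phi> p1 q1 W' by auto
  note op = A.orbit_g_eq[OF p1'(3,1) p(2)] and oq = A.orbit_g_eq[OF q1'(3,1) q(2)]
  note op' = B.orbit_g_eq[OF S'(1) p1(4,3)] and oq' = B.orbit_g_eq[OF S'(2) q1(4,3)]
  have "sink_source f' g' S' Z' s' (\<phi> p1) (\<phi> q1)"
    unfolding sink_source_def
  proof (intro conjI ballI)
    fix z' assume z': "z' \<in> S'"
    show "z' \<in> forward_orbit f' (\<phi> q1) \<or> approaches f' z' (forward_orbit f' (\<phi> p1))"
      by (rule half_transfer[OF p1(1) p(2) p1'(1) _ p1(3,4,6) q1(1,3,4) _ z'])
        (use p1' q1' p conv in auto)
    show "z' \<in> forward_orbit f' (\<phi> p1) \<or> approaches g' z' (forward_orbit f' (\<phi> q1))"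
      using I.half_transfer[of q1 n n' p1 m' z'] q1 q q1' p p1 p1' conv z'
        A.periodic_g B.periodic_g S'
      unfolding op oq op' oq' by auto
  qed (use p1 p q1 q S' in auto)
  then show ?thesis unfolding trivial_dynamics_def by blast
qed

end

section \<open>The maps and their suspension\<close>

text \<open>The break points of \<open>F\<close>, which \<open>F\<close> permutes. Hence a break
  point of \<open>F_rot t\<close>, being rotated into this set, is also mapped into it, and a cycle
  through a break point meets \<open>breaks\<close>. Conditions below are therefore put on the value
  \<open>F_rot t x\<close>.\<close>

definition breaks :: "real set" where
  "breaks = {0, 1/6, 1/2, 5/6}"

definition F_rot_inv :: "real \<Rightarrow> real \<Rightarrow> real" where
  "F_rot_inv t x = frac (F x - t)"

definition F_slope :: "real \<Rightarrow> real \<Rightarrow> real" where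
  "F_slope t x = (if frac (x + t) < 1/6 \<or> 5/6 \<le> frac (x + t) then 2 else 1/2)"

definition good_angle :: "real \<Rightarrow> bool" where
  "good_angle t \<longleftrightarrow> trivial_dynamics (F_rot t) (F_rot_inv t) D breaks (F_slope t)"

lemma F_rot_eq: "F_rot t x = F (frac (x + t))"
  by (simp add: F_rot_def rotation_def)

lemma F_in_D: "x \<in> D \<Longrightarrow> F x \<in> D"
  using bij_betw_F by (auto simp: bij_betw_def)

lemma F_F: "x \<in> D \<Longrightarrow> F (F x) = x"
  by (auto simp: F_def D_def field_simps)

lemma frac_in_D: "frac x \<in> D"
  by (simp add: D_def frac_lt_1)

lemma frac_D: "x \<in> D \<Longrightarrow> frac x = x"
  by (simp add: D_def frac_eq)

lemma frac_add_int: "frac (x + of_int n) = frac x"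
  by (simp add: frac_def)

lemma frac_frac_add: "frac (frac x + y) = frac (x + y)"
  using frac_add_int[of "x + y" "- \<lfloor>x\<rfloor>"] by (simp add: frac_def[of x] algebra_simps)

lemma frac_frac_diff: "frac (frac x - y) = frac (x - y)"
  using frac_frac_add[of x "- y"] by simp

lemma F_breaks: "x \<in> breaks \<Longrightarrow> F x \<in> breaks"
  by (auto simp: breaks_def F_def)

lemma invertible_F_rot: "invertible_map (F_rot t) (F_rot_inv t) D"
proof
  fix x assume x: "x \<in> D"
  show "F_rot t x \<in> D" "F_rot_inv t x \<in> D"
    by (simp_all add: F_rot_eq F_rot_inv_def F_in_D frac_in_D)
  show "F_rot_inv t (F_rot t x) = x"
    using x by (simp add: F_rot_eq F_rot_inv_def F_F frac_in_D frac_frac_diff frac_D)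
  show "F_rot t (F_rot_inv t x) = x"
    using x by (simp add: F_rot_eq F_rot_inv_def frac_frac_add F_F F_in_D frac_D)
qed

lemma F_slope_pos: "F_slope t x > 0"
  by (simp add: F_slope_def)

lemma frac_locally_translation:
  assumes "frac x \<noteq> 0"
  shows "\<exists>\<delta>>0. \<forall>y. \<bar>y - x\<bar> < \<delta> \<longrightarrow> frac y = frac x + (y - x)"
proof (intro exI[of _ "min (frac x) (1 - frac x)"] conjI allI impI)
  show "0 < min (frac x) (1 - frac x)"
    using assms frac_ge_0[of x] frac_lt_1[of x] by linarith
  fix y assume "\<bar>y - x\<bar> < min (frac x) (1 - frac x)"
  then show "frac y = frac x + (y - x)"
    unfolding frac_unique_iff by (auto simp: frac_def)
qed

lemma good_angle_add_int: "good_angle (t + of_int n) = good_angle t"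
proof -
  have "frac (x + (t + of_int n)) = frac (x + t)" "frac (y - (t + of_int n)) = frac (y - t)" for x y
    using frac_add_int[of "x + t" n] frac_add_int[of "y - t" "- n"] by (simp_all add: algebra_simps)
  then have "F_rot_inv (t + of_int n) = F_rot_inv t" "F_slope (t + of_int n) = F_slope t"
    by (auto simp: F_rot_inv_def F_slope_def)
  then show ?thesis by (simp add: good_angle_def F_rot_add_of_int)
qed

text \<open>As \<open>F\<close> is an involution, the inverse of \<open>F_rot t\<close> is
  \<open>F\<close> followed by the rotation by \<open>- t\<close>; conjugating with
  \<open>rotation t\<close> puts the rotation first and gives \<open>F_rot (- t)\<close>.\<close>

lemma conjugate_F_rot_minus:
  "section_conjugacy (F_rot_inv t) (F_rot t) D (F_rot (- t)) (F_rot_inv (- t)) D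
     (\<lambda>z. 1 / F_slope t (F_rot_inv t z)) D (F_slope (- t)) D (rotation t) (rotation (- t)) breaks breaks"
proof -
  interpret A: invertible_map "F_rot t" "F_rot_inv t" D by (rule invertible_F_rot)
  interpret A': invertible_map "F_rot_inv t" "F_rot t" D by (rule A.swap)
  interpret B: invertible_map "F_rot (- t)" "F_rot_inv (- t)" D by (rule invertible_F_rot)
  show ?thesis
  proof unfold_locales
    fix z assume z: "z \<in> D"
    show "rotation t z \<in> D" "rotation (- t) z \<in> D" by (simp_all add: rotation_in_D)
    show "rotation t (rotation (- t) z) = z" "rotation (- t) (rotation t z) = z"
      using z by (simp_all add: rotation_def frac_frac_add frac_D frac_frac_diff)
    have "F_rot (- t) (rotation t z) = rotation t (F_rot_inv t z)"
      using z by (simp add: F_rot_eq F_rot_inv_def rotation_def frac_frac_add frac_frac_diff frac_D F_in_D)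
    moreover have "F_slope (- t) (rotation t z) = 1 / F_slope t (F_rot_inv t z)"
      using z F_in_D[OF z] by (auto simp: F_slope_def F_rot_inv_def rotation_def frac_frac_add frac_frac_diff
          frac_D) (auto simp: F_def D_def split: if_splits)
    ultimately show "matching_returns (F_rot_inv t) (\<lambda>z. 1 / F_slope t (F_rot_inv t z)) D
        (F_rot (- t)) (F_slope (- t)) D (rotation t) z"
      by (intro matching_returns_1_1 A.g_in z)
    show "\<exists>n. (F_rot_inv t ^^ n) z \<in> D" "\<exists>n. (F_rot t ^^ n) z \<in> D"
      "\<exists>n. (F_rot (- t) ^^ n) z \<in> D" "\<exists>n. (F_rot_inv (- t) ^^ n) z \<in> D"
      using z by (auto intro: exI[of _ 0])
  next
    fix z assume z: "z \<in> D" "z \<in> breaks"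
    let ?w = "F_rot_inv (- t) z"
    have "rotation (- t) ?w = F z"
      using z by (simp add: rotation_def F_rot_inv_def frac_frac_diff frac_D F_in_D)
    then have "rotation (- t) ?w \<in> breaks" using F_breaks z by simp
    moreover have "z \<in> forward_orbit (F_rot (- t)) ?w"
      using B.fg[OF z(1)] orbit_funpow[of 1 "F_rot (- t)" ?w] by simp
    ultimately show "\<exists>w'\<in>D. rotation (- t) w' \<in> breaks \<and>
        (z \<in> forward_orbit (F_rot (- t)) w' \<or> w' \<in> forward_orbit (F_rot (- t)) z)"
      using B.g_in z(1) by blast
  next
    fix p m and \<epsilon> :: real
    assume p: "p \<in> D" "0 < m" "(F_rot_inv t ^^ m) p = p" "forward_orbit (F_rot_inv t) p \<inter> breaks = {}"
      and e: "\<epsilon> > 0"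
    \<comment> \<open>\<open>rotation t\<close> could jump at \<open>p\<close> only if
      \<open>frac (p + t) = 0\<close>, and then \<open>F_rot t p = F 0\<close> would be a break
      point on the cycle.\<close>
    have "F_rot t p \<in> forward_orbit (F_rot_inv t) p"
      using A'.g_pow_orbit[OF p(1,3,2), of 1] by simp
    then have "F_rot t p \<notin> breaks" using p(4) by blast
    then have "frac (p + t) \<noteq> 0" 
      using F_breaks[of "frac (p + t)"] by (auto simp: F_rot_eq breaks_def)
    from frac_locally_translation[OF this] obtain d where d: "d > 0"
      "\<And>y. \<bar>y - (p + t)\<bar> < d \<Longrightarrow> frac y = frac (p + t) + (y - (p + t))" by blast
    show "\<exists>\<delta>>0. \<forall>z\<in>D. dist z p < \<delta> \<longrightarrow> z \<in> D \<and> dist (rotation t z) (rotation t p) < \<epsilon>"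
    proof (intro exI[of _ "min d \<epsilon>"] conjI ballI impI)
      fix z assume "dist z p < min d \<epsilon>"
      then show "dist (rotation t z) (rotation t p) < \<epsilon>"
        using d(2)[of "z + t"] by (simp add: dist_real_def rotation_def)
    qed (use d e in auto)
  qed auto
qed

lemma good_angle_minus: "good_angle t \<Longrightarrow> good_angle (- t)"
  unfolding good_angle_def
  by (rule section_conjugacy.trivial_dynamics_transfer[OF conjugate_F_rot_minus])
    (rule invertible_map.trivial_dynamics_inverse[OF invertible_F_rot _ F_slope_pos])

text \<open>\<open>[0,1)\<close> is cut into strips \<open>0,1,2,3\<close>. Flowing upwards in direction \<open>(t, 1)\<close>, one leaves the
  rectangle of height 1 over strip \<open>k\<close> through its top, which is glued to the bottom of the
  rectangle \<open>partner k\<close>, or through its right side into the next rectangle. A flow line in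
  the rectangle is labelled by the abscissa \<open>u\<close> at which it meets the level of the bottom, so lines
  entering from the left have \<open>u < 0\<close>.\<close>

definition width :: "real \<Rightarrow> real" where
  "width k = (if k = 1 \<or> k = 2 then 1/3 else 1/6)"

definition left_end :: "real \<Rightarrow> real" where
  "left_end k = (if k = 0 then 0 else if k = 1 then 1/6 else if k = 2 then 1/2 else 5/6)"

definition partner :: "real \<Rightarrow> real" where
  "partner k = (if k = 0 then 1 else if k = 1 then 0 else if k = 2 then 3 else 2)"

definition next_strip :: "real \<Rightarrow> real" where
  "next_strip k = (if k = 3 then 0 else k + 1)"

definition prev_strip :: "real \<Rightarrow> real" where
  "prev_strip k = (if k = 0 then 3 else k - 1)"

definition strip :: "real \<Rightarrow> real" where
  "strip x = (if x < 1/6 then 0 else if x < 1/2 then 1 else if x < 5/6 then 2 else 3)"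

definition ratio :: "real \<Rightarrow> real" where
  "ratio k = width (partner k) / width k"

text \<open>One step is the passage through one rectangle. Entries through a bottom
  (\<open>0 \<le> u\<close>) and through a left side (\<open>u < 0\<close>) partition
  \<open>H_space\<close>, so both return maps are first returns of the same map.\<close>

definition H :: "real \<Rightarrow> real \<times> real \<Rightarrow> real \<times> real" where
  "H t = (\<lambda>(k, u). if u + t < width k then (partner k, ratio k * (u + t))
                   else (next_strip k, u - width k))"

definition H_inv :: "real \<Rightarrow> real \<times> real \<Rightarrow> real \<times> real" where
  "H_inv t = (\<lambda>(k, u). if 0 \<le> u then (partner k, ratio k * u - t)
                       else (prev_strip k, u + width (prev_strip k)))"

definition H_slope :: "real \<Rightarrow> real \<times> real \<Rightarrow> real" where
  "H_slope t = (\<lambda>(k, u). if u + t < width k then ratio k else 1)"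

definition H_space :: "real \<Rightarrow> (real \<times> real) set" where
  "H_space t = {(k, u). k \<in> {0, 1, 2, 3} \<and> - t \<le> u \<and> u < width k}"

text \<open>The flow lines through the lower left corner (\<open>u = 0\<close>) and the upper left
  corner (\<open>u = - t\<close>) of a rectangle.\<close>

definition H_breaks :: "real \<Rightarrow> (real \<times> real) set" where
  "H_breaks t = {(k, u). k \<in> {0, 1, 2, 3} \<and> (u = 0 \<or> u = - t)}"

definition bottoms :: "(real \<times> real) set" where
  "bottoms = {(k, u). k \<in> {0, 1, 2, 3} \<and> 0 \<le> u \<and> u < width k}"

definition left_sides :: "real \<Rightarrow> (real \<times> real) set" where
  "left_sides t = {(k, u). k \<in> {0, 1, 2, 3} \<and> - t \<le> u \<and> u < 0}"

definition to_strip :: "real \<Rightarrow> real \<times> real" where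
  "to_strip x = (strip x, x - left_end (strip x))"

definition of_strip :: "real \<times> real \<Rightarrow> real" where
  "of_strip = (\<lambda>(k, u). left_end k + u)"

lemmas strip_defs = width_def left_end_def partner_def next_strip_def prev_strip_def ratio_def

section \<open>The flow through the rectangles and its return to the horizontal sides\<close>

lemma strip_cases:
  assumes "k \<in> {0, 1, 2, 3::real}"
  obtains "k = 0" | "k = 1" | "k = 2" | "k = 3"
  using assms by auto

lemma strips_closed:
  "k \<in> {0, 1, 2, 3} \<Longrightarrow> partner k \<in> {0, 1, 2, 3}"
  "k \<in> {0, 1, 2, 3} \<Longrightarrow> next_strip k \<in> {0, 1, 2, 3}"
  "k \<in> {0, 1, 2, 3} \<Longrightarrow> prev_strip k \<in> {0, 1, 2, 3}"
  by (auto simp: strip_defs)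

lemma width_ge: "width k \<ge> 1/6"
  by (simp add: width_def)

lemma invertible_H:
  assumes t: "t > 0"
  shows "invertible_map (H t) (H_inv t) (H_space t)"
proof
  fix z assume "z \<in> H_space t"
  then obtain k u where z: "z = (k, u)" and k: "k \<in> {0, 1, 2, 3}" and u: "- t \<le> u" "u < width k"
    by (auto simp: H_space_def)
  from k show "H t z \<in> H_space t"
    by (cases rule: strip_cases) (use u t in \<open>auto simp: z H_def H_space_def strip_defs\<close>)
  from k show "H_inv t z \<in> H_space t"
    by (cases rule: strip_cases) (use u t in \<open>auto simp: z H_inv_def H_space_def strip_defs\<close>)
  from k show "H_inv t (H t z) = z"
    by (cases rule: strip_cases) (use u t in \<open>auto simp: z H_def H_inv_def strip_defs field_simps\<close>)
  from k show "H t (H_inv t z) = z"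
    by (cases rule: strip_cases) (use u t in \<open>auto simp: z H_def H_inv_def strip_defs field_simps\<close>)
qed

lemma dist_same_label: "dist (k, u) (k, v) = dist u v" for k u v :: real
  by (simp add: dist_prod_def)

text \<open>Strips are labelled by reals so that pairs inherit the product metric; distinct labels
  are at distance at least 1, hence the cap \<open>min \<epsilon> 1\<close>.\<close>

lemma near_same_label:
  assumes "dist z (p :: real \<times> real) < min \<epsilon> 1" "fst z \<in> {0, 1, 2, 3}" "fst p \<in> {0, 1, 2, 3}"
  shows "fst z = fst p" "\<bar>snd z - snd p\<bar> < min \<epsilon> 1"
proof -
  have "dist (fst z) (fst p) < 1" using dist_fst_le[of z p] assms by simp
  then show "fst z = fst p" using assms(2,3) by (auto simp: dist_real_def)
  show "\<bar>snd z - snd p\<bar> < min \<epsilon> 1"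
    using dist_snd_le[of z p] assms(1) unfolding dist_real_def by linarith
qed

lemma locally_affine_continuous:
  fixes f :: "real \<times> real \<Rightarrow> real \<times> real"
  assumes "(k, u) \<in> H_space t" "d > 0"
    and eq: "\<And>v. \<bar>v - u\<bar> < d \<Longrightarrow> f (k, v) = (l, a * v + b)"
  shows "continuous (at (k, u) within H_space t) f"
proof (rule continuous_transform_within)
  show "continuous (at (k, u) within H_space t) (\<lambda>z. (l, a * snd z + b))"
    by (intro continuous_intros)
  show "0 < min d 1" using assms by simp
  fix z assume z: "z \<in> H_space t" "dist z (k, u) < min d 1"
  then have "fst z = k" "\<bar>snd z - u\<bar> < min d 1"
    using near_same_label[OF z(2)] z(1) assms(1) by (auto simp: H_space_def)
  then show "(l, a * snd z + b) = f z" using eq[of "snd z"] z by (metis min_less_iff_conj prod.collapse)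
qed (fact assms(1))

text \<open>The branches change at the flow line through the upper right corner,
  \<open>u + t = width k\<close>, which is sent to the corner line \<open>u = - t\<close> of the
  next rectangle.\<close>

lemma continuous_H:
  assumes z: "z \<in> H_space t" "H t z \<notin> H_breaks t"
  shows "continuous (at z within H_space t) (H t)"
proof -
  obtain k u where ku: "z = (k, u)" "k \<in> {0, 1, 2, 3}" using z by (auto simp: H_space_def)
  have "u + t \<noteq> width k"
    using z(2) strips_closed[OF ku(2)] by (auto simp: ku(1) H_def H_breaks_def)
  then consider "u + t < width k" | "u + t > width k" by linarith
  then show ?thesis
  proof cases
    case 1
    show ?thesis unfolding ku
      by (rule locally_affine_continuous[where d = "width k - (u + t)" and l = "partner k"
            and a = "ratio k" and b = "ratio k * t"]) (use 1 z ku in \<open>auto simp: H_def algebra_simps\<close>)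
  next
    case 2
    show ?thesis unfolding ku
      by (rule locally_affine_continuous[where d = "u + t - width k" and l = "next_strip k"
            and a = 1 and b = "- width k"]) (use 2 z ku in \<open>auto simp: H_def\<close>)
  qed
qed

lemma continuous_H_inv:
  assumes z: "z \<in> H_space t" "z \<notin> H_breaks t"
  shows "continuous (at z within H_space t) (H_inv t)"
proof -
  obtain k u where ku: "z = (k, u)" "k \<in> {0, 1, 2, 3}" using z by (auto simp: H_space_def)
  have "u \<noteq> 0" using z ku by (auto simp: H_breaks_def)
  then consider "u > 0" | "u < 0" by linarith
  then show ?thesis
  proof cases
    case 1
    show ?thesis unfolding ku
      by (rule locally_affine_continuous[where d = u and l = "partner k" and a = "ratio k" and b = "- t"])
        (use 1 z ku in \<open>auto simp: H_inv_def\<close>)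
  next
    case 2
    show ?thesis unfolding ku
      by (rule locally_affine_continuous[where d = "- u" and l = "prev_strip k"
            and a = 1 and b = "width (prev_strip k)"]) (use 2 z ku in \<open>auto simp: H_inv_def\<close>)
  qed
qed

lemma to_strip_in: "x \<in> D \<Longrightarrow> to_strip x \<in> bottoms"
  by (auto simp: to_strip_def bottoms_def strip_def D_def strip_defs)

lemma of_strip_in: "z \<in> bottoms \<Longrightarrow> of_strip z \<in> D"
  by (auto simp: of_strip_def bottoms_def D_def strip_defs)

lemma to_strip_of_strip: "z \<in> bottoms \<Longrightarrow> to_strip (of_strip z) = z"
  by (auto simp: of_strip_def to_strip_def bottoms_def strip_def strip_defs)

lemma of_strip_to_strip: "of_strip (to_strip x) = x"
  by (simp add: of_strip_def to_strip_def)

lemma bottoms_subset: "t > 0 \<Longrightarrow> bottoms \<subseteq> H_space t"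
  by (auto simp: bottoms_def H_space_def)

lemma left_sides_subset: "left_sides t \<subseteq> H_space t"
  by (auto simp: left_sides_def H_space_def width_def)

text \<open>Stated from all of \<open>H_space\<close> so that induction works:
  \<open>left_end k + u\<close> is the abscissa of the flow line at the bottom level, and passing a
  right side changes it only by an integer. Each such passage lowers \<open>u + t\<close> by at
  least \<open>1/6\<close>, which bounds their number by \<open>N\<close>.\<close>

lemma return_to_bottoms:
  assumes "t > 0" "(k, u) \<in> H_space t"
  shows "\<exists>n>0. (H t ^^ n) (k, u) = to_strip (F_rot t (left_end k + u)) \<and>
    (\<forall>j. 0 < j \<longrightarrow> j < n \<longrightarrow> (H t ^^ j) (k, u) \<notin> bottoms) \<and>
    cocycle (H t) (H_slope t) n (k, u) = F_slope t (left_end k + u)"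
proof -
  obtain N :: nat where "6 * (u + t) < N" using reals_Archimedean2 by blast
  then show ?thesis using assms(2)
  proof (induction N arbitrary: k u)
    case 0
    then show ?case by (auto simp: H_space_def)
  next
    case (Suc N)
    have k: "k \<in> {0, 1, 2, 3}" and u: "- t \<le> u" "u < width k"
      using Suc.prems by (auto simp: H_space_def)
    show ?case
    proof (cases "u + t < width k")
      case True
      have frac: "frac (left_end k + u + t) = left_end k + u + t"
        using k by (cases rule: strip_cases) (use True u in \<open>auto simp: frac_eq strip_defs\<close>)
      have "H t (k, u) = to_strip (F_rot t (left_end k + u)) \<and>
          H_slope t (k, u) = F_slope t (left_end k + u)"
        unfolding F_rot_eq F_slope_def frac using k
        by (cases rule: strip_cases)
          (use True u in \<open>auto simp: H_def H_slope_def to_strip_def strip_def F_def strip_defs field_simps\<close>)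
      then show ?thesis by (intro exI[of _ 1]) (simp add: cocycle_def)
    next
      case False
      define k' u' where ku': "k' = next_strip k" "u' = u - width k"
      have step: "H t (k, u) = (k', u')" "H_slope t (k, u) = 1" "u' < 0"
        using False u by (auto simp: H_def H_slope_def ku')
      have "(k', u') \<in> H_space t"
        using invertible_map.f_in[OF invertible_H[OF assms(1)] Suc.prems(2)] step by simp
      moreover have "6 * (u' + t) < N" using Suc.prems(1) width_ge[of k] by (simp add: ku')
      ultimately obtain n where n: "n > 0" "(H t ^^ n) (k', u') = to_strip (F_rot t (left_end k' + u'))"
        "\<And>j. 0 < j \<Longrightarrow> j < n \<Longrightarrow> (H t ^^ j) (k', u') \<notin> bottoms"
        "cocycle (H t) (H_slope t) n (k', u') = F_slope t (left_end k' + u')"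
        using Suc.IH by blast
      have "left_end k' + u' = left_end k + u + of_int (if k = 3 then - 1 else 0)"
        using k by (cases rule: strip_cases) (auto simp: ku' strip_defs)
      then have fr: "frac (left_end k' + u' + t) = frac (left_end k + u + t)"
        using frac_add_int[of "left_end k + u + t"] by (metis add.commute add.left_commute)
      have "F_rot t (left_end k' + u') = F_rot t (left_end k + u)"
        "F_slope t (left_end k' + u') = F_slope t (left_end k + u)"
        using fr by (simp_all add: F_rot_eq F_slope_def)
      moreover have "(k', u') \<notin> bottoms" using step(3) by (simp add: bottoms_def)
      ultimately show ?thesis
        using first_hit_Suc[of "H t" "(k, u)", OF step(1) _ n(2,4) n(3)] step(2) by simp
    qed
  qed
qed

lemma back_to_bottoms:
  assumes "t > 0" "z \<in> H_space t" shows "\<exists>n. (H_inv t ^^ n) z \<in> bottoms"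
proof -
  obtain N :: nat where "- 6 * snd z < N" using reals_Archimedean2 by blast
  then show ?thesis using assms(2)
  proof (induction N arbitrary: z)
    case 0
    then show ?case by (intro exI[of _ 0]) (auto simp: H_space_def bottoms_def)
  next
    case (Suc N)
    show ?case
    proof (cases "0 \<le> snd z")
      case True
      then show ?thesis using Suc.prems by (intro exI[of _ 0]) (auto simp: H_space_def bottoms_def)
    next
      case False
      have "H_inv t z \<in> H_space t" using invertible_map.g_in[OF invertible_H[OF assms(1)] Suc.prems(2)] .
      moreover have "- 6 * snd (H_inv t z) < N"
        using Suc.prems(1) False width_ge[of "prev_strip (fst z)"] by (auto simp: H_inv_def split: prod.splits)
      ultimately obtain n where "(H_inv t ^^ n) (H_inv t z) \<in> bottoms" using Suc.IH by blast
      then show ?thesis by (intro exI[of _ "Suc n"]) (simp add: funpow_swap1)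
    qed
  qed
qed

lemma H_left_corner:
  assumes "t > 0" "k \<in> {0, 1, 2, 3}"
  shows "H t (k, - t) = (partner k, 0)"
  using assms width_ge[of k] by (simp add: H_def)

lemma partner_partner:
  assumes "k \<in> {0, 1, 2, 3}"
  shows "partner (partner k) = k"
  using assms by (auto simp: partner_def)

context
  fixes t :: real assumes t: "t > 0"
begin

lemma section_F_H:
  "section_conjugacy (F_rot t) (F_rot_inv t) D (H t) (H_inv t) (H_space t)
     (F_slope t) D (H_slope t) bottoms to_strip of_strip breaks (H_breaks t)"
proof -
  interpret A: invertible_map "F_rot t" "F_rot_inv t" D by (rule invertible_F_rot)
  interpret B: invertible_map "H t" "H_inv t" "H_space t" by (rule invertible_H[OF t])
  show ?thesis
  proof unfold_locales
    show "bottoms \<subseteq> H_space t" using bottoms_subset t .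
    fix z assume z: "z \<in> D"
    let ?w = "to_strip z"
    have w: "?w \<in> H_space t" using to_strip_in z bottoms_subset t by blast
    have *: "left_end (fst ?w) + snd ?w = z"
      by (simp add: to_strip_def)
    show "matching_returns (F_rot t) (F_slope t) D (H t) (H_slope t) bottoms to_strip z"
      using return_to_bottoms[OF t, of "fst ?w" "snd ?w"] w unfolding *
      by (auto intro: matching_returns_1 A.f_in z)
    show "\<exists>n. (F_rot t ^^ n) z \<in> D" "\<exists>n. (F_rot_inv t ^^ n) z \<in> D" using z by (auto intro: exI[of _ 0])
  next
    fix z assume z: "z \<in> H_space t"
    show "\<exists>n. (H_inv t ^^ n) z \<in> bottoms" using back_to_bottoms[OF t z] .
    show "\<exists>n. (H t ^^ n) z \<in> bottoms"
      using return_to_bottoms[OF t, of "fst z" "snd z"] z to_strip_in A.f_in F_in_D frac_in_D F_rot_eq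
      by (metis prod.collapse)
    assume "z \<in> H_breaks t"
    then obtain k where k: "k \<in> {0, 1, 2, 3}" "z = (k, 0) \<or> z = (k, - t)" by (auto simp: H_breaks_def)
    have *: "(l, 0) \<in> bottoms \<and> of_strip (l, 0) \<in> breaks" if "l \<in> {0, 1, 2, 3}" for l
      using that by (auto simp: bottoms_def width_def of_strip_def left_end_def breaks_def)
    \<comment> \<open>The line through an upper left corner continues as the line through the lower
      left corner of the partner, which belongs to the section.\<close>
    have "(partner k, 0) \<in> forward_orbit (H t) (k, - t)"
      using H_left_corner[OF t k(1)] orbit_funpow[of 1 "H t" "(k, - t)"] by simp
    then show "\<exists>w'\<in>bottoms. of_strip w' \<in> breaks \<and>
        (z \<in> forward_orbit (H t) w' \<or> w' \<in> forward_orbit (H t) z)"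
      using *[OF k(1)] *[OF strips_closed(1)[OF k(1)]] k(2) orbit_self by metis
  next
    fix p m and \<epsilon> :: real
    assume p: "p \<in> D" "forward_orbit (F_rot t) p \<inter> breaks = {}" and e: "\<epsilon> > 0"
    have "p \<notin> breaks" using p(2) orbit_self by fastforce
    define \<delta> where "\<delta> = Min {\<bar>p\<bar>, \<bar>p - 1/6\<bar>, \<bar>p - 1/2\<bar>, \<bar>p - 5/6\<bar>, \<epsilon>}"
    have "\<delta> > 0" using \<open>p \<notin> breaks\<close> e by (auto simp: \<delta>_def breaks_def)
    have near: "\<bar>z - p\<bar> < \<delta> \<Longrightarrow> strip z = strip p \<and> \<bar>z - p\<bar> < \<epsilon>" for z
      by (auto simp: strip_def \<delta>_def)
    show "\<exists>\<delta>>0. \<forall>z\<in>D. dist z p < \<delta> \<longrightarrow> z \<in> D \<and> dist (to_strip z) (to_strip p) < \<epsilon>"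
    proof (intro exI[of _ \<delta>] conjI ballI impI)
      fix z assume "dist z p < \<delta>"
      with near[of z] show "dist (to_strip z) (to_strip p) < \<epsilon>"
        by (simp add: to_strip_def dist_same_label dist_real_def)
    qed (use \<open>\<delta> > 0\<close> in auto)
  next
    show "bottoms = H_space t \<or>
      (\<forall>z\<in>H_space t. z \<notin> H_breaks t \<longrightarrow> H t z \<notin> H_breaks t \<longrightarrow> continuous (at z within H_space t) (H t)) \<and>
      (\<forall>z\<in>H_space t. z \<notin> H_breaks t \<longrightarrow> H_inv t z \<notin> H_breaks t \<longrightarrow>
        continuous (at z within H_space t) (H_inv t))"
      using continuous_H continuous_H_inv by blast
  qed (use to_strip_in of_strip_in to_strip_of_strip of_strip_to_strip in auto)
qed

lemma section_H_F:
  "section_conjugacy (H t) (H_inv t) (H_space t) (F_rot t) (F_rot_inv t) D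
     (H_slope t) bottoms (F_slope t) D of_strip to_strip (H_breaks t) breaks"
proof -
  interpret FH: section_conjugacy "F_rot t" "F_rot_inv t" D "H t" "H_inv t" "H_space t"
     "F_slope t" D "H_slope t" bottoms to_strip of_strip breaks "H_breaks t"
    by (rule section_F_H)
  interpret conjugate_returns "H t" "H_inv t" "H_space t" "F_rot t" "F_rot_inv t" D
     "H_slope t" bottoms "F_slope t" D of_strip to_strip by (rule FH.swap)
  show ?thesis
  proof unfold_locales
    fix z assume "z \<in> breaks"
    then have "z \<in> D" "to_strip z \<in> H_breaks t"
      by (auto simp: breaks_def D_def H_breaks_def to_strip_def strip_def left_end_def)
    then show "\<exists>w'\<in>D. to_strip w' \<in> H_breaks t \<and>
        (z \<in> forward_orbit (F_rot t) w' \<or> w' \<in> forward_orbit (F_rot t) z)"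
      by (intro bexI[of _ z] conjI disjI1 orbit_self)
  next
    fix p m and \<epsilon> :: real
    assume p: "p \<in> bottoms" "forward_orbit (H t) p \<inter> H_breaks t = {}" and e: "\<epsilon> > 0"
    obtain k u where ku: "p = (k, u)" "k \<in> {0, 1, 2, 3}" "0 \<le> u"
      using p by (auto simp: bottoms_def)
    have "p \<notin> H_breaks t" using p(2) orbit_self by fastforce
    then have u: "u > 0" using ku by (auto simp: H_breaks_def)
    show "\<exists>\<delta>>0. \<forall>z\<in>H_space t. dist z p < \<delta> \<longrightarrow> z \<in> bottoms \<and> dist (of_strip z) (of_strip p) < \<epsilon>"
    proof (intro exI[of _ "min (min u \<epsilon>) 1"] conjI ballI impI)
      fix z assume z: "z \<in> H_space t" "dist z p < min (min u \<epsilon>) 1"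
      then have "fst z = k" "\<bar>snd z - u\<bar> < min u \<epsilon>"
        using near_same_label[OF z(2)] ku by (auto simp: H_space_def)
      then show "z \<in> bottoms" "dist (of_strip z) (of_strip p) < \<epsilon>"
        using z ku by (auto simp: bottoms_def H_space_def of_strip_def dist_real_def)
    qed (use u e in auto)
  qed (use FH.hits FH.hits' FH.hits_back FH.hits_back' in auto)
qed

lemma good_angle_iff_H:
  "good_angle t \<longleftrightarrow> trivial_dynamics (H t) (H_inv t) (H_space t) (H_breaks t) (H_slope t)"
  unfolding good_angle_def
  by (rule iffI[OF section_conjugacy.trivial_dynamics_transfer[OF section_F_H]
        section_conjugacy.trivial_dynamics_transfer[OF section_H_F]])

end

text \<open>The rectangles over strips \<open>0,1\<close> form a cylinder of circumference \<open>3/2\<close> (heights being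
  measured on the narrow strip), and so do those over \<open>2,3\<close>. Crossing a cylinder is a rotation
  of its vertical circle, which depends on \<open>1/t\<close> only modulo 9.\<close>

definition narrow :: "real \<Rightarrow> real" where
  "narrow k = (if k = 0 \<or> k = 1 then 0 else 3)"

definition wide :: "real \<Rightarrow> real" where
  "wide k = (if k = 0 \<or> k = 1 then 1 else 2)"

text \<open>On a wide rectangle heights are halved: the gluing doubles lengths from narrow to wide,
  so on the narrow scale the wide rectangle has width \<open>1/6\<close> and height
  \<open>1/2\<close> and sits on top of the narrow one.\<close>

definition height :: "real \<times> real \<Rightarrow> real" where
  "height = (\<lambda>(k, y). if k = 0 \<or> k = 3 then y else 1 + y / 2)"

definition at_height :: "real \<Rightarrow> real \<Rightarrow> real \<times> real" where
  "at_height k c = (if c \<le> 1 then (narrow k, c) else (wide k, 2 * (c - 1)))"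

text \<open>Reduction modulo \<open>3/2\<close> to the interval \<open>(0, 3/2]\<close>.\<close>

definition wrap :: "real \<Rightarrow> real" where
  "wrap c = c - 3/2 * (of_int \<lceil>2/3 * c\<rceil> - 1)"

text \<open>\<open>s\<close> is the slope of the flow lines and \<open>1/6\<close> the width of the
  cylinder. The label only selects which cylinder is crossed.\<close>

definition cross :: "real \<Rightarrow> real \<times> real \<Rightarrow> real \<times> real" where
  "cross s z = at_height (fst z) (wrap (height z + s / 6))"

definition R :: "real \<Rightarrow> real \<times> real \<Rightarrow> real \<times> real" where
  "R s z = apfst next_strip (cross s z)"

definition R_inv :: "real \<Rightarrow> real \<times> real \<Rightarrow> real \<times> real" where
  "R_inv s z = cross (- s) (apfst prev_strip z)"

text \<open>The rotation is isometric on the narrow scale; the quotient of widths converts between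
  the vertical scales of the two rectangles.\<close>

definition R_slope :: "real \<Rightarrow> real \<times> real \<Rightarrow> real" where
  "R_slope s z = width (fst (cross s z)) / width (fst z)"

definition R_space :: "(real \<times> real) set" where
  "R_space = {0, 1, 2, 3} \<times> {0<..1}"

definition R_breaks :: "(real \<times> real) set" where
  "R_breaks = {0, 1, 2, 3} \<times> {1}"

section \<open>Rotations of the cylinders and their symmetries\<close>

lemma wrap_bounds: "0 < wrap c" "wrap c \<le> 3/2"
proof -
  define m :: real where "m = of_int \<lceil>2/3 * c\<rceil>"
  have m: "m - 1 < 2/3 * c" "2/3 * c \<le> m"
    unfolding m_def using ceiling_correct[of "2/3 * c"] by blast+
  have "wrap c = c - 3/2 * (m - 1)" by (simp add: wrap_def m_def)
  with m show "0 < wrap c" "wrap c \<le> 3/2" by (simp_all add: field_simps)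
qed

lemma wrap_add: "wrap (c + 3/2 * of_int n) = wrap c"
proof -
  have "\<lceil>2/3 * (c + 3/2 * of_int n)\<rceil> = \<lceil>2/3 * c\<rceil> + n"
    using ceiling_add_of_int[of "2/3 * c" n] by (simp add: algebra_simps)
  then show ?thesis by (simp add: wrap_def algebra_simps)
qed

lemma wrap_id: assumes "0 < c" "c \<le> 3/2" shows "wrap c = c"
proof -
  have "\<lceil>2/3 * c\<rceil> = 1" using assms by (intro ceiling_unique) auto
  then show ?thesis by (simp add: wrap_def)
qed

lemma wrap_wrap_add: "wrap (wrap c + a) = wrap (c + a)"
  using wrap_add[of "c + a" "1 - \<lceil>2/3 * c\<rceil>"] by (simp add: wrap_def[of c] algebra_simps)

lemma height_bounds: "z \<in> R_space \<Longrightarrow> 0 < height z" "z \<in> R_space \<Longrightarrow> height z \<le> 3/2"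
  by (auto simp: R_space_def height_def)

lemma at_height_height: "z \<in> R_space \<Longrightarrow> at_height (fst z) (height z) = z"
  by (auto simp: R_space_def height_def at_height_def narrow_def wide_def)

lemma height_at_height: "height (at_height k c) = c"
  by (auto simp: height_def at_height_def narrow_def wide_def field_simps)

lemma at_height_in: "0 < c \<Longrightarrow> c \<le> 3/2 \<Longrightarrow> at_height k c \<in> R_space"
  by (auto simp: R_space_def at_height_def narrow_def wide_def)

lemma at_height_at_height: "at_height (fst (at_height k c)) = at_height k"
  by (auto simp: at_height_def narrow_def wide_def fun_eq_iff)

lemma cross_in: "cross s z \<in> R_space"
  unfolding cross_def by (intro at_height_in wrap_bounds)

lemma cross_cross_minus:
  assumes z: "z \<in> R_space" shows "cross (- s) (cross s z) = z"
proof -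
  have "wrap (wrap (height z + s / 6) + - s / 6) = height z"
    unfolding wrap_wrap_add using wrap_id[OF height_bounds(1)[OF z] height_bounds(2)[OF z]] by simp
  then show ?thesis
    unfolding cross_def height_at_height at_height_at_height using z by (simp add: at_height_height)
qed

lemma cross_minus_cross: "z \<in> R_space \<Longrightarrow> cross s (cross (- s) z) = z"
  using cross_cross_minus[of z "- s"] by simp

lemma strip_moves_in:
  "z \<in> R_space \<Longrightarrow> apfst next_strip z \<in> R_space" "z \<in> R_space \<Longrightarrow> apfst prev_strip z \<in> R_space"
  by (auto simp: R_space_def strip_defs)

lemma prev_next:
  "z \<in> R_space \<Longrightarrow> apfst next_strip (apfst prev_strip z) = z"
  "z \<in> R_space \<Longrightarrow> apfst prev_strip (apfst next_strip z) = z"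
  by (auto simp: R_space_def strip_defs)

lemma invertible_R: "invertible_map (R s) (R_inv s) R_space"
  by unfold_locales (simp_all add: R_def R_inv_def cross_in strip_moves_in prev_next
      cross_cross_minus cross_minus_cross)

text \<open>\<open>9/6\<close> is the circumference \<open>3/2\<close>, so adding 9 to the slope
  turns both cylinders once more around.\<close>

lemma R_add_9: "R (s + 9 * of_int n) = R s" "R_inv (s + 9 * of_int n) = R_inv s"
  "R_slope (s + 9 * of_int n) = R_slope s"
proof -
  have "wrap (c + (s + 9 * of_int n) / 6) = wrap (c + s / 6)" for c
    using wrap_add[of "c + s / 6" n] by (simp add: algebra_simps add_divide_distrib)
  moreover have "wrap (c + - (s + 9 * of_int n) / 6) = wrap (c + - s / 6)" for c
    using wrap_add[of "c + - s / 6" "- n"] by (simp add: algebra_simps add_divide_distrib diff_divide_distrib)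
  ultimately have "cross (s + 9 * of_int n) = cross s" "cross (- (s + 9 * of_int n)) = cross (- s)"
    by (simp_all add: cross_def fun_eq_iff)
  then show "R (s + 9 * of_int n) = R s" "R_inv (s + 9 * of_int n) = R_inv s"
    "R_slope (s + 9 * of_int n) = R_slope s"
    by (simp_all add: R_def R_inv_def R_slope_def fun_eq_iff)
qed

definition good_shear :: "real \<Rightarrow> bool" where
  "good_shear s \<longleftrightarrow> trivial_dynamics (R s) (R_inv s) R_space R_breaks (R_slope s)"

lemma good_shear_add_9: "good_shear (s + 9 * of_int n) = good_shear s"
  by (simp add: good_shear_def R_add_9)

definition flip :: "real \<times> real \<Rightarrow> real \<times> real" where
  "flip z = (3 - fst z, snd z)"

lemma flip_in: "z \<in> R_space \<Longrightarrow> flip z \<in> R_space"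
  by (auto simp: R_space_def flip_def)

lemma flip_flip: "flip (flip z) = z"
  by (simp add: flip_def)

lemma flip_next: "z \<in> R_space \<Longrightarrow> apfst next_strip (flip z) = flip (apfst prev_strip z)"
  by (auto simp: R_space_def flip_def strip_defs)

lemma cross_flip: "z \<in> R_space \<Longrightarrow> cross s (flip z) = flip (cross s z)"
proof -
  assume z: "z \<in> R_space"
  have "height (flip z) = height z" using z by (auto simp: R_space_def flip_def height_def)
  moreover have "at_height (fst (flip z)) c = flip (at_height (fst z) c)" for c
    using z by (auto simp: R_space_def flip_def at_height_def narrow_def wide_def)
  ultimately show ?thesis by (simp add: cross_def)
qed

lemma width_flip: "z \<in> R_space \<Longrightarrow> width (fst (flip z)) = width (fst z)"
  by (auto simp: R_space_def flip_def width_def)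

lemma R_space_label: "z \<in> R_space \<Longrightarrow> fst z \<in> {0, 1, 2, 3}"
  by (auto simp: R_space_def)

text \<open>Left-right reflection of the surface. The left side of strip \<open>k\<close> becomes
  the right side of strip \<open>3 - k\<close>, that is, the left side of the strip after it; this
  explains the \<open>prev_strip\<close> under \<open>flip\<close>. Reflection commutes with
  crossing and turns \<open>prev_strip\<close> into \<open>next_strip\<close>, so
  \<open>cross (- s)\<close> after \<open>prev_strip\<close>, the inverse of \<open>R s\<close>,
  becomes \<open>R (- s)\<close>.\<close>

lemma conjugate_R_minus:
  "section_conjugacy (R_inv s) (R s) R_space (R (- s)) (R_inv (- s)) R_space
     (\<lambda>z. 1 / R_slope s (R_inv s z)) R_space (R_slope (- s)) R_space
     (\<lambda>z. flip (apfst prev_strip z)) (\<lambda>z. apfst next_strip (flip z)) R_breaks R_breaks"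
proof -
  interpret A: invertible_map "R s" "R_inv s" R_space by (rule invertible_R)
  interpret A': invertible_map "R_inv s" "R s" R_space by (rule A.swap)
  interpret B: invertible_map "R (- s)" "R_inv (- s)" R_space by (rule invertible_R)
  let ?\<phi> = "\<lambda>z. flip (apfst prev_strip z)"
  show ?thesis
  proof unfold_locales
    fix z assume z: "z \<in> R_space"
    show "?\<phi> z \<in> R_space" "apfst next_strip (flip z) \<in> R_space"
      using z by (simp_all add: flip_in strip_moves_in)
    show "?\<phi> (apfst next_strip (flip z)) = z"
      using z by (simp add: flip_in prev_next flip_flip)
    show "apfst next_strip (flip (?\<phi> z)) = z"
      using z by (simp add: flip_flip prev_next)
    let ?y = "apfst prev_strip z"
    have y: "?y \<in> R_space" using z by (rule strip_moves_in)
    have c: "cross (- s) (flip ?y) = flip (R_inv s z)"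
      using y by (simp add: cross_flip R_inv_def)
    have "R (- s) (?\<phi> z) = ?\<phi> (R_inv s z)"
      using A.g_in[OF z] by (simp add: R_def c flip_next)
    moreover have "cross s (R_inv s z) = ?y"
      using y by (simp add: R_inv_def cross_minus_cross)
    then have "R_slope (- s) (?\<phi> z) = 1 / R_slope s (R_inv s z)"
      using y A.g_in[OF z] by (simp add: R_slope_def c width_flip)
    ultimately show "matching_returns (R_inv s) (\<lambda>z. 1 / R_slope s (R_inv s z)) R_space
        (R (- s)) (R_slope (- s)) R_space ?\<phi> z"
      by (intro matching_returns_1_1 A.g_in z)
    show "\<exists>n. (R_inv s ^^ n) z \<in> R_space" "\<exists>n. (R s ^^ n) z \<in> R_space"
      "\<exists>n. (R (- s) ^^ n) z \<in> R_space" "\<exists>n. (R_inv (- s) ^^ n) z \<in> R_space"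
      by (rule exI[of _ 0], simp add: z)+
  next
    fix z assume z: "z \<in> R_space" "z \<in> R_breaks"
    then have "apfst next_strip (flip z) \<in> R_breaks"
      by (auto simp: R_breaks_def flip_def strip_defs)
    then show "\<exists>w'\<in>R_space. apfst next_strip (flip w') \<in> R_breaks \<and>
        (z \<in> forward_orbit (R (- s)) w' \<or> w' \<in> forward_orbit (R (- s)) z)"
      by (intro bexI[of _ z] conjI disjI1 orbit_self z)
  next
    fix p and \<epsilon> :: real
    assume p: "p \<in> R_space" and e: "\<epsilon> > 0"
    show "\<exists>\<delta>>0. \<forall>z\<in>R_space. dist z p < \<delta> \<longrightarrow> z \<in> R_space \<and> dist (?\<phi> z) (?\<phi> p) < \<epsilon>"
    proof (intro exI[of _ "min \<epsilon> 1"] conjI ballI impI)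
      fix z assume z: "z \<in> R_space" "dist z p < min \<epsilon> 1"
      note * = near_same_label[OF z(2) R_space_label[OF z(1)] R_space_label[OF p]]
      then show "dist (?\<phi> z) (?\<phi> p) < \<epsilon>"
        by (simp add: flip_def dist_same_label dist_real_def)
    qed (use e in auto)
  qed auto
qed

lemma R_slope_pos: "R_slope s z > 0"
  by (simp add: R_slope_def width_def)

lemma good_shear_minus: "good_shear s \<Longrightarrow> good_shear (- s)"
  unfolding good_shear_def
  by (rule section_conjugacy.trivial_dynamics_transfer[OF conjugate_R_minus])
    (rule invertible_map.trivial_dynamics_inverse[OF invertible_R _ R_slope_pos])

section \<open>The return map to the vertical sides\<close>

definition exit_height :: "real \<Rightarrow> real \<times> real \<Rightarrow> real" where
  "exit_height t = (\<lambda>(k, u). if k = 0 \<or> k = 3 then (1/6 - u) / t else 1 + (1/3 - u) / (2 * t))"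

definition to_side :: "real \<Rightarrow> real \<times> real \<Rightarrow> real \<times> real" where
  "to_side t = (\<lambda>(k, u). (k, - u / t))"

definition of_side :: "real \<Rightarrow> real \<times> real \<Rightarrow> real \<times> real" where
  "of_side t = (\<lambda>(k, y). (k, - t * y))"

context
  fixes t :: real assumes t: "t > 0"
begin

lemma to_side_in: "z \<in> left_sides t \<Longrightarrow> to_side t z \<in> R_space"
  using t by (auto simp: left_sides_def R_space_def to_side_def field_simps)

lemma of_side_in: "z \<in> R_space \<Longrightarrow> of_side t z \<in> left_sides t"
  using t by (auto simp: left_sides_def R_space_def of_side_def field_simps)

lemma side_inverse: "to_side t (of_side t z) = z" "of_side t (to_side t z) = z"
  using t by (simp_all add: of_side_def to_side_def split: prod.split)

text \<open>\<open>exit_height\<close> is the height at which the flow line, unrolled from the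
  cylinder, meets its right boundary; \<open>wrap\<close> rolls it up again. Arbitrary starting
  points are allowed for the sake of the induction over the tops crossed on the way.\<close>

lemma return_to_left_sides:
  assumes "(k, u) \<in> H_space t"
  defines "e \<equiv> at_height k (wrap (exit_height t (k, u)))"
  shows "\<exists>n>0. (H t ^^ n) (k, u) = of_side t (apfst next_strip e) \<and>
    (\<forall>j. 0 < j \<longrightarrow> j < n \<longrightarrow> (H t ^^ j) (k, u) \<notin> left_sides t) \<and>
    cocycle (H t) (H_slope t) n (k, u) = width (fst e) / width k"
proof -
  \<comment> \<open>The bracket is the horizontal distance left, on the narrow scale. A passage
    through a top shortens it by \<open>t\<close> or \<open>t / 2\<close>, so the quotient drops by
    at least 1.\<close>
  obtain N :: nat where "(1/6 - u / (6 * width k)) * 2 / t < N" using reals_Archimedean2 by blast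
  then show ?thesis using assms(1) unfolding e_def
  proof (induction N arbitrary: k u)
    case 0
    then have "(1/6 - u / (6 * width k)) * 2 < 0" using t by (simp add: divide_less_0_iff)
    then show ?case using 0 by (auto simp: H_space_def width_def split: if_splits)
  next
    case (Suc N)
    have k: "k \<in> {0, 1, 2, 3}" and u: "- t \<le> u" "u < width k"
      using Suc.prems by (auto simp: H_space_def)
    show ?case
    proof (cases "u + t < width k")
      case False
      from k have "H t (k, u) = of_side t (apfst next_strip (at_height k (wrap (exit_height t (k, u))))) \<and>
          H_slope t (k, u) = width (fst (at_height k (wrap (exit_height t (k, u))))) / width k"
      proof -
        have "0 < exit_height t (k, u)" "exit_height t (k, u) \<le> 3/2"
          using k t False u by (auto simp: exit_height_def width_def field_simps)
        then have w: "wrap (exit_height t (k, u)) = exit_height t (k, u)" by (rule wrap_id)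
        from k show ?thesis unfolding w
          by (cases rule: strip_cases) (use False u t in \<open>auto simp: H_def H_slope_def at_height_def
            exit_height_def of_side_def strip_defs narrow_def wide_def field_simps\<close>)
      qed
      then show ?thesis by (intro exI[of _ 1]) (simp add: cocycle_def)
    next
      case True
      define k' u' where ku': "k' = partner k" "u' = ratio k * (u + t)"
      have step: "H t (k, u) = (k', u')" "H_slope t (k, u) = ratio k" "u' \<ge> 0"
        using True u by (auto simp: H_def H_slope_def ku' ratio_def width_def)
      have "(k', u') \<in> H_space t"
        using invertible_map.f_in[OF invertible_H[OF t] Suc.prems(2)] step by simp
      moreover have "(1/6 - u' / (6 * width k')) * 2 / t < N"
      proof -
        have "(1/6 - u' / (6 * width k')) * 2 / t \<le> (1/6 - u / (6 * width k)) * 2 / t - 1"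
          using k by (cases rule: strip_cases) (use t in \<open>auto simp: ku' strip_defs field_simps\<close>)
        then show ?thesis using Suc.prems(1) by simp
      qed
      ultimately obtain n where n: "n > 0"
        "(H t ^^ n) (k', u') = of_side t (apfst next_strip (at_height k' (wrap (exit_height t (k', u')))))"
        "\<And>j. 0 < j \<Longrightarrow> j < n \<Longrightarrow> (H t ^^ j) (k', u') \<notin> left_sides t"
        "cocycle (H t) (H_slope t) n (k', u') =
          width (fst (at_height k' (wrap (exit_height t (k', u'))))) / width k'"
        using Suc.IH by blast
      \<comment> \<open>From narrow to wide the unrolled height continues; from wide back to narrow
        one full turn of length \<open>3/2\<close> is subtracted.\<close>
      have "exit_height t (k', u') = exit_height t (k, u) + 3/2 * of_int (if k = 0 \<or> k = 3 then 0 else - 1)"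
        using k by (cases rule: strip_cases) (use t in \<open>auto simp: ku' strip_defs exit_height_def field_simps\<close>)
      then have wr: "wrap (exit_height t (k', u')) = wrap (exit_height t (k, u))"
        by (simp only: wrap_add)
      have ah: "at_height k' = at_height k"
        using k by (cases rule: strip_cases) (auto simp: ku' strip_defs at_height_def narrow_def wide_def fun_eq_iff)
      have "ratio k * (a / width k') = a / width k" for a
        by (simp add: ratio_def ku' width_def)
      moreover have "(k', u') \<notin> left_sides t" using step(3) by (simp add: left_sides_def)
      ultimately show ?thesis
        using first_hit_Suc[of "H t" "(k, u)", OF step(1) _ n(2,4) n(3)] step(2) wr ah by simp
    qed
  qed
qed

lemma back_to_left_sides:
  assumes "z \<in> H_space t" shows "\<exists>n. (H_inv t ^^ n) z \<in> left_sides t"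
proof -
  obtain N :: nat where "snd z / width (fst z) / (3 * t) < N" using reals_Archimedean2 by blast
  then show ?thesis using assms(1)
  proof (induction N arbitrary: z)
    case 0
    then have "snd z < 0" using t width_ge[of "fst z"]
      by (auto simp: divide_less_0_iff zero_less_mult_iff mult_less_0_iff)
    then show ?case using 0 by (intro exI[of _ 0]) (auto simp: H_space_def left_sides_def)
  next
    case (Suc N)
    show ?case
    proof (cases "snd z < 0")
      case True
      then show ?thesis using Suc.prems by (intro exI[of _ 0]) (auto simp: H_space_def left_sides_def)
    next
      case False
      have "H_inv t z \<in> H_space t" using invertible_map.g_in[OF invertible_H[OF t] Suc.prems(2)] .
      moreover have "snd (H_inv t z) / width (fst (H_inv t z)) / (3 * t) \<le> snd z / width (fst z) / (3 * t) - 1"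
        using False t by (auto simp: H_inv_def ratio_def width_def field_simps split: prod.splits)
      then have "snd (H_inv t z) / width (fst (H_inv t z)) / (3 * t) < N"
        using Suc.prems(1) by simp
      ultimately obtain n where "(H_inv t ^^ n) (H_inv t z) \<in> left_sides t" using Suc.IH by blast
      then show ?thesis by (intro exI[of _ "Suc n"]) (simp add: funpow_swap1)
    qed
  qed
qed

lemma section_R_H:
  "section_conjugacy (R (1 / t)) (R_inv (1 / t)) R_space (H t) (H_inv t) (H_space t)
     (R_slope (1 / t)) R_space (H_slope t) (left_sides t) (of_side t) (to_side t) R_breaks (H_breaks t)"
proof -
  interpret A: invertible_map "R (1 / t)" "R_inv (1 / t)" R_space by (rule invertible_R)
  interpret B: invertible_map "H t" "H_inv t" "H_space t" by (rule invertible_H[OF t])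
  show ?thesis
  proof unfold_locales
    show "left_sides t \<subseteq> H_space t" by (rule left_sides_subset)
    fix z assume z: "z \<in> R_space"
    obtain k u where ku: "of_side t z = (k, u)" by (cases "of_side t z")
    then have w: "(k, u) \<in> H_space t" using of_side_in[OF z] left_sides_subset by auto
    have k: "k = fst z" using ku by (auto simp: of_side_def split: prod.splits)
    have "exit_height t (k, u) = height z + 1 / t / 6"
      using ku t by (auto simp: of_side_def exit_height_def height_def field_simps split: prod.splits)
    then have e: "at_height k (wrap (exit_height t (k, u))) = cross (1 / t) z"
      by (simp add: cross_def k)
    show "matching_returns (R (1 / t)) (R_slope (1 / t)) R_space (H t) (H_slope t) (left_sides t) (of_side t) z"
      using return_to_left_sides[OF w] unfolding e unfolding ku[symmetric]
      by (auto intro!: matching_returns_1 simp: R_def R_slope_def k strip_moves_in cross_in)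
    show "\<exists>n. (R (1 / t) ^^ n) z \<in> R_space" "\<exists>n. (R_inv (1 / t) ^^ n) z \<in> R_space"
      using z by (auto intro: exI[of _ 0])
  next
    fix z assume z: "z \<in> H_space t"
    show "\<exists>n. (H_inv t ^^ n) z \<in> left_sides t" using back_to_left_sides[OF z] .
    have "of_side t (apfst next_strip (at_height k (wrap c))) \<in> left_sides t" for k c
      by (intro of_side_in strip_moves_in at_height_in wrap_bounds)
    then show "\<exists>n. (H t ^^ n) z \<in> left_sides t"
      using return_to_left_sides[of "fst z" "snd z"] z by (metis prod.collapse)
    assume "z \<in> H_breaks t"
    then obtain k where k: "k \<in> {0, 1, 2, 3}" "z = (k, 0) \<or> z = (k, - t)" by (auto simp: H_breaks_def)
    have *: "(l, - t) \<in> left_sides t \<and> to_side t (l, - t) \<in> R_breaks" if "l \<in> {0, 1, 2, 3}" for l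
      using that t by (auto simp: left_sides_def to_side_def R_breaks_def)
    have "(k, 0) \<in> forward_orbit (H t) (partner k, - t)"
      using H_left_corner[OF t strips_closed(1)[OF k(1)]] partner_partner[OF k(1)]
        orbit_funpow[of 1 "H t" "(partner k, - t)"] by simp
    then show "\<exists>w'\<in>left_sides t. to_side t w' \<in> R_breaks \<and>
        (z \<in> forward_orbit (H t) w' \<or> w' \<in> forward_orbit (H t) z)"
      using *[OF k(1)] *[OF strips_closed(1)[OF k(1)]] k(2) orbit_self by metis
  next
    fix p and \<epsilon> :: real
    assume p: "p \<in> R_space" and e: "\<epsilon> > 0"
    show "\<exists>\<delta>>0. \<forall>z\<in>R_space. dist z p < \<delta> \<longrightarrow> z \<in> R_space \<and> dist (of_side t z) (of_side t p) < \<epsilon>"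
    proof (intro exI[of _ "min (\<epsilon> / t) 1"] conjI ballI impI)
      fix z assume z: "z \<in> R_space" "dist z p < min (\<epsilon> / t) 1"
      note * = near_same_label[OF z(2) R_space_label[OF z(1)] R_space_label[OF p]]
      have "\<bar>t * snd z - t * snd p\<bar> = t * \<bar>snd z - snd p\<bar>"
        using t by (simp add: abs_mult flip: right_diff_distrib)
      also have "\<dots> < \<epsilon>" using *(2) t by (simp add: field_simps)
      finally show "dist (of_side t z) (of_side t p) < \<epsilon>"
        using *(1) by (simp add: of_side_def case_prod_unfold dist_same_label dist_real_def)
    qed (use e t in auto)
  next
    show "left_sides t = H_space t \<or>
      (\<forall>z\<in>H_space t. z \<notin> H_breaks t \<longrightarrow> H t z \<notin> H_breaks t \<longrightarrow> continuous (at z within H_space t) (H t)) \<and>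
      (\<forall>z\<in>H_space t. z \<notin> H_breaks t \<longrightarrow> H_inv t z \<notin> H_breaks t \<longrightarrow>
        continuous (at z within H_space t) (H_inv t))"
      using continuous_H continuous_H_inv by blast
  qed (use to_side_in of_side_in side_inverse in auto)
qed

lemma section_H_R:
  "section_conjugacy (H t) (H_inv t) (H_space t) (R (1 / t)) (R_inv (1 / t)) R_space
     (H_slope t) (left_sides t) (R_slope (1 / t)) R_space (to_side t) (of_side t) (H_breaks t) R_breaks"
proof -
  interpret RH: section_conjugacy "R (1 / t)" "R_inv (1 / t)" R_space "H t" "H_inv t" "H_space t"
     "R_slope (1 / t)" R_space "H_slope t" "left_sides t" "of_side t" "to_side t" R_breaks "H_breaks t"
    by (rule section_R_H)
  interpret conjugate_returns "H t" "H_inv t" "H_space t" "R (1 / t)" "R_inv (1 / t)" R_space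
     "H_slope t" "left_sides t" "R_slope (1 / t)" R_space "to_side t" "of_side t"
    by (rule RH.swap)
  show ?thesis
  proof unfold_locales
    fix z assume "z \<in> R_breaks"
    then have "z \<in> R_space" "of_side t z \<in> H_breaks t"
      by (auto simp: R_breaks_def R_space_def H_breaks_def of_side_def)
    then show "\<exists>w'\<in>R_space. of_side t w' \<in> H_breaks t \<and>
        (z \<in> forward_orbit (R (1 / t)) w' \<or> w' \<in> forward_orbit (R (1 / t)) z)"
      by (intro bexI[of _ z] conjI disjI1 orbit_self)
  next
    fix p m and \<epsilon> :: real
    assume p: "p \<in> left_sides t" "forward_orbit (H t) p \<inter> H_breaks t = {}" and e: "\<epsilon> > 0"
    obtain k u where ku: "p = (k, u)" "k \<in> {0, 1, 2, 3}" "u < 0"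
      using p by (auto simp: left_sides_def)
    define d where "d = min (- u) (t * \<epsilon>)"
    show "\<exists>\<delta>>0. \<forall>z\<in>H_space t. dist z p < \<delta> \<longrightarrow> z \<in> left_sides t \<and> dist (to_side t z) (to_side t p) < \<epsilon>"
    proof (intro exI[of _ "min d 1"] conjI ballI impI)
      show "min d 1 > 0" using ku t e by (simp add: d_def)
      fix z assume z: "z \<in> H_space t" "dist z p < min d 1"
      have "fst z = fst p" "\<bar>snd z - snd p\<bar> < min d 1"
        by (rule near_same_label[OF z(2)]; use z(1) ku in \<open>auto simp: H_space_def\<close>)+
      then have *: "fst z = k" "\<bar>snd z - u\<bar> < d" using ku by auto
      then show "z \<in> left_sides t" using z ku by (auto simp: left_sides_def H_space_def d_def)
      have "\<bar>snd z / t - u / t\<bar> = \<bar>snd z - u\<bar> / t"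
        using t by (simp add: abs_divide flip: diff_divide_distrib)
      also have "\<dots> < \<epsilon>" using *(2) t by (simp add: d_def field_simps)
      finally show "dist (to_side t z) (to_side t p) < \<epsilon>"
        using *(1) ku by (auto simp: to_side_def dist_same_label dist_real_def abs_minus_commute split: prod.splits)
    qed
  qed (use RH.hits RH.hits' RH.hits_back RH.hits_back' in auto)
qed

lemma good_angle_iff_shear: "good_angle t \<longleftrightarrow> good_shear (1 / t)"
  unfolding good_angle_iff_H[OF t] good_shear_def
  by (rule iffI[OF section_conjugacy.trivial_dynamics_transfer[OF section_H_R]
        section_conjugacy.trivial_dynamics_transfer[OF section_R_H]])

end

lemma good_angle_minus_iff: "good_angle (- t) = good_angle t"
  using good_angle_minus[of t] good_angle_minus[of "- t"] by auto

lemma good_shear_minus_iff: "good_shear (- s) = good_shear s"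
  using good_shear_minus[of s] good_shear_minus[of "- s"] by auto

text \<open>The suspension flow is set up for \<open>t > 0\<close>; negative angles follow from the
  reflection symmetries on both sides.\<close>

theorem good_angle_iff_good_shear:
  assumes "t \<noteq> 0" shows "good_angle t \<longleftrightarrow> good_shear (1 / t)"
proof (cases "t > 0")
  case False
  then have "good_angle (- t) \<longleftrightarrow> good_shear (1 / - t)"
    using assms by (intro good_angle_iff_shear) simp
  then show ?thesis by (simp add: good_angle_minus_iff good_shear_minus_iff)
qed (rule good_angle_iff_shear)

lemma good_angle_shear:
  assumes "t \<noteq> 0" "t' \<noteq> 0" "1 / t' = 1 / t + 9 * of_int n"
  shows "good_angle t' = good_angle t"
  using assms by (simp add: good_angle_iff_good_shear good_shear_add_9)

section \<open>The exceptional angles form a null set\<close>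

text \<open>The inverse branches of \<open>t \<mapsto> t'\<close>, where \<open>1/t' = 1/t - 9m\<close> and \<open>v = t' - n\<close>.\<close>

definition branch :: "int \<Rightarrow> int \<Rightarrow> real \<Rightarrow> real" where
  "branch m n v = (of_int n + v) / (9 * of_int m * (of_int n + v) + 1)"

lemma branch_deriv:
  assumes "9 * of_int m * (of_int n + v) + 1 \<noteq> (0::real)"
  shows "(branch m n has_field_derivative 1 / (9 * of_int m * (of_int n + v) + 1)\<^sup>2) (at v within S)"
  unfolding branch_def using assms
  by (auto intro!: derivative_eq_intros simp: power2_eq_square field_simps)

text \<open>\<open>\<bar>n + v\<bar> \<ge> 7/9 * \<bar>n\<bar>\<close> makes the product at least
  \<open>7 * \<bar>m * n\<bar>\<close>, and the summand 1 costs at most another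
  \<open>\<bar>m * n\<bar>\<close>.\<close>

lemma branch_denominator:
  fixes v :: real
  assumes "m \<noteq> 0" "n \<noteq> 0" "\<bar>v\<bar> \<le> 2/9"
  shows "6 * \<bar>of_int m * of_int n\<bar> \<le> \<bar>9 * of_int m * (of_int n + v) + 1\<bar>"
proof -
  have m: "1 \<le> \<bar>of_int m :: real\<bar>" and n: "1 \<le> \<bar>of_int n :: real\<bar>" using assms by linarith+
  have "7/9 * \<bar>of_int n\<bar> \<le> \<bar>of_int n + v\<bar>" using n assms(3) by linarith
  then have "\<bar>of_int m\<bar> * (7/9 * \<bar>of_int n\<bar>) \<le> \<bar>of_int m\<bar> * \<bar>of_int n + v\<bar>"
    using m by (intro mult_left_mono) auto
  then have "7 * \<bar>of_int m * of_int n\<bar> \<le> \<bar>9 * of_int m * (of_int n + v)\<bar>"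
    by (simp add: abs_mult)
  moreover have "1 \<le> \<bar>of_int m * of_int n :: real\<bar>"
    using mult_mono[OF m n] by (simp add: abs_mult)
  ultimately show ?thesis by linarith
qed

text \<open>Change of variables along an injective branch, whose derivative is the reciprocal of the
  squared denominator.\<close>

lemma branch_image_measure:
  assumes B: "B \<in> lmeasurable" "B \<subseteq> {-2/9..2/9}" and mn: "m \<noteq> 0" "n \<noteq> 0"
  shows "branch m n ` B \<in> lmeasurable"
    and "measure lebesgue (branch m n ` B) \<le> measure lebesgue B / (36 * (of_int m)\<^sup>2 * (of_int n)\<^sup>2)"
proof -
  define g' where "g' v = 1 / (9 * of_int m * (of_int n + v) + 1 :: real)\<^sup>2" for v
  define L :: real where "L = 1 / (36 * (of_int m)\<^sup>2 * (of_int n)\<^sup>2)"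
  have den: "6 * \<bar>of_int m * of_int n\<bar> \<le> \<bar>9 * of_int m * (of_int n + v) + 1\<bar>" if "v \<in> B" for v
    using branch_denominator[OF mn] that B(2) by (force simp: abs_le_iff)
  have pos: "0 < 6 * \<bar>of_int m * of_int n :: real\<bar>" using mn by simp
  have nz: "9 * of_int m * (of_int n + v) + 1 \<noteq> 0" if "v \<in> B" for v
    using den[OF that] pos by linarith
  have bound: "\<bar>g' v\<bar> \<le> L" if "v \<in> B" for v
  proof -
    have "(6 * \<bar>of_int m * of_int n\<bar>)\<^sup>2 \<le> \<bar>9 * of_int m * (of_int n + v) + 1\<bar>\<^sup>2"
      using den[OF that] pos by (intro power_mono) auto
    then have "36 * (of_int m)\<^sup>2 * (of_int n)\<^sup>2 \<le> (9 * of_int m * (of_int n + v) + 1)\<^sup>2"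
      by (simp add: power_mult_distrib)
    then show ?thesis unfolding g'_def L_def using mn by (simp add: frac_le)
  qed
  have inj: "inj_on (branch m n) B"
  proof (rule inj_onI)
    fix x y assume xy: "x \<in> B" "y \<in> B" "branch m n x = branch m n y"
    then show "x = y" using nz[OF xy(1)] nz[OF xy(2)]
      by (simp add: branch_def frac_eq_eq) (simp add: algebra_simps)
  qed
  have cont: "continuous_on B (\<lambda>v. \<bar>g' v\<bar>)"
    unfolding g'_def by (intro continuous_intros) (use nz in auto)
  have "(\<lambda>v. \<bar>g' v\<bar>) absolutely_integrable_on B"
  proof (rule measurable_bounded_by_integrable_imp_absolutely_integrable)
    show "(\<lambda>v. \<bar>g' v\<bar>) \<in> borel_measurable (lebesgue_on B)"
      by (rule continuous_imp_measurable_on_sets_lebesgue[OF cont]) (use B in auto)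
    show "(\<lambda>v. L) integrable_on B" by (rule integrable_on_const[OF B(1)])
  qed (use B bound in auto)
  then have 1: "(\<lambda>v. \<bar>g' v\<bar> * 1) absolutely_integrable_on B" by simp
  have cov: "(\<lambda>v. 1::real) absolutely_integrable_on (branch m n ` B) \<and>
    integral (branch m n ` B) (\<lambda>v. 1::real) = integral B (\<lambda>v. \<bar>g' v\<bar> * 1)"
    using has_absolute_integral_change_of_variables_1'[of B "branch m n" g' "\<lambda>v. 1" "integral B (\<lambda>v. \<bar>g' v\<bar> * 1)"]
      branch_deriv nz inj 1 B unfolding g'_def by blast
  then show lm: "branch m n ` B \<in> lmeasurable"
    by (simp add: lmeasurable_iff_integrable_on set_lebesgue_integral_eq_integral(1))
  have "measure lebesgue (branch m n ` B) = integral B (\<lambda>v. \<bar>g' v\<bar>)"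
    using cov lmeasure_integral[OF lm] by simp
  also have "\<dots> \<le> integral B (\<lambda>v. L)"
    using 1 bound integrable_on_const[OF B(1)]
    by (intro integral_le) (auto dest: set_lebesgue_integral_eq_integral(1))
  also have "\<dots> = L * measure lebesgue B"
    using lmeasure_integral[OF B(1)] integral_mult_right[of B L "\<lambda>v. 1"] by simp
  finally show "measure lebesgue (branch m n ` B) \<le> measure lebesgue B / (36 * (of_int m)\<^sup>2 * (of_int n)\<^sup>2)"
    by (simp add: L_def)
qed

text \<open>The crude bound \<open>pi < 4\<close> in \<open>pi^2 / 6\<close> is enough to keep the
  final factor below 1.\<close>

lemma suminf_inverse_squares: "(\<Sum>i. ennreal (c / (real i + 1)\<^sup>2)) \<le> ennreal (8/3 * c)" if "c \<ge> 0"
proof -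
  have s: "(\<lambda>i. c * (1 / (real i + 1)\<^sup>2)) sums (c * (pi\<^sup>2 / 6))"
    using sums_mult[OF inverse_squares_sums, of c] by (simp add: add.commute)
  have "pi\<^sup>2 \<le> 4\<^sup>2" using pi_less_4 pi_gt_zero by (intro power_mono) auto
  then have "c * (pi\<^sup>2 / 6) \<le> c * (8/3)" using that by (intro mult_left_mono) auto
  then show ?thesis
    using s that by (subst suminf_ennreal2) (auto simp: sums_iff mult.commute intro!: ennreal_leI)
qed

lemma branch_images_measure:
  assumes B: "B \<in> lmeasurable" "B \<subseteq> {-2/9..2/9}"
  defines "C \<equiv> \<Union>m\<in>-{0}. \<Union>n\<in>-{0}. branch m n ` B"
  shows "C \<in> lmeasurable" "measure lebesgue C \<le> 64/81 * measure lebesgue B"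
proof -
  define \<mu> where "\<mu> = measure lebesgue B"
  \<comment> \<open>\<open>A i j\<close> unites the four branches with
    \<open>\<bar>m\<bar> = i + 1\<close> and \<open>\<bar>n\<bar> = j + 1\<close>; four times
    \<open>1/36\<close> is the \<open>1/9\<close> in \<open>c\<close>.\<close>
  define A where "A i j = (\<Union>m\<in>{int (Suc i), - int (Suc i)}. \<Union>n\<in>{int (Suc j), - int (Suc j)}. branch m n ` B)" for i j
  define c where "c i = \<mu> / 9 / (real i + 1)\<^sup>2" for i
  have \<mu>: "\<mu> \<ge> 0" by (simp add: \<mu>_def)
  have A: "A i j \<in> lmeasurable \<and> measure lebesgue (A i j) \<le> c i / (real j + 1)\<^sup>2" for i j
  proof -
    have one: "branch m n ` B \<in> lmeasurable \<and> measure lebesgue (branch m n ` B) \<le> \<mu> / 36 / (real i + 1)\<^sup>2 / (real j + 1)\<^sup>2"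
      if "m \<in> {int (Suc i), - int (Suc i)}" "n \<in> {int (Suc j), - int (Suc j)}" for m n
    proof -
      have "\<bar>m\<bar> = 1 + int i" "\<bar>n\<bar> = 1 + int j" using that by auto
      then have "\<bar>of_int m\<bar> = 1 + real i" "\<bar>of_int n\<bar> = 1 + real j" by linarith+
      then have "m \<noteq> 0" "n \<noteq> 0" "(of_int m)\<^sup>2 = (real i + 1)\<^sup>2" "(of_int n)\<^sup>2 = (real j + 1)\<^sup>2"
        by (auto simp: add.commute simp flip: power2_abs[of "of_int m"] power2_abs[of "of_int n"])
      then show ?thesis using branch_image_measure[OF B, of m n] unfolding \<mu>_def
        by (simp add: mult.assoc)
    qed
    define b where "b = \<mu> / 36 / (real i + 1)\<^sup>2 / (real j + 1)\<^sup>2"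
    let ?p = "int (Suc i)" and ?q = "int (Suc j)"
    have eq: "A i j = (branch ?p ?q ` B \<union> branch ?p (- ?q) ` B) \<union> (branch (- ?p) ?q ` B \<union> branch (- ?p) (- ?q) ` B)"
      by (auto simp: A_def)
    have un: "X \<union> Y \<in> lmeasurable \<and> measure lebesgue (X \<union> Y) \<le> x + y"
      if "X \<in> lmeasurable \<and> measure lebesgue X \<le> x" "Y \<in> lmeasurable \<and> measure lebesgue Y \<le> y"
      for X Y :: "real set" and x y
      using that measure_Un_le[of X lebesgue Y] by (auto simp: fmeasurableD)
    have "A i j \<in> lmeasurable \<and> measure lebesgue (A i j) \<le> (b + b) + (b + b)"
      unfolding eq b_def by (intro un one) auto
    then show ?thesis by (simp add: b_def c_def)
  qed
  have cpos: "c i \<ge> 0" for i using \<mu> by (simp add: c_def)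
  have meas: "A i j \<in> sets lebesgue" for i j using A by blast
  have Ceq: "C = (\<Union>i. \<Union>j. A i j)"
  proof
    show "(\<Union>i. \<Union>j. A i j) \<subseteq> C" unfolding A_def C_def by fastforce
    show "C \<subseteq> (\<Union>i. \<Union>j. A i j)"
    proof
      fix x assume "x \<in> C"
      then obtain m n where mn: "m \<noteq> 0" "n \<noteq> 0" "x \<in> branch m n ` B" by (auto simp: C_def)
      have "m \<in> {int (Suc (nat \<bar>m\<bar> - 1)), - int (Suc (nat \<bar>m\<bar> - 1))}"
        "n \<in> {int (Suc (nat \<bar>n\<bar> - 1)), - int (Suc (nat \<bar>n\<bar> - 1))}" using mn by auto
      then have "x \<in> A (nat \<bar>m\<bar> - 1) (nat \<bar>n\<bar> - 1)" using mn(3) unfolding A_def by blast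
      then show "x \<in> (\<Union>i. \<Union>j. A i j)" by blast
    qed
  qed
  have "emeasure lebesgue (\<Union>j. A i j) \<le> ennreal (8/3 * c i)" for i
  proof -
    have "emeasure lebesgue (\<Union>j. A i j) \<le> (\<Sum>j. emeasure lebesgue (A i j))"
      using meas by (intro emeasure_subadditive_countably) auto
    also have "\<dots> \<le> (\<Sum>j. ennreal (c i / (real j + 1)\<^sup>2))"
      using A by (intro suminf_le) (auto simp: emeasure_eq_measure2 intro!: ennreal_leI)
    also have "\<dots> \<le> ennreal (8/3 * c i)" by (rule suminf_inverse_squares[OF cpos])
    finally show ?thesis .
  qed
  moreover have "emeasure lebesgue C \<le> (\<Sum>i. emeasure lebesgue (\<Union>j. A i j))"
    unfolding Ceq using meas by (intro emeasure_subadditive_countably) auto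
  ultimately have "emeasure lebesgue C \<le> (\<Sum>i. ennreal (8/3 * c i))"
    by (meson order_trans suminf_le summableI)
  also have "\<dots> = (\<Sum>i. ennreal (8/3 * (\<mu> / 9) / (real i + 1)\<^sup>2))" by (simp add: c_def)
  also have "\<dots> \<le> ennreal (8/3 * (8/3 * (\<mu> / 9)))" using \<mu> by (intro suminf_inverse_squares) simp
  also have "8/3 * (8/3 * (\<mu> / 9)) = 64/81 * \<mu>" by simp
  finally have le: "emeasure lebesgue C \<le> ennreal (64/81 * \<mu>)" .
  have "C \<in> sets lebesgue" unfolding Ceq using meas by auto
  then show "C \<in> lmeasurable" using le by (intro fmeasurableI) (auto intro: le_less_trans)
  then show "measure lebesgue C \<le> 64/81 * measure lebesgue B"
    using le \<mu> by (simp add: emeasure_eq_measure2 \<mu>_def)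
qed

text \<open>\<open>m\<close> rounds \<open>1/t\<close> to a multiple of 9, and
  \<open>m \<noteq> 0\<close> because \<open>\<bar>1/t\<bar> > 9/2\<close>. The angles
  \<open>1 / (9 * m)\<close> are excluded since there the reduced slope \<open>s'\<close> vanishes
  and has no reciprocal.\<close>

lemma renormalization_step:
  fixes t :: real
  assumes "t \<noteq> 0" "\<bar>t\<bar> < 2/9" "t \<notin> range (\<lambda>m::int. 1 / (9 * of_int m))"
  obtains m n :: int and v where "m \<noteq> 0" "\<bar>v\<bar> \<le> 1/2" "2/9 \<le> \<bar>of_int n + v\<bar>"
    "1 / (of_int n + v) = 1 / t + 9 * of_int (- m)" "t = branch m n v"
    "9 * of_int m * (of_int n + v) + 1 \<noteq> 0"
proof -
  define m where "m = round (1 / t / 9)"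
  define s' where "s' = 1 / t - 9 * of_int m"
  define n where "n = round (1 / s')"
  define v where "v = 1 / s' - of_int n"
  have "1 / \<bar>t\<bar> > 9/2" using assms by (simp add: field_simps)
  then have big: "\<bar>1 / t\<bar> > 9/2" by simp
  have r: "\<bar>of_int m - 1 / t / 9\<bar> \<le> 1/2" unfolding m_def by (rule of_int_round_abs_le)
  have "m \<noteq> 0"
  proof
    assume "m = 0"
    then have "\<bar>1 / t\<bar> \<le> 9/2" using r by simp
    then show False using big by linarith
  qed
  have s': "\<bar>s'\<bar> \<le> 9/2" using r unfolding s'_def abs_le_iff by simp
  have "s' \<noteq> 0"
  proof
    assume "s' = 0"
    then have "1 / (1 / t) = 1 / (9 * of_int m)" by (simp add: s'_def)
    then have "t = 1 / (9 * of_int m)" by simp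
    then show False using assms(3) by blast
  qed
  have nv: "of_int n + v = 1 / s'" by (simp add: v_def)
  have "\<bar>v\<bar> \<le> 1/2" using of_int_round_abs_le[of "1 / s'"] by (simp add: v_def n_def abs_minus_commute)
  moreover have "2/9 \<le> \<bar>of_int n + v\<bar>" unfolding nv using s' \<open>s' \<noteq> 0\<close> by (simp add: field_simps)
  moreover have "1 / (of_int n + v) = 1 / t + 9 * of_int (- m)" unfolding nv by (simp add: s'_def)
  moreover have den: "9 * of_int m * (of_int n + v) + 1 = 1 / (t * s')"
    unfolding nv using \<open>s' \<noteq> 0\<close> assms(1) by (simp add: field_simps) (simp add: s'_def field_simps)
  then have "9 * of_int m * (of_int n + v) + 1 \<noteq> 0" using \<open>s' \<noteq> 0\<close> assms(1) by simp
  moreover have "t = branch m n v"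
    unfolding branch_def den using \<open>s' \<noteq> 0\<close> by (simp add: nv)
  ultimately show thesis using that \<open>m \<noteq> 0\<close> by blast
qed

text \<open>For images of null sets no bound on the derivative is asked for, so \<open>n = 0\<close>
  is allowed as well.\<close>

lemma negligible_branch_image:
  assumes "negligible B" "\<And>v. v \<in> B \<Longrightarrow> 9 * of_int m * (of_int n + v) + 1 \<noteq> 0"
  shows "negligible (branch m n ` B)"
proof (rule negligible_differentiable_image_negligible[OF _ assms(1)])
  show "branch m n differentiable_on B"
    unfolding differentiable_on_def
  proof
    fix v assume "v \<in> B"
    then have "branch m n field_differentiable (at v within B)"
      unfolding field_differentiable_def using branch_deriv[OF assms(2)] by blast
    then show "branch m n differentiable (at v within B)"
      by (rule field_differentiable_imp_differentiable)
  qed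
qed simp

text \<open>Let \<open>K1\<close> be the part of \<open>K\<close> in \<open>[-2/9, 2/9]\<close>.
  Renormalization covers \<open>K1\<close> by a null set and the branch images of \<open>K1\<close>
  with \<open>m\<close> and \<open>n\<close> nonzero. Each application of this covering multiplies
  the measure by at most \<open>64/81\<close>, so the outer measure of \<open>K1\<close> is
  zero.\<close>

theorem negligible_if_invariant:
  fixes K :: "real set"
  assumes transl: "\<And>t n. t \<in> K \<Longrightarrow> t + of_int n \<in> K"
    and shear: "\<And>t t' n. t \<in> K \<Longrightarrow> t \<noteq> 0 \<Longrightarrow> t' \<noteq> 0 \<Longrightarrow> 1 / t' = 1 / t + 9 * of_int n \<Longrightarrow> t' \<in> K"
    and base: "negligible (K \<inter> {2/9<..<7/9})"
  shows "negligible K"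
proof -
  define B0 where "B0 = {v \<in> K. 2/9 \<le> \<bar>v\<bar> \<and> \<bar>v\<bar> \<le> 1/2}"
  define K1 where "K1 = {v \<in> K. \<bar>v\<bar> \<le> 2/9}"
  define X where "X = insert (2/9) (insert (-2/9) ((K \<inter> {2/9<..<7/9}) \<union> (+) (- 1) ` (K \<inter> {2/9<..<7/9})))"
  have "negligible X"
    unfolding X_def using base by (intro negligible_insert[THEN iffD2] negligible_Un negligible_translation)
  moreover have "B0 \<subseteq> X"
  proof
    fix v assume v: "v \<in> B0"
    consider "v = 2/9" | "v = -2/9" | "2/9 < v" | "v < -2/9" using v unfolding B0_def by fastforce
    then show "v \<in> X"
    proof cases
      case 4
      have "v + of_int 1 \<in> K" using v transl unfolding B0_def by blast
      then have "v + 1 \<in> K \<inter> {2/9<..<7/9}" using v 4 by (simp add: B0_def)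
      then have "v \<in> (+) (- 1) ` (K \<inter> {2/9<..<7/9})" by (intro image_eqI[of _ _ "v + 1"]) auto
      then show ?thesis by (simp add: X_def)
    qed (use v in \<open>auto simp: B0_def X_def\<close>)
  qed
  ultimately have B0: "negligible B0" using negligible_subset by blast
  \<comment> \<open>\<open>N\<close> collects what needs no estimate: boundary points, points where
    the step is undefined, and angles sent into the null set \<open>B0\<close>.\<close>
  define N where "N = {0, 2/9, -2/9} \<union> range (\<lambda>m::int. 1 / (9 * of_int m :: real)) \<union>
    (\<Union>m. \<Union>n. branch m n ` {v \<in> B0. 9 * of_int m * (of_int n + v) + 1 \<noteq> 0})"
  have N: "negligible N"
    unfolding N_def
  proof (intro negligible_Un)
    have "countable (range (\<lambda>m::int. 1 / (9 * of_int m :: real)))" by simp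
    then show "negligible (range (\<lambda>m::int. 1 / (9 * of_int m :: real)))" 
      by (simp add: negligible_iff_null_sets countable_imp_null_set_lborel null_sets_completionI)
    show "negligible (\<Union>m. \<Union>n. branch m n ` {v \<in> B0. 9 * of_int m * (of_int n + v) + 1 \<noteq> 0})"
      by (intro negligible_countable_Union countable_image countableI_type)
        (auto intro!: negligible_branch_image intro: negligible_subset[OF B0])
  qed (simp add: negligible_finite)
  have cover: "K1 \<subseteq> N \<union> (\<Union>m\<in>-{0}. \<Union>n\<in>-{0}. branch m n ` K1)"
  proof
    fix t assume t: "t \<in> K1"
    show "t \<in> N \<union> (\<Union>m\<in>-{0}. \<Union>n\<in>-{0}. branch m n ` K1)"
    proof (cases "t \<in> {0, 2/9, -2/9} \<union> range (\<lambda>m::int. 1 / (9 * of_int m))")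
      case True
      then show ?thesis by (auto simp: N_def)
    next
      case False
      then have t': "t \<noteq> 0" "\<bar>t\<bar> < 2/9" "t \<notin> range (\<lambda>m::int. 1 / (9 * of_int m))"
        using t by (auto simp: K1_def abs_le_iff abs_less_iff)
      obtain m n :: int and v where *: "m \<noteq> 0" "\<bar>v\<bar> \<le> 1/2" "2/9 \<le> \<bar>of_int n + v\<bar>"
        "1 / (of_int n + v) = 1 / t + 9 * of_int (- m)" "t = branch m n v"
        "9 * of_int m * (of_int n + v) + 1 \<noteq> 0"
        using renormalization_step[OF t'] .
      have "of_int n + v \<in> K"
        by (rule shear[OF _ t'(1) _ *(4)]) (use t *(3) in \<open>auto simp: K1_def\<close>)
      then have v: "v \<in> K" using transl[of "of_int n + v" "- n"] by simp
      show ?thesis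
      proof (cases "2/9 \<le> \<bar>v\<bar>")
        case True
        then have "v \<in> B0" using v * by (simp add: B0_def)
        then show ?thesis using * by (auto simp: N_def)
      next
        case False
        then have "n \<noteq> 0" "v \<in> K1" using * v by (auto simp: K1_def)
        then show ?thesis using * by blast
      qed
    qed
  qed
  \<comment> \<open>\<open>K1\<close> is not known to be measurable, so the estimate is applied to
    measurable sets \<open>B\<close> around it.\<close>
  have approx: "\<exists>B. K1 \<subseteq> B \<and> B \<in> lmeasurable \<and> B \<subseteq> {-2/9..2/9} \<and> measure lebesgue B \<le> (64/81) ^ j" for j
  proof (induction j)
    case 0
    show ?case by (intro exI[of _ "{-2/9..2/9}"]) (auto simp: K1_def)
  next
    case (Suc j)
    then obtain B where B: "K1 \<subseteq> B" "B \<in> lmeasurable" "B \<subseteq> {-2/9..2/9}" "measure lebesgue B \<le> (64/81) ^ j"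
      by blast
    define C where "C = (\<Union>m\<in>-{0}. \<Union>n\<in>-{0}. branch m n ` B)"
    have C: "C \<in> lmeasurable" "measure lebesgue C \<le> 64/81 * measure lebesgue B"
      unfolding C_def by (rule branch_images_measure[OF B(2,3)])+
    have NM: "N \<in> lmeasurable" "measure lebesgue N = 0"
      using N negligible_imp_measurable negligible_imp_measure0 by auto
    have U: "N \<union> C \<in> lmeasurable" using NM C by blast
    \<comment> \<open>Cutting back to the interval restores the hypothesis of the branch estimate
      for the next round.\<close>
    show ?case
    proof (intro exI[of _ "(N \<union> C) \<inter> {-2/9..2/9}"] conjI)
      have "K1 \<subseteq> N \<union> C" using cover B(1) unfolding C_def by fastforce
      then show "K1 \<subseteq> (N \<union> C) \<inter> {-2/9..2/9}" by (auto simp: K1_def)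
      show I: "(N \<union> C) \<inter> {-2/9..2/9} \<in> lmeasurable"
        using U by (intro fmeasurable_Int_fmeasurable) auto
      have "measure lebesgue ((N \<union> C) \<inter> {-2/9..2/9}) \<le> measure lebesgue (N \<union> C)"
        using U I by (intro measure_mono_fmeasurable) auto
      also have "\<dots> \<le> measure lebesgue N + measure lebesgue C"
        using NM C by (intro measure_Un_le) auto
      also have "\<dots> \<le> (64/81) ^ Suc j" using NM(2) C(2) B(4) by simp
      finally show "measure lebesgue ((N \<union> C) \<inter> {-2/9..2/9}) \<le> (64/81) ^ Suc j" .
    qed simp
  qed
  have K1: "negligible K1"
    unfolding negligible_outer_le
  proof (intro allI impI)
    fix e :: real assume "e > 0"
    then obtain j where "(64/81::real) ^ j < e" using real_arch_pow_inv[of e "64/81"] by auto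
    then show "\<exists>T. K1 \<subseteq> T \<and> T \<in> lmeasurable \<and> measure lebesgue T \<le> e"
      using approx[of j] by (meson less_imp_le order_trans)
  qed
  have "K \<subseteq> (\<Union>n. (+) (of_int n) ` (K1 \<union> B0))"
  proof
    fix t assume t: "t \<in> K"
    define v where "v = t - of_int (round t)"
    have "v \<in> K" using transl[OF t, of "- round t"] by (simp add: v_def)
    moreover have "\<bar>v\<bar> \<le> 1/2" using of_int_round_abs_le[of t] by (simp add: v_def abs_minus_commute)
    ultimately have "v \<in> K1 \<union> B0" by (auto simp: K1_def B0_def)
    then show "t \<in> (\<Union>n. (+) (of_int n) ` (K1 \<union> B0))"
      by (intro UN_I[of "round t"] image_eqI[of _ _ v]) (auto simp: v_def)
  qed
  moreover have "negligible (\<Union>n::int. (+) (of_int n :: real) ` (K1 \<union> B0))"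
    using K1 B0 by (intro negligible_countable_Union countable_image countableI_type)
      (auto intro: negligible_translation)
  ultimately show ?thesis using negligible_subset by blast
qed

section \<open>Contracted rotations\<close>

text \<open>\<open>u / 2 + d\<close> modulo 1. For \<open>1/2 < d < 1\<close> it wraps once, at
  \<open>2 - 2 * d\<close>, and its range on \<open>[0,1)\<close> omits exactly
  \<open>[d - 1/2, d)\<close>, which is \<open>gap d 1\<close>.\<close>

definition contracted :: "real \<Rightarrow> real \<Rightarrow> real" where
  "contracted d u = (if u < 2 - 2 * d then u / 2 + d else u / 2 + d - 1)"

text \<open>\<open>gap d j\<close> is the \<open>(j - 1)\<close>-st image of the complement of the range, as long as the break point
  \<open>2 - 2 * d\<close> has not fallen into the interior of an earlier gap.\<close>

definition gap_end :: "real \<Rightarrow> nat \<Rightarrow> real" where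
  "gap_end d j = (contracted d ^^ j) 0"

definition gap_start :: "real \<Rightarrow> nat \<Rightarrow> real" where
  "gap_start d j = gap_end d j - (1/2) ^ j"

definition gap :: "real \<Rightarrow> nat \<Rightarrow> real set" where
  "gap d j = {gap_start d j..<gap_end d j}"

lemma funpow_in:
  assumes "\<And>x. x \<in> S \<Longrightarrow> f x \<in> S" "x \<in> S" shows "(f ^^ n) x \<in> S"
  using assms by (induction n) auto

locale contracted_rotation =
  fixes d :: real
  assumes d: "1/2 < d" "d < 1"
begin

abbreviation "f \<equiv> contracted d"
abbreviation "c \<equiv> 2 - 2 * d"
abbreviation "l \<equiv> gap_end d"
abbreviation "r \<equiv> gap_start d"
abbreviation "G \<equiv> gap d"

lemma f_in: "u \<in> {0..<1} \<Longrightarrow> f u \<in> {0..<1}"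
  using d by (auto simp: contracted_def)

lemma f_pow_in: "u \<in> {0..<1} \<Longrightarrow> (f ^^ k) u \<in> {0..<1}"
  using funpow_in[of "{0..<1}" f] f_in by blast

lemma f_inj: "u \<in> {0..<1} \<Longrightarrow> v \<in> {0..<1} \<Longrightarrow> f u = f v \<Longrightarrow> u = v"
  by (auto simp: contracted_def split: if_splits)

lemma l_0: "l 0 = 0" and l_Suc: "l (Suc j) = f (l j)"
  by (simp_all add: gap_end_def)

lemma l_in: "l j \<in> {0..<1}"
  unfolding gap_end_def by (intro f_pow_in) simp

lemma r_less_l: "r j < l j"
  by (simp add: gap_start_def)

lemma l_1: "l 1 = d" and r_1: "r 1 = d - 1/2"
  using d by (auto simp: gap_start_def gap_end_def contracted_def)

lemma f_avoids_gap_1: "u \<in> {0..<1} \<Longrightarrow> f u \<notin> G 1"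
  using d by (auto simp: gap_def l_1[unfolded One_nat_def] r_1[unfolded One_nat_def] contracted_def)

end

text \<open>The break may be the left end of a half-open gap but not its right end: the next gap is
  located by the image of the right end, which must be computed by the same branch as the image of
  the gap.\<close>

locale intact_gaps = contracted_rotation +
  fixes n :: nat
  assumes intact: "1 \<le> j \<Longrightarrow> j < n \<Longrightarrow> c \<le> r j \<or> l j < c"
begin

lemma f_on_gap:
  assumes "1 \<le> j" "j < n" "x \<in> G j"
  shows "f x = (x - l j) / 2 + l (Suc j)"
  using intact[OF assms(1,2)] assms(3) by (auto simp: gap_def l_Suc contracted_def field_simps)

lemma gap_preimage:
  assumes "1 \<le> j" "j < n" "y \<in> G (Suc j)" shows "\<exists>x\<in>G j. y = f x"
proof
  let ?x = "l j + 2 * (y - l (Suc j))"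
  show x: "?x \<in> G j" using assms(3) by (auto simp: gap_def gap_start_def)
  show "y = f ?x" using f_on_gap[OF assms(1,2) x] by (simp add: field_simps)
qed

lemma gap_subset:
  assumes "1 \<le> j" "j \<le> n" shows "G j \<subseteq> {0..<1}"
  using assms
proof (induction j rule: nat_induct_at_least)
  case base
  then show ?case using d by (auto simp: gap_def l_1[unfolded One_nat_def] r_1[unfolded One_nat_def])
next
  case (Suc j)
  have "y \<in> {0..<1}" if y: "y \<in> G (Suc j)" for y
  proof -
    obtain x where x: "x \<in> G j" "y = f x" using gap_preimage[OF Suc.hyps _ y] Suc.prems by auto
    have "x \<in> {0..<1}" using Suc x(1) by auto
    then show ?thesis using f_in x(2) by blast
  qed
  then show ?case by blast
qed

text \<open>By injectivity the preimage of each gap is the previous one, which leads back to gap 1,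
  missed by the range.\<close>

lemma f_pow_avoids_gap:
  assumes "1 \<le> j" "j \<le> n" "j \<le> k" "u \<in> {0..<1}" shows "(f ^^ k) u \<notin> G j"
  using assms
proof (induction j arbitrary: k rule: nat_induct_at_least)
  case base
  then obtain i where "k = Suc i" by (cases k) auto
  then show ?case using f_avoids_gap_1[of "(f ^^ i) u"] f_pow_in base by simp
next
  case (Suc j)
  then obtain i where i: "k = Suc i" "j \<le> i" by (cases k) auto
  show ?case
  proof
    assume "(f ^^ k) u \<in> G (Suc j)"
    then obtain x where x: "x \<in> G j" "(f ^^ k) u = f x" using gap_preimage[of j] Suc by auto
    have "x \<in> {0..<1}" using gap_subset[of j] x Suc by auto
    then have "(f ^^ i) u = x"
      using x(2) i f_inj[of "(f ^^ i) u" x] f_pow_in[OF Suc.prems(3)] by simp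
    then show False using Suc.IH[of i] x(1) i Suc.prems by auto
  qed
qed

lemma gap_is_image:
  assumes "1 \<le> j" "j \<le> n" "y \<in> G j" shows "\<exists>x\<in>{0..<1}. y = (f ^^ (j - 1)) x"
  using assms
proof (induction j arbitrary: y rule: nat_induct_at_least)
  case base
  then show ?case using gap_subset[of 1] by auto
next
  case (Suc j)
  then obtain x where x: "x \<in> G j" "y = f x" using gap_preimage[of j y] by auto
  obtain z where z: "z \<in> {0..<1}" "x = (f ^^ (j - 1)) z" using Suc.IH[OF _ x(1)] Suc.prems by auto
  have "y = (f ^^ Suc (j - 1)) z" using x z by simp
  then show ?case using z(1) Suc.hyps by (metis diff_Suc_1 le_add_diff_inverse plus_1_eq_Suc)
qed

text \<open>The later gap lies in the range of \<open>f ^^ (j - 1)\<close>, which misses all gaps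
  with smaller index.\<close>

lemma gaps_disjoint:
  assumes "1 \<le> i" "i < j" "j \<le> n" shows "G i \<inter> G j = {}"
proof -
  have "y \<notin> G i" if yj: "y \<in> G j" for y
  proof -
    obtain x where "x \<in> {0..<1}" "y = (f ^^ (j - 1)) x" using gap_is_image[of j y] yj assms by auto
    then show ?thesis using f_pow_avoids_gap[of i "j - 1" x] assms by auto
  qed
  then show ?thesis by blast
qed

end

text \<open>Once the break point lies inside the gap \<open>n\<close>, the complement of the gaps \<open>1, \<dots>, n\<close> is mapped into
  itself, its components being permuted cyclically: the component with right end \<open>r j\<close> goes to the one
  with right end \<open>r (Suc j)\<close>, and the one with right end \<open>r n\<close> to the last one, ending at 1.\<close>

locale trapped_break = intact_gaps +
  assumes n: "1 \<le> n" and trapped: "r n < c" "c < l n"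
begin

definition U :: "real set" where
  "U = {0..<1} - (\<Union>j\<in>{1..n}. G j)"

lemma U_subset: "U \<subseteq> {0..<1}"
  by (auto simp: U_def)

lemma c_in_gap: "c \<in> G n"
  using trapped by (simp add: gap_def)

lemma c_notin_U: "c \<notin> U"
  using c_in_gap n by (auto simp: U_def)

lemma f_U: assumes "u \<in> U" shows "f u \<in> U"
proof -
  have u: "u \<in> {0..<1}" using assms U_subset by blast
  have "f u \<notin> G j" if j: "1 \<le> j" "j \<le> n" for j
  proof (cases "j = 1")
    case False
    then obtain i where i: "j = Suc i" "1 \<le> i" using j by (cases j) auto
    show ?thesis
    proof
      assume "f u \<in> G j"
      then obtain x where x: "x \<in> G i" "f u = f x" using gap_preimage[of i "f u"] i j by auto
      then have "u = x" using f_inj[OF u] gap_subset[of i] i j by auto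
      then show False using assms x(1) i j by (auto simp: U_def)
    qed
  qed (use f_avoids_gap_1[OF u] in simp)
  then show ?thesis using f_in[OF u] by (auto simp: U_def)
qed

lemma f_pow_U: "u \<in> U \<Longrightarrow> (f ^^ k) u \<in> U"
  using funpow_in[of U f] f_U by blast

lemma eventually_U: "u \<in> {0..<1} \<Longrightarrow> (f ^^ n) u \<in> U"
  using f_pow_in[of u n] f_pow_avoids_gap[of _ n u] by (auto simp: U_def)

lemma segment_image:
  assumes "u \<le> v" "{u..v} \<subseteq> U"
  shows "f u \<le> f v" "{f u..f v} \<subseteq> U" "f v - f u = (v - u) / 2"
proof -
  have "c \<notin> {u..v}" using assms(2) c_notin_U by blast
  then have aff: "f x = f u + (x - u) / 2" if "x \<in> {u..v}" for x
    using that assms(1) by (auto simp: contracted_def field_simps)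
  show diff: "f v - f u = (v - u) / 2" using aff[of v] assms(1) by simp
  then show "f u \<le> f v" using assms(1) by simp
  show "{f u..f v} \<subseteq> U"
  proof
    fix y assume y: "y \<in> {f u..f v}"
    let ?x = "u + 2 * (y - f u)"
    have x: "?x \<in> {u..v}" using y diff by auto
    then have "y = f ?x" using aff[OF x] by (simp add: field_simps)
    then show "y \<in> U" using f_U x assms(2) by (metis subsetD)
  qed
qed

lemma segment_pow_image:
  assumes "u \<le> v" "{u..v} \<subseteq> U"
  shows "(f ^^ k) u \<le> (f ^^ k) v \<and> {(f ^^ k) u..(f ^^ k) v} \<subseteq> U \<and>
    (f ^^ k) v - (f ^^ k) u = (v - u) * (1/2) ^ k"
proof (induction k)
  case (Suc k)
  then show ?case using segment_image[of "(f ^^ k) u" "(f ^^ k) v"] by auto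
qed (use assms in auto)

lemma c_off_earlier_gap:
  assumes "1 \<le> j" "j < n" shows "c < r j \<or> l j < c"
proof -
  have "c \<notin> G j" using gaps_disjoint[OF assms] c_in_gap by blast
  then show ?thesis using intact[OF assms] r_less_l[of j] by (auto simp: gap_def)
qed

text \<open>Index 0 stands for the last component, ending at 1. Its image ends at
  \<open>r 1 = d - 1/2\<close>, so it starts the chain.\<close>

definition right_end :: "nat \<Rightarrow> real" where
  "right_end j = (if j = 0 then 1 else r j)"

text \<open>The image of \<open>r n\<close>. The part \<open>[r n, c)\<close> of the gap around the
  break is mapped onto \<open>[w, 1)\<close>.\<close>

definition w :: real where
  "w = r n / 2 + d"

text \<open>Components are handled through their right end and one point \<open>v\<close>, so left
  ends never have to be located. As \<open>c\<close> lies neither in the segment nor in gap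
  \<open>j\<close>, a single branch serves both, and it carries the right end along.\<close>

lemma component_step:
  assumes j: "j < n" and v: "v < right_end j" "{v..<right_end j} \<subseteq> U"
  shows "f v < right_end (Suc j) \<and> {f v..<right_end (Suc j)} \<subseteq> U"
proof -
  have cv: "c \<notin> {v..<right_end j}" using v(2) c_notin_U by blast
  have ex: "\<exists>e. right_end (Suc j) = right_end j / 2 + e \<and> (\<forall>x\<in>{v..<right_end j}. f x = x / 2 + e)"
  proof (cases "j = 0")
    case True
    then show ?thesis using cv v d r_1[unfolded One_nat_def]
      by (intro exI[of _ "d - 1"]) (auto simp: right_end_def contracted_def)
  next
    case False
    then have j1: "1 \<le> j" by simp
    have re: "right_end (Suc j) = l (Suc j) - (1/2) ^ j / 2" "right_end j = l j - (1/2) ^ j" "right_end j = r j"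
      using False by (simp_all add: right_end_def gap_start_def)
    from c_off_earlier_gap[OF j1 j] show ?thesis
    proof
      assume "c < r j"
      then have "l (Suc j) = l j / 2 + (d - 1)" "c < v"
        using r_less_l[of j] cv v(1) by (auto simp: l_Suc contracted_def re(3))
      then show ?thesis by (intro exI[of _ "d - 1"]) (auto simp: re(1,2) contracted_def diff_divide_distrib)
    next
      assume "l j < c"
      then have "l (Suc j) = l j / 2 + d" "r j < c"
        using r_less_l[of j] by (auto simp: l_Suc contracted_def)
      then show ?thesis
        by (intro exI[of _ d]) (auto simp: re(3) contracted_def, simp add: re(1) re(2)[unfolded re(3)] diff_divide_distrib)
    qed
  qed
  then obtain e where e: "right_end (Suc j) = right_end j / 2 + e"
    "\<And>x. x \<in> {v..<right_end j} \<Longrightarrow> f x = x / 2 + e" by blast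
  have fv: "f v = v / 2 + e" using e(2) v(1) by simp
  have "y \<in> U" if "y \<in> {f v..<right_end (Suc j)}" for y
  proof -
    have "2 * (y - e) \<in> {v..<right_end j}" using that fv e(1) by auto
    then show ?thesis using e(2)[of "2 * (y - e)"] f_U v(2) by (metis add.commute
          diff_add_cancel nonzero_mult_div_cancel_left subsetD zero_neq_numeral)
  qed
  then show ?thesis using fv e(1) v(1) by auto
qed

lemma last_component: "0 < w" "w < 1" "{w..<1} \<subseteq> U"
proof -
  have "0 \<le> r n" using gap_subset[of n] n r_less_l[of n] by (auto simp: gap_def)
  then show "0 < w" "w < 1" using trapped d by (auto simp: w_def)
  show "{w..<1} \<subseteq> U"
  proof
    fix y assume y: "y \<in> {w..<1}"
    let ?x = "2 * (y - d)"
    have x: "?x \<in> G n" "f ?x = y"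
      using y trapped by (auto simp: gap_def w_def contracted_def field_simps)
    have x01: "?x \<in> {0..<1}" using gap_subset[of n] n x(1) by blast
    have "y \<notin> G j" if j: "1 \<le> j" "j \<le> n" for j
    proof (cases "j = 1")
      case False
      then obtain i where i: "j = Suc i" "1 \<le> i" using j by (cases j) auto
      show ?thesis
      proof
        assume "y \<in> G j"
        then obtain x' where x': "x' \<in> G i" "y = f x'" using gap_preimage[of i y] i j by auto
        then have "?x = x'" using f_inj[OF x01] gap_subset[of i] i j x(2) by auto
        then show False using gaps_disjoint[of i n] x(1) x'(1) i j by auto
      qed
    qed (use f_avoids_gap_1[OF x01] x(2) in simp)
    then show "y \<in> U" using y \<open>0 < w\<close> by (auto simp: U_def)
  qed
qed

text \<open>The image of the segment ends at \<open>w\<close>, and \<open>last_component\<close>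
  extends it to 1.\<close>

lemma component_step_last:
  assumes v: "v < right_end n" "{v..<right_end n} \<subseteq> U"
  shows "f v < w \<and> {f v..<1} \<subseteq> U"
proof -
  have re: "right_end n = r n" using n by (simp add: right_end_def)
  have aff: "f x = x / 2 + d" if "x < r n" for x using that trapped by (simp add: contracted_def)
  have "y \<in> U" if y: "y \<in> {f v..<1}" for y
  proof (cases "y < w")
    case True
    then have "2 * (y - d) \<in> {v..<r n}" using y v(1) aff[of v] by (auto simp: w_def re)
    then show ?thesis using aff[of "2 * (y - d)"] f_U[of "2 * (y - d)"] v(2)
      by (auto simp: re diff_divide_distrib)
  qed (use y last_component(3) in auto)
  then show ?thesis using aff[of v] v(1) by (auto simp: w_def re)
qed

text \<open>It takes \<open>n - j\<close> steps to reach index \<open>n\<close> and one more to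
  reach the last component.\<close>

lemma component_cycle:
  assumes "j \<le> n" "v < right_end j" "{v..<right_end j} \<subseteq> U"
  shows "(f ^^ (Suc n - j)) v < w \<and> {(f ^^ (Suc n - j)) v..<1} \<subseteq> U"
  using assms
proof (induction j arbitrary: v rule: inc_induct)
  case base
  then show ?case using component_step_last by simp
next
  case (step j)
  have "f v < right_end (Suc j) \<and> {f v..<right_end (Suc j)} \<subseteq> U"
    using component_step step by blast
  then have "(f ^^ (Suc n - Suc j)) (f v) < w \<and> {(f ^^ (Suc n - Suc j)) (f v)..<1} \<subseteq> U"
    using step.IH by blast
  moreover have "Suc n - j = Suc (Suc n - Suc j)" using step by simp
  ultimately show ?case by (simp add: funpow_swap1)
qed

text \<open>For the least right end above \<open>u\<close>, no gap can begin between
  \<open>u\<close> and it.\<close>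

lemma in_component:
  assumes u: "u \<in> U" obtains j where "j \<le> n" "u < right_end j" "{u..<right_end j} \<subseteq> U"
proof -
  define E where "E = {right_end j | j. j \<le> n \<and> u < right_end j}"
  have "E = right_end ` {j. j \<le> n \<and> u < right_end j}" by (auto simp: E_def)
  then have fin: "finite E" by simp
  have one: "1 \<in> E" using u U_subset by (auto simp: E_def right_end_def intro!: exI[of _ 0])
  then have "Min E \<in> E" using fin by (intro Min_in) auto
  then obtain j where j: "j \<le> n" "u < right_end j" "right_end j = Min E" by (auto simp: E_def)
  have "y \<in> U" if y: "y \<in> {u..<right_end j}" for y
  proof -
    have "right_end j \<le> 1" using Min_le[OF fin one] j(3) by simp
    then have y01: "y \<in> {0..<1}" using y u U_subset by fastforce
    have "y \<notin> G i" if i: "1 \<le> i" "i \<le> n" for i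
    proof
      assume yi: "y \<in> G i"
      have ri: "right_end i = r i" using i by (simp add: right_end_def)
      have "\<not> u < r i"
      proof
        assume "u < r i"
        then have "r i \<in> E" using i ri by (auto simp: E_def intro!: exI[of _ i])
        then have "right_end j \<le> r i" using Min_le[OF fin] j(3) by simp
        then show False using y yi by (auto simp: gap_def)
      qed
      then have "u \<in> G i" using y yi by (auto simp: gap_def)
      then show False using u i by (auto simp: U_def)
    qed
    then show ?thesis using y01 by (auto simp: U_def)
  qed
  then show thesis using that j by blast
qed

lemma reaches_last_component:
  assumes "u \<in> U" obtains a where "a \<le> Suc n" "{(f ^^ a) u..<1} \<subseteq> U"
proof -
  obtain j where j: "j \<le> n" "u < right_end j" "{u..<right_end j} \<subseteq> U" using in_component[OF assms] .
  show thesis using component_cycle[OF j] by (intro that[of "Suc n - j"]) auto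
qed

lemma last_component_close:
  assumes "{u..<1} \<subseteq> U" "{v..<1} \<subseteq> U" "u \<in> {0..<1}" "v \<in> {0..<1}"
  shows "\<bar>(f ^^ k) u - (f ^^ k) v\<bar> \<le> (1/2) ^ k"
  using assms
proof (induction u v rule: linorder_wlog)
  case (le u v)
  have "{u..v} \<subseteq> {u..<1}" using le by auto
  then have "(f ^^ k) v - (f ^^ k) u = (v - u) * (1/2) ^ k" "(f ^^ k) u \<le> (f ^^ k) v"
    using segment_pow_image[of u v k] le by auto
  moreover have "(v - u) * (1/2) ^ k \<le> 1 * (1/2) ^ k" using le by (intro mult_right_mono) auto
  ultimately show ?case by simp
next
  case (sym u v)
  then show ?case by (simp add: abs_minus_commute)
qed

text \<open>One turn \<open>g\<close> maps the last component into itself with slope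
  \<open>q\<close>. The fixed point is extrapolated from \<open>w\<close> before it is known to lie
  in the component; the orbit of \<open>w\<close> under \<open>g\<close> then decreases to it
  through the component.\<close>

lemma periodic_point:
  obtains p where "p \<in> {0..<1}" "{p..<1} \<subseteq> U" "(f ^^ Suc n) p = p"
proof -
  define g where "g = f ^^ Suc n"
  define q :: real where "q = (1/2) ^ Suc n"
  have q: "0 < q" "q < 1" unfolding q_def by (simp, intro power_Suc_less_one) auto
  \<comment> \<open>The solution of \<open>p = g w - q * (w - p)\<close>, the fixed-point equation
    of the affine map through \<open>(w, g w)\<close> with slope \<open>q\<close>.\<close>
  define p where "p = w - (w - g w) / (1 - q)"
  have gw: "g v < w \<and> {g v..<1} \<subseteq> U" if "v < 1" "{v..<1} \<subseteq> U" for v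
    using component_cycle[of 0 v] that by (simp add: g_def right_end_def)
  have w: "w < 1" "{w..<1} \<subseteq> U" using last_component by auto
  have "p < w" using gw[OF w] q by (simp add: p_def)
  have fix_eq: "g w - q * (w - p) = p" using q by (simp add: p_def field_simps)
  have last: "g w - g u = (w - u) * q" if "{u..<1} \<subseteq> U" "u \<le> w" for u
  proof -
    have "{u..w} \<subseteq> U" using that(1) w(1) by fastforce
    then show ?thesis
      using segment_pow_image[OF that(2), of "Suc n"] unfolding g_def q_def by blast
  qed
  have iter: "{p + q ^ k * (w - p)..<1} \<subseteq> U" for k
  proof (induction k)
    case (Suc k)
    let ?v = "p + q ^ k * (w - p)"
    have "q ^ k \<le> 1" using q by (simp add: power_le_one)
    then have "q ^ k * (w - p) \<le> 1 * (w - p)" using \<open>p < w\<close> by (intro mult_right_mono) auto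
    then have vw: "?v \<le> w" by simp
    have "g ?v = p + q ^ Suc k * (w - p)"
      using last[OF Suc vw] fix_eq by (simp add: algebra_simps)
    then show ?case using gw[OF _ Suc] vw w(1) by simp
  qed (use w in simp)
  have below: "\<exists>k. p + q ^ k * (w - p) < y" if py: "p < y" for y
  proof -
    obtain k where "q ^ k < (y - p) / (w - p)"
      using real_arch_pow_inv[of "(y - p) / (w - p)" q] py \<open>p < w\<close> q by auto
    then show ?thesis using \<open>p < w\<close> by (intro exI[of _ k]) (simp add: field_simps)
  qed
  have above: "y \<in> U" if y: "p < y" "y < 1" for y
  proof -
    obtain k where "p + q ^ k * (w - p) < y" using below y(1) by blast
    then have "y \<in> {p + q ^ k * (w - p)..<1}" using y(2) by simp
    then show ?thesis using iter by blast
  qed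
  have "p \<in> {0..<1}"
  proof -
    have "0 \<le> p"
    proof (rule ccontr)
      assume "\<not> 0 \<le> p"
      then show False using above[of "p / 2"] U_subset by auto
    qed
    then show ?thesis using \<open>p < w\<close> w(1) by simp
  qed
  have "p \<in> U"
  proof -
    \<comment> \<open>Gaps are open on the right, so a gap containing \<open>p\<close> would contain
      points just above \<open>p\<close>, all of which are in \<open>U\<close>.\<close>
    have "p \<notin> G j" if "j \<in> {1..n}" for j
    proof
      assume "p \<in> G j"
      with that have j: "j \<in> {1..n}" "p \<in> G j" by auto
      define y where "y = min ((p + l j) / 2) ((p + w) / 2)"
      have "p < l j" using j(2) by (simp add: gap_def)
      moreover have "y \<le> (p + l j) / 2" "y \<le> (p + w) / 2"
        unfolding y_def by (rule min.cobounded1, rule min.cobounded2)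
      ultimately have y: "p < y" "y < l j" "y < 1" using \<open>p < w\<close> w(1) by (simp_all add: y_def)
      then have "y \<in> G j" using j(2) by (auto simp: gap_def)
      then show False using above[OF y(1,3)] j(1) by (auto simp: U_def)
    qed
    then show ?thesis using \<open>p \<in> {0..<1}\<close> by (auto simp: U_def)
  qed
  have pU: "{p..<1} \<subseteq> U"
  proof
    fix y assume "y \<in> {p..<1}"
    then show "y \<in> U" using above[of y] \<open>p \<in> U\<close> by (cases "y = p") auto
  qed
  have "g p = p" using last[OF pU] fix_eq \<open>p < w\<close> by (simp add: algebra_simps)
  then show thesis using that[OF \<open>p \<in> {0..<1}\<close> pU] by (simp add: g_def)
qed

end

text \<open>The avoided values are the parameters of the break points \<open>5/6\<close> and
  \<open>0\<close> in the arc and the break of the contraction itself. \<open>N\<close> is uniform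
  in \<open>u\<close>; this is what identifies points with arbitrarily long backward orbits later
  on.\<close>

definition attracting_cycle :: "real \<Rightarrow> real \<Rightarrow> nat \<Rightarrow> bool" where
  "attracting_cycle d p m \<longleftrightarrow> 0 < m \<and> p \<in> {0..<1} \<and> (contracted d ^^ m) p = p \<and>
     (\<forall>k. (contracted d ^^ k) p \<notin> {0, 1/2, 2 - 2 * d}) \<and>
     (\<exists>N. \<forall>u\<in>{0..<1}. \<exists>i. \<forall>k. \<bar>(contracted d ^^ (N + k)) u - (contracted d ^^ (i + k)) p\<bar> \<le> (1/2) ^ k)"

theorem (in trapped_break) attracting_cycle: "\<exists>p m. attracting_cycle d p m"
proof -
  obtain p where p: "p \<in> {0..<1}" "{p..<1} \<subseteq> U" "(f ^^ Suc n) p = p" using periodic_point .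
  have "p \<in> U" using p by auto
  have shift: "(f ^^ k) p = f ((f ^^ (k + n)) p)" for k
  proof -
    have "(f ^^ (k + Suc n)) p = (f ^^ k) p" by (simp only: funpow_add o_apply p(3))
    then show ?thesis by simp
  qed
  have c: "(f ^^ k) p \<noteq> c" for k using f_pow_U[OF \<open>p \<in> U\<close>] c_notin_U by metis
  \<comment> \<open>The value 0 is taken only at \<open>c\<close>, and \<open>1/2\<close> lies in
    gap 1, outside the range.\<close>
  have avoid: "(f ^^ k) p \<notin> {0, 1/2, c}" for k
  proof -
    let ?x = "(f ^^ (k + n)) p"
    have x: "?x \<in> {0..<1}" using f_pow_in p(1) by blast
    have "f ?x \<noteq> 0" using x c[of "k + n"] d by (auto simp: contracted_def)
    moreover have "1/2 \<in> G 1" using d by (simp add: gap_def l_1[unfolded One_nat_def] r_1[unfolded One_nat_def])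
    then have "f ?x \<noteq> 1/2" using f_avoids_gap_1[OF x] by metis
    ultimately show ?thesis using c[of k] shift[of k] by auto
  qed
  \<comment> \<open>\<open>n\<close> steps bring \<open>u\<close> into \<open>U\<close>, and at most
    \<open>Suc n\<close> more into the last component, where it stays close to
    \<open>p\<close>.\<close>
  have sync: "\<exists>i. \<forall>k. \<bar>(f ^^ (Suc n + n + k)) u - (f ^^ (i + k)) p\<bar> \<le> (1/2) ^ k" if u: "u \<in> {0..<1}" for u
  proof -
    obtain a where a: "a \<le> Suc n" "{(f ^^ a) ((f ^^ n) u)..<1} \<subseteq> U"
      using reaches_last_component[OF eventually_U[OF u]] .
    let ?v = "(f ^^ a) ((f ^^ n) u)"
    have v: "?v \<in> {0..<1}" using u f_pow_in by blast
    have "\<bar>(f ^^ (Suc n + n + k)) u - (f ^^ (Suc n - a + k)) p\<bar> \<le> (1/2) ^ k" for k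
    proof -
      have "Suc n + n + k = (Suc n - a + k) + (a + n)" using a(1) by simp
      then have "(f ^^ (Suc n + n + k)) u = (f ^^ (Suc n - a + k)) ?v"
        by (simp only: funpow_add o_apply)
      then have "\<bar>(f ^^ (Suc n + n + k)) u - (f ^^ (Suc n - a + k)) p\<bar> \<le> (1/2) ^ (Suc n - a + k)"
        using last_component_close[OF a(2) p(2) v p(1)] by simp
      also have "\<dots> \<le> (1/2) ^ k" by (intro power_decreasing) auto
      finally show ?thesis .
    qed
    then show ?thesis by blast
  qed
  have "attracting_cycle d p (Suc n)"
    unfolding attracting_cycle_def using p avoid sync by blast
  then show ?thesis by blast
qed

lemma attracting_cycle_if_trapped:
  assumes d: "1/2 < d" "d < 1"
    and n: "1 \<le> n" "gap_start d n < 2 - 2 * d" "2 - 2 * d < gap_end d n"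
    and no_hit: "\<And>j. 1 \<le> j \<Longrightarrow> gap_end d j \<noteq> 2 - 2 * d"
  shows "\<exists>p m. attracting_cycle d p m"
proof -
  define P where "P k \<longleftrightarrow> 1 \<le> k \<and> gap_start d k < 2 - 2 * d \<and> 2 - 2 * d < gap_end d k" for k
  \<comment> \<open>For the least such index the earlier gaps are intact; \<open>no_hit\<close>
    excludes that the break is the right end of one of them.\<close>
  define k where "k = (LEAST k. P k)"
  have "P k" unfolding k_def by (rule LeastI[of P n]) (use n in \<open>simp add: P_def\<close>)
  moreover have "\<not> P j" if "j < k" for j using not_less_Least that by (metis k_def)
  ultimately interpret trapped_break d k
    by unfold_locales (use d no_hit in \<open>force simp: P_def not_less\<close>)+
  show ?thesis by (rule attracting_cycle)
qed

text \<open>The orbit of 0 under the lift of \<open>contracted d\<close> to the real line. Its integer parts increase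
  with \<open>d\<close>, so initial segments of the itinerary of 0 take only polynomially many values as \<open>d\<close> varies.\<close>

fun lift :: "real \<Rightarrow> nat \<Rightarrow> real" where
  "lift d 0 = 0"
| "lift d (Suc k) = (lift d k + of_int \<lfloor>lift d k\<rfloor>) / 2 + d"

text \<open>A single number that encodes the itinerary: each integer part is monotone in
  \<open>d\<close>, so equal sums force equal summands.\<close>

definition level :: "nat \<Rightarrow> real \<Rightarrow> nat" where
  "level n d = (\<Sum>k\<le>n. nat \<lfloor>lift d k\<rfloor>)"

section \<open>Counting itineraries\<close>

lemma lift_mono: "d \<le> d' \<Longrightarrow> lift d k \<le> lift d' k"
proof (induction k)
  case (Suc k)
  then have "\<lfloor>lift d k\<rfloor> \<le> \<lfloor>lift d' k\<rfloor>" by (intro floor_mono)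
  then have "(of_int \<lfloor>lift d k\<rfloor> :: real) \<le> of_int \<lfloor>lift d' k\<rfloor>" by (simp only: of_int_le_iff)
  then show ?case unfolding lift.simps using Suc by (intro add_mono divide_right_mono) auto
qed simp

lemma lift_strict_mono:
  assumes "d < d'" "1 \<le> k" shows "lift d k < lift d' k"
proof -
  obtain i where i: "k = Suc i" using assms(2) by (cases k) auto
  have le: "lift d i \<le> lift d' i" using assms(1) by (intro lift_mono) simp
  then have "(of_int \<lfloor>lift d i\<rfloor> :: real) \<le> of_int \<lfloor>lift d' i\<rfloor>" using floor_mono by (simp only: of_int_le_iff)
  then show ?thesis
    unfolding i lift.simps using le assms(1) by (intro add_le_less_mono divide_right_mono add_mono) auto
qed

lemma lift_nonneg: "0 \<le> d \<Longrightarrow> 0 \<le> lift d k"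
proof (induction k)
  case (Suc k)
  then have "0 \<le> \<lfloor>lift d k\<rfloor>" by simp
  then have "(0::real) \<le> of_int \<lfloor>lift d k\<rfloor>" by (simp only: of_int_0_le_iff)
  then show ?case using Suc by simp
qed simp

lemma lift_le: "d \<le> 1 \<Longrightarrow> lift d k \<le> k"
proof (induction k)
  case (Suc k)
  have "(lift d k + of_int \<lfloor>lift d k\<rfloor>) / 2 \<le> (real k + real k) / 2"
    using Suc order_trans[OF of_int_floor_le] by (intro divide_right_mono add_mono) auto
  then have "(lift d k + of_int \<lfloor>lift d k\<rfloor>) / 2 + d \<le> (real k + real k) / 2 + 1"
    using Suc.prems by (rule add_mono)
  then show ?case by (simp only: lift.simps of_nat_Suc) simp
qed simp

lemma level_le: assumes "d \<le> 1" shows "level n d \<le> (n + 1) * n"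
proof -
  have "nat \<lfloor>lift d k\<rfloor> \<le> n" if "k \<le> n" for k
  proof -
    have "lift d k \<le> real n" using lift_le[OF assms, of k] that by simp
    then show ?thesis by linarith
  qed
  then have "level n d \<le> (\<Sum>k\<le>n. n)" unfolding level_def by (intro sum_mono) auto
  then show ?thesis by simp
qed

lemma same_level:
  assumes "0 \<le> d" "d \<le> d'" "level n d = level n d'" "k \<le> n"
  shows "\<lfloor>lift d k\<rfloor> = \<lfloor>lift d' k\<rfloor>"
proof -
  have mono: "nat \<lfloor>lift d i\<rfloor> \<le> nat \<lfloor>lift d' i\<rfloor>" for i
    using lift_mono[OF assms(2), of i] by (intro nat_mono floor_mono)
  have "nat \<lfloor>lift d k\<rfloor> = nat \<lfloor>lift d' k\<rfloor>"
  proof (rule ccontr)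
    assume "nat \<lfloor>lift d k\<rfloor> \<noteq> nat \<lfloor>lift d' k\<rfloor>"
    then have "level n d < level n d'"
      unfolding level_def using mono assms(4)
      by (intro sum_strict_mono_ex1 bexI[of _ k] le_neq_implies_less) auto
    then show False using assms(3) by simp
  qed
  moreover have "0 \<le> \<lfloor>lift d k\<rfloor>" "0 \<le> \<lfloor>lift d' k\<rfloor>"
    using lift_nonneg[of d k] lift_nonneg[of d' k] assms(1,2) by simp_all
  ultimately show ?thesis by (simp add: nat_eq_iff)
qed

context contracted_rotation
begin

lemma lift_frac: "l k = frac (lift d k)"
proof (induction k)
  case (Suc k)
  have "lift d (Suc k) - l (Suc k) = of_int (\<lfloor>lift d k\<rfloor> + (if l k < c then 0 else 1))"
    using Suc by (simp add: l_Suc contracted_def frac_def field_simps)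
  then have "lift d (Suc k) - l (Suc k) \<in> \<int>" by simp
  then show ?case using l_in[of "Suc k"] frac_unique_iff[of "lift d (Suc k)" "l (Suc k)"] by simp
qed (simp add: l_0)

text \<open>The increments of the integer parts are the itinerary of 0 relative to the
  break.\<close>

lemma floor_lift_Suc: "\<lfloor>lift d (Suc k)\<rfloor> = \<lfloor>lift d k\<rfloor> + (if l k < c then 0 else 1)"
proof -
  have "lift d (Suc k) = l k / 2 + d + of_int \<lfloor>lift d k\<rfloor>"
    using lift_frac[of k] by (simp add: frac_def field_simps)
  then have "\<lfloor>lift d (Suc k)\<rfloor> = \<lfloor>l k / 2 + d\<rfloor> + \<lfloor>lift d k\<rfloor>"
    by (simp only: floor_add_int)
  moreover have "\<lfloor>l k / 2 + d\<rfloor> = (if l k < c then 0 else 1)"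
    using l_in[of k] d by (auto simp: floor_eq_iff)
  ultimately show ?thesis by simp
qed

definition left_mass :: "nat \<Rightarrow> real" where
  "left_mass n = (\<Sum>j\<in>{1..n}. if l j < c then (1/2) ^ j else 0)"

text \<open>Every gap lies on one side of \<open>c\<close>. The first \<open>n\<close> gaps are
  disjoint with total length \<open>1 - (1/2) ^ n\<close>; those on the left fit into
  \<open>[0, c)\<close> and those on the right into \<open>[c, 1)\<close>, which pins down
  \<open>c\<close> up to the missing \<open>(1/2) ^ n\<close>.\<close>

lemma break_position:
  assumes not_trapped: "\<And>j. 1 \<le> j \<Longrightarrow> c \<le> r j \<or> l j < c"
  shows "left_mass n \<le> c" "c \<le> left_mass n + (1/2) ^ n"
proof -
  interpret intact_gaps d n by unfold_locales (rule not_trapped)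
  have total: "measure lborel (\<Union>j\<in>J. G j) = (\<Sum>j\<in>J. (1/2) ^ j)" if "J \<subseteq> {1..n}" for J
  proof -
    have fin: "finite J" using that finite_subset by blast
    have "measure lborel (\<Union>j\<in>J. G j) = (\<Sum>j\<in>J. measure lborel (G j))"
    proof (rule measure_finite_Union[OF fin])
      show "disjoint_family_on G J"
        unfolding disjoint_family_on_def
      proof (intro ballI impI)
        fix i j assume ij: "i \<in> J" "j \<in> J" "i \<noteq> j"
        then consider "i < j" | "j < i" by linarith
        then show "G i \<inter> G j = {}"
          using gaps_disjoint[of i j] gaps_disjoint[of j i] ij that by cases fastforce+
      qed
    qed (use r_less_l in \<open>auto simp: gap_def less_imp_le\<close>)
    also have "\<dots> = (\<Sum>j\<in>J. (1/2) ^ j)" by (simp add: gap_def gap_start_def)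
    finally show ?thesis .
  qed
  have bound: "(\<Sum>j\<in>J. (1/2) ^ j) \<le> b - a" if "J \<subseteq> {1..n}" "(\<Union>j\<in>J. G j) \<subseteq> {a..<b}" "a \<le> b" for J a b
  proof -
    have "measure lborel (\<Union>j\<in>J. G j) \<le> measure lborel {a..<b}"
      using that finite_subset[OF that(1)] by (intro measure_mono_fmeasurable) (auto simp: gap_def fmeasurable_def)
    then show ?thesis using total[OF that(1)] that(3) by simp
  qed
  define L where "L = {j \<in> {1..n}. l j < c}"
  define R where "R = {j \<in> {1..n}. \<not> l j < c}"
  have sub: "G j \<subseteq> {0..<1}" if "j \<in> {1..n}" for j using gap_subset[of j] that by simp
  have "(\<Sum>j\<in>L. (1/2) ^ j) \<le> c - 0"
  proof (rule bound)
    show "(\<Union>j\<in>L. G j) \<subseteq> {0..<c}" using sub by (fastforce simp: L_def gap_def)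
  qed (use d in \<open>auto simp: L_def\<close>)
  moreover have "(\<Sum>j\<in>R. (1/2) ^ j) \<le> 1 - c"
  proof (rule bound)
    have "G j \<subseteq> {c..<1}" if "j \<in> R" for j
    proof -
      have j: "j \<in> {1..n}" "c \<le> r j" using that not_trapped[of j] by (auto simp: R_def)
      then show ?thesis using sub[OF j(1)] by (auto simp: gap_def)
    qed
    then show "(\<Union>j\<in>R. G j) \<subseteq> {c..<1}" by blast
  qed (use d in \<open>auto simp: R_def\<close>)
  moreover have "left_mass n = (\<Sum>j\<in>L. (1/2) ^ j)"
    unfolding left_mass_def L_def by (rule sum.inter_filter[symmetric]) simp
  moreover have "(\<Sum>j\<in>L. (1/2) ^ j) + (\<Sum>j\<in>R. (1/2) ^ j) = (\<Sum>j\<in>{1..n}. (1/2::real) ^ j)"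
  proof -
    have "{1..n} = L \<union> R" "L \<inter> R = {}" by (auto simp: L_def R_def)
    then show ?thesis by (metis sum.union_disjoint finite_Un finite_atLeastAtMost)
  qed
  moreover have "(\<Sum>j\<in>{1..n}. (1/2::real) ^ j) = 1 - (1/2) ^ n"
    by (induction n) auto
  ultimately show "left_mass n \<le> c" "c \<le> left_mass n + (1/2) ^ n" by auto
qed

end

text \<open>\<open>Suc n\<close> is used because the side of \<open>gap_end d n\<close> is read off
  from the integer part at the following index.\<close>

lemma left_mass_same_level:
  assumes "1/2 < d" "d \<le> d'" "d' < 1" "level (Suc n) d = level (Suc n) d'"
  shows "contracted_rotation.left_mass d n = contracted_rotation.left_mass d' n"
proof -
  interpret A: contracted_rotation d by unfold_locales (use assms in auto)
  interpret B: contracted_rotation d' by unfold_locales (use assms in auto)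
  have "gap_end d j < 2 - 2 * d \<longleftrightarrow> gap_end d' j < 2 - 2 * d'" if "j \<le> n" for j
  proof -
    have "\<lfloor>lift d i\<rfloor> = \<lfloor>lift d' i\<rfloor>" if "i \<le> Suc n" for i
      using same_level[of d d' "Suc n" i] assms that by simp
    from this[of j] this[of "Suc j"] that show ?thesis
      using A.floor_lift_Suc[of j] B.floor_lift_Suc[of j] by (auto split: if_splits)
  qed
  then show ?thesis unfolding A.left_mass_def B.left_mass_def by (intro sum.cong) auto
qed

text \<open>On a fixed level \<open>gap_end d n\<close> strictly increases with \<open>d\<close>
  while \<open>2 - 2 * d\<close> decreases, so each of the finitely many levels contains at most one
  hit.\<close>

lemma finite_hits:
  assumes "1 \<le> n"
  shows "finite {d. 1/2 < d \<and> d < 1 \<and> gap_end d n = 2 - 2 * d}"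
proof (rule finite_imageD)
  show "finite (level n ` {d. 1/2 < d \<and> d < 1 \<and> gap_end d n = 2 - 2 * d})"
    by (rule finite_subset[of _ "{..(n + 1) * n}"]) (use level_le in fastforce)+
  have *: "\<not> d < d'" if "1/2 < d" "gap_end d n = 2 - 2 * d" "d' < 1" "gap_end d' n = 2 - 2 * d'"
    "level n d = level n d'" for d d'
  proof
    assume dd: "d < d'"
    interpret A: contracted_rotation d by unfold_locales (use that dd in auto)
    interpret B: contracted_rotation d' by unfold_locales (use that dd in auto)
    have "\<lfloor>lift d n\<rfloor> = \<lfloor>lift d' n\<rfloor>" using same_level[of d d' n n] that dd by simp
    moreover have "lift d n < lift d' n" using lift_strict_mono dd assms .
    ultimately have "gap_end d n < gap_end d' n"
      unfolding A.lift_frac B.lift_frac by (simp add: frac_def)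
    then show False using that dd by simp
  qed
  show "inj_on (level n) {d. 1/2 < d \<and> d < 1 \<and> gap_end d n = 2 - 2 * d}"
  proof (rule inj_onI)
    fix x y
    assume "x \<in> {d. 1/2 < d \<and> d < 1 \<and> gap_end d n = 2 - 2 * d}"
      "y \<in> {d. 1/2 < d \<and> d < 1 \<and> gap_end d n = 2 - 2 * d}" "level n x = level n y"
    then have "\<not> x < y" "\<not> y < x" using *[of x y] *[of y x] by simp_all
    then show "x = y" by simp
  qed
qed

lemma quadratic_times_power_tendsto:
  "(\<lambda>n. ((real n + 2) * (real n + 1) + 1) * (1/2) ^ n) \<longlonglongrightarrow> 0"
proof -
  \<comment> \<open>Splitting \<open>(1/2) ^ n\<close> into two equal factors gives each linear
    factor its own decaying power.\<close>
  define y :: real where "y = sqrt (1/2)"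
  have "norm y < 1" unfolding y_def by (simp add: real_sqrt_divide)
  then have 1: "(\<lambda>n. real n * y ^ n) \<longlonglongrightarrow> 0" by (rule powser_times_n_limit_0)
  have 2: "(\<lambda>n. y ^ n) \<longlonglongrightarrow> 0" using \<open>norm y < 1\<close> by (simp add: LIMSEQ_power_zero)
  have "(\<lambda>n. (real n * y ^ n + 2 * y ^ n) * (real n * y ^ n + y ^ n) + y ^ n * y ^ n) \<longlonglongrightarrow>
      (0 + 2 * 0) * (0 + 0) + 0 * 0"
    by (intro tendsto_intros 1 2)
  moreover have "(real n * y ^ n + 2 * y ^ n) * (real n * y ^ n + y ^ n) + y ^ n * y ^ n =
      ((real n + 2) * (real n + 1) + 1) * (1/2) ^ n" for n
  proof -
    have "y ^ n * y ^ n = (1/2) ^ n" by (simp add: y_def flip: power_mult_distrib)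
    then show ?thesis by (simp add: algebra_simps flip: mult.assoc)
  qed
  ultimately show ?thesis by simp
qed

theorem negligible_no_attracting_cycle:
  "negligible {d. 1/2 < d \<and> d < 1 \<and> (\<nexists>p m. attracting_cycle d p m)}"
proof -
  define hits where "hits = (\<Union>n\<in>{1..}. {d. 1/2 < d \<and> d < 1 \<and> gap_end d n = 2 - 2 * d})"
  define bad where "bad = {d. 1/2 < d \<and> d < 1 \<and> (\<forall>j\<ge>1. 2 - 2 * d \<le> gap_start d j \<or> gap_end d j < 2 - 2 * d)}"
  have "negligible hits"
    unfolding hits_def
  proof (intro negligible_countable_Union)
    show "negligible B" if "B \<in> (\<lambda>n. {d. 1/2 < d \<and> d < 1 \<and> gap_end d n = 2 - 2 * d}) ` {1..}" for B
      using that finite_hits by (elim imageE) (simp only:, intro negligible_finite finite_hits, simp)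
  qed auto
  moreover have "negligible bad"
    unfolding negligible_outer_le
  proof (intro allI impI)
    fix e :: real assume e: "e > 0"
    have "(\<lambda>n. ((real n + 2) * (real n + 1) + 1) * (1/2) ^ n) \<longlonglongrightarrow> 0"
      by (rule quadratic_times_power_tendsto)
    then have "\<forall>\<^sub>F n in sequentially. ((real n + 2) * (real n + 1) + 1) * (1/2) ^ n < e"
      using e by (rule order_tendstoD)
    then obtain n where n: "((real n + 2) * (real n + 1) + 1) * (1/2) ^ n < e"
      using eventually_happens'[OF sequentially_bot] by blast
    define B where "B i = {d \<in> bad. level (Suc n) d = i}" for i
    have near: "\<bar>d' - d\<bar> \<le> (1/2) ^ n / 2" if "d \<in> B i" "d' \<in> B i" for d d' i
    proof -
      have half: "\<bar>d' - d\<bar> \<le> (1/2) ^ n / 2" if "d \<in> B i" "d' \<in> B i" "d \<le> d'" for d d'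
      proof -
        have dd: "1/2 < d" "d < 1" "1/2 < d'" "d' < 1" using that by (auto simp: B_def bad_def)
        interpret A: contracted_rotation d by unfold_locales (use dd in auto)
        interpret B: contracted_rotation d' by unfold_locales (use dd in auto)
        have "A.left_mass n = B.left_mass n"
          by (rule left_mass_same_level) (use that dd in \<open>auto simp: B_def\<close>)
        moreover have "A.left_mass n \<le> 2 - 2 * d" "2 - 2 * d \<le> A.left_mass n + (1/2) ^ n"
          by (rule A.break_position; use that(1) in \<open>simp add: B_def bad_def\<close>)+
        moreover have "B.left_mass n \<le> 2 - 2 * d'" "2 - 2 * d' \<le> B.left_mass n + (1/2) ^ n"
          by (rule B.break_position; use that(2) in \<open>simp add: B_def bad_def\<close>)+
        ultimately show ?thesis unfolding abs_le_iff by linarith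
      qed
      show ?thesis using half[OF that] half[OF that(2,1)] by (cases "d \<le> d'") (auto simp: abs_minus_commute)
    qed
    have cover: "\<exists>x. B i \<subseteq> {x - (1/2) ^ n / 2..x + (1/2) ^ n / 2}" for i
    proof (cases "B i = {}")
      case False
      then obtain x where "x \<in> B i" by blast
      have "y \<in> {x - (1/2) ^ n / 2..x + (1/2) ^ n / 2}" if "y \<in> B i" for y
        using near[OF \<open>x \<in> B i\<close> that] unfolding abs_le_iff atLeastAtMost_iff by linarith
      then show ?thesis by blast
    qed simp
    obtain x where x: "B i \<subseteq> {x i - (1/2) ^ n / 2..x i + (1/2) ^ n / 2}" for i
      using cover by metis
    \<comment> \<open>The bound on \<open>level (Suc n)\<close>: at most \<open>M + 1\<close>
      intervals of length \<open>(1/2) ^ n\<close> cover \<open>bad\<close>.\<close>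
    define M where "M = (n + 2) * (n + 1)"
    define T where "T = (\<Union>i\<in>{..M}. {x i - (1/2) ^ n / 2..x i + (1/2) ^ n / 2})"
    show "\<exists>T. bad \<subseteq> T \<and> T \<in> lmeasurable \<and> measure lebesgue T \<le> e"
    proof (intro exI[of _ T] conjI)
      show "bad \<subseteq> T"
      proof
        fix d assume d: "d \<in> bad"
        then have "level (Suc n) d \<le> M" using level_le[of d "Suc n"] by (simp add: bad_def M_def)
        moreover have "d \<in> B (level (Suc n) d)" using d by (simp add: B_def)
        ultimately show "d \<in> T" using x unfolding T_def by blast
      qed
      show "T \<in> lmeasurable" unfolding T_def by (intro fmeasurable.finite_UN) auto
      have "measure lebesgue T \<le> (\<Sum>i\<in>{..M}. measure lebesgue {x i - (1/2) ^ n / 2..x i + (1/2) ^ n / 2})"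
        unfolding T_def by (intro measure_UNION_le) auto
      also have "\<dots> = (real M + 1) * (1/2) ^ n" by simp
      also have "\<dots> \<le> e" using n by (simp add: M_def algebra_simps)
      finally show "measure lebesgue T \<le> e" .
    qed
  qed
  ultimately have "negligible (hits \<union> bad)" by (rule negligible_Un)
  moreover have "{d. 1/2 < d \<and> d < 1 \<and> (\<nexists>p m. attracting_cycle d p m)} \<subseteq> hits \<union> bad"
  proof
    fix d assume d: "d \<in> {d. 1/2 < d \<and> d < 1 \<and> (\<nexists>p m. attracting_cycle d p m)}"
    have "d \<in> bad" if "d \<notin> hits"
    proof -
      have no_hit: "gap_end d j \<noteq> 2 - 2 * d" if "1 \<le> j" for j
        using \<open>d \<notin> hits\<close> d that by (auto simp: hits_def)
      have "2 - 2 * d \<le> gap_start d j \<or> gap_end d j < 2 - 2 * d" if "1 \<le> j" for j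
      proof (rule ccontr)
        assume "\<not> ?thesis"
        then have "gap_start d j < 2 - 2 * d" "2 - 2 * d < gap_end d j" using no_hit[OF that] by auto
        then show False using attracting_cycle_if_trapped[of d j] no_hit d that by auto
      qed
      then show ?thesis using d by (simp add: bad_def)
    qed
    then show "d \<in> hits \<union> bad" by blast
  qed
  ultimately show ?thesis using negligible_subset by blast
qed

section \<open>Angles in the fundamental interval\<close>

lemma approaches_funpow:
  assumes "approaches f ((f ^^ n) z) P" shows "approaches f z P"
  unfolding approaches_def
proof (intro ballI allI impI)
  fix y \<epsilon> assume "y \<in> P" "(\<epsilon>::real) > 0"
  then obtain k where "dist ((f ^^ k) ((f ^^ n) z)) y < \<epsilon>" using assms unfolding approaches_def by blast
  then show "\<exists>k. dist ((f ^^ k) z) y < \<epsilon>" by (intro exI[of _ "k + n"]) (simp add: funpow_plus)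
qed

lemma forward_orbit_fixed: "f x = x \<Longrightarrow> forward_orbit f x = {x}"
proof -
  assume f: "f x = x"
  have "(f ^^ n) x = x" for n by (induction n) (simp_all add: f)
  then show ?thesis by (auto simp: forward_orbit_def)
qed

lemma cocycle_cong:
  assumes "\<And>x. x \<in> S \<Longrightarrow> f x \<in> S" "\<And>x. x \<in> S \<Longrightarrow> s x = s' x" "z \<in> S"
  shows "cocycle f s n z = cocycle f s' n z"
  unfolding cocycle_def using assms(2) funpow_in[OF assms(1,3)] by (intro prod.cong) auto

text \<open>The arc of length \<open>1/3\<close> around 0. For \<open>1/3 < t < 2/3\<close> its
  rotation lies in \<open>[1/6, 5/6)\<close>, where \<open>F\<close> contracts by \<open>1/2\<close>
  and returns to the arc.\<close>

definition arc :: "real set" where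
  "arc = {x \<in> D. x < 1/6 \<or> 5/6 \<le> x}"

definition arc_param :: "real \<Rightarrow> real" where
  "arc_param u = frac (u / 3 - 1/6)"

lemma arc_param_eq: "u \<in> {0..<1} \<Longrightarrow> arc_param u = (if u < 1/2 then u / 3 + 5/6 else u / 3 - 1/6)"
  unfolding arc_param_def frac_unique_iff by auto

lemma arc_param_in: "u \<in> {0..<1} \<Longrightarrow> arc_param u \<in> arc"
  by (auto simp: arc_param_eq arc_def D_def)

lemma arc_param_surj: "x \<in> arc \<Longrightarrow> \<exists>u\<in>{0..<1}. x = arc_param u"
proof -
  assume x: "x \<in> arc"
  show ?thesis
  proof (cases "x < 1/6")
    case True
    then show ?thesis using x by (intro bexI[of _ "3 * (x + 1/6)"]) (auto simp: arc_param_eq arc_def D_def field_simps)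
  next
    case False
    then show ?thesis using x by (intro bexI[of _ "3 * (x - 5/6)"]) (auto simp: arc_param_eq arc_def D_def field_simps)
  qed
qed

lemma arc_param_inj: "u \<in> {0..<1} \<Longrightarrow> v \<in> {0..<1} \<Longrightarrow> arc_param u = arc_param v \<Longrightarrow> u = v"
  by (auto simp: arc_param_eq split: if_splits)

locale arc_angle =
  fixes t :: real
  assumes t: "1/3 < t" "t < 2/3"
begin

abbreviation "f \<equiv> F_rot t"
abbreviation "c \<equiv> contracted (3 * t / 2)"

sublocale rot: contracted_rotation "3 * t / 2"
  by unfold_locales (use t in auto)

lemma frac_arc_add:
  assumes "u \<in> {0..<1}" shows "frac (arc_param u + t) = u / 3 - 1/6 + t"
proof -
  have "frac (arc_param u + t) = frac (u / 3 - 1/6 + t)"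
    unfolding arc_param_def by (rule frac_frac_add)
  also have "\<dots> = u / 3 - 1/6 + t" using assms t by (simp add: frac_eq)
  finally show ?thesis .
qed

text \<open>With \<open>x = u / 3 - 1/6 + t\<close>, both contracting branches of \<open>F\<close>
  give \<open>v / 3 - 1/6\<close> modulo 1, where \<open>v = u / 2 + 3 * t / 2\<close>; this is the
  origin of \<open>d = 3 * t / 2\<close>.\<close>

lemma F_arc_param:
  assumes u: "u \<in> {0..<1}" shows "f (arc_param u) = arc_param (c u)"
proof -
  have "f (arc_param u) = F (u / 3 - 1/6 + t)" by (simp only: F_rot_eq frac_arc_add[OF u])
  also have "\<dots> = arc_param (c u)"
  proof (cases "u < 2 - 2 * (3 * t / 2)")
    case True
    then show ?thesis using u t unfolding arc_param_eq[OF rot.f_in[OF u]]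
      by (auto simp: F_def contracted_def field_simps)
  next
    case False
    then show ?thesis using u t unfolding arc_param_eq[OF rot.f_in[OF u]]
      by (auto simp: F_def contracted_def field_simps)
  qed
  finally show ?thesis .
qed

lemma F_slope_arc: "u \<in> {0..<1} \<Longrightarrow> F_slope t (arc_param u) = 1/2"
  using t by (simp add: F_slope_def frac_arc_add)

lemma F_pow_arc_param: "u \<in> {0..<1} \<Longrightarrow> (f ^^ n) (arc_param u) = arc_param ((c ^^ n) u)"
  by (induction n) (simp_all add: F_arc_param[OF rot.f_pow_in, simplified])

lemma arc_param_continuous:
  assumes "u \<in> {0..<1}" "u \<noteq> 1/2" "\<epsilon> > 0"
  shows "\<exists>\<delta>>0. \<forall>v. \<bar>v - u\<bar> < \<delta> \<longrightarrow> \<bar>arc_param v - arc_param u\<bar> < \<epsilon>"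
proof -
  have "frac (u / 3 - 1/6) \<noteq> 0" using assms arc_param_eq[of u] by (auto simp: arc_param_def split: if_splits)
  from frac_locally_translation[OF this] obtain d where d: "d > 0"
    "\<And>y. \<bar>y - (u / 3 - 1/6)\<bar> < d \<Longrightarrow> frac y = frac (u / 3 - 1/6) + (y - (u / 3 - 1/6))" by blast
  show ?thesis
  proof (intro exI[of _ "min d \<epsilon>"] conjI allI impI)
    fix v assume v: "\<bar>v - u\<bar> < min d \<epsilon>"
    have eq: "(v / 3 - 1/6) - (u / 3 - 1/6) = (v - u) / 3" by (simp add: diff_divide_distrib)
    have small: "\<bar>(v - u) / 3\<bar> < min d \<epsilon>"
      using v by (intro le_less_trans[OF _ v]) (simp add: abs_divide)
    then have "arc_param v = arc_param u + (v - u) / 3"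
      using d(2)[of "v / 3 - 1/6"] unfolding eq arc_param_def by simp
    then show "\<bar>arc_param v - arc_param u\<bar> < \<epsilon>" using small by simp
  qed (use d assms in auto)
qed

context
  fixes p0 :: real and m :: nat
  assumes cyc: "attracting_cycle (3 * t / 2) p0 m"
begin

lemma m: "0 < m" and p0: "p0 \<in> {0..<1}" "(c ^^ m) p0 = p0"
  and p0_avoids: "(c ^^ k) p0 \<notin> {0, 1/2, 2 - 2 * (3 * t / 2)}"
  using cyc by (auto simp: attracting_cycle_def)

lemma p0_sync:
  obtains N where
    "\<And>u. u \<in> {0..<1} \<Longrightarrow> \<exists>i. \<forall>k. \<bar>(c ^^ (N + k)) u - (c ^^ (i + k)) p0\<bar> \<le> (1/2) ^ k"
  using cyc unfolding attracting_cycle_def by blast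

lemma arc_periodic: "(f ^^ m) (arc_param p0) = arc_param p0"
  by (simp only: F_pow_arc_param[OF p0(1)] p0(2))

lemma arc_cocycle: "cocycle f (F_slope t) m (arc_param p0) < 1"
proof -
  have "cocycle f (F_slope t) m (arc_param p0) = (\<Prod>j<m. 1/2)"
    unfolding cocycle_def by (intro prod.cong refl) (simp only: F_pow_arc_param[OF p0(1)] F_slope_arc rot.f_pow_in[OF p0(1)])
  also have "\<dots> < 1" using m by (simp add: power_less_one_iff power_one_over)
  finally show ?thesis .
qed

lemma arc_orbit_avoids: "forward_orbit f (arc_param p0) \<inter> breaks = {}"
proof -
  have "arc_param ((c ^^ k) p0) \<notin> breaks" for k
    using p0_avoids[of k] rot.f_pow_in[OF p0(1), of k] arc_param_eq[of "(c ^^ k) p0"]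
    by (auto simp: breaks_def split: if_splits)
  then show ?thesis by (auto elim!: orbitE simp: F_pow_arc_param[OF p0(1)])
qed

lemma arc_approaches:
  assumes "z \<in> arc" shows "approaches f z (forward_orbit f (arc_param p0))"
  unfolding approaches_def
proof (intro ballI allI impI)
  fix y and \<epsilon> :: real assume y: "y \<in> forward_orbit f (arc_param p0)" and e: "\<epsilon> > 0"
  obtain u where u: "u \<in> {0..<1}" "z = arc_param u" using arc_param_surj[OF assms] by blast
  obtain j where j: "y = arc_param ((c ^^ j) p0)" using y orbitE F_pow_arc_param[OF p0(1)] by metis
  have pj: "(c ^^ j) p0 \<in> {0..<1}" "(c ^^ j) p0 \<noteq> 1/2" using rot.f_pow_in[OF p0(1)] p0_avoids[of j] by auto
  obtain d where d: "d > 0" "\<And>v. \<bar>v - (c ^^ j) p0\<bar> < d \<Longrightarrow> \<bar>arc_param v - y\<bar> < \<epsilon>"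
    using arc_param_continuous[OF pj e] unfolding j by blast
  obtain N where "\<And>u. u \<in> {0..<1} \<Longrightarrow> \<exists>i. \<forall>k. \<bar>(c ^^ (N + k)) u - (c ^^ (i + k)) p0\<bar> \<le> (1/2) ^ k"
    using p0_sync by blast
  then obtain i where i: "\<And>k. \<bar>(c ^^ (N + k)) u - (c ^^ (i + k)) p0\<bar> \<le> (1/2) ^ k" using u(1) by blast
  obtain K where K: "(1/2::real) ^ K < d" using real_arch_pow_inv[of d "1/2"] d by auto
  \<comment> \<open>Chosen so that \<open>i + k\<close> is \<open>j\<close> modulo \<open>m\<close>
    and \<open>k \<ge> K\<close>.\<close>
  define k where "k = j + i * (m - 1) + K * m"
  have "i + k = j + (i + K) * m" using m by (cases m) (auto simp: k_def algebra_simps)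
  then have "(c ^^ (i + k)) p0 = (c ^^ j) p0"
    by (simp only: funpow_plus periodic_mult[OF p0(2)])
  then have "\<bar>(c ^^ (N + k)) u - (c ^^ j) p0\<bar> \<le> (1/2) ^ k" using i[of k] by simp
  also have "K \<le> k" using m by (simp add: k_def trans_le_add2)
  then have "(1/2::real) ^ k \<le> (1/2) ^ K" by (intro power_decreasing) auto
  finally have "\<bar>arc_param ((c ^^ (N + k)) u) - y\<bar> < \<epsilon>" using K d(2) by simp
  then show "\<exists>n. dist ((f ^^ n) z) y < \<epsilon>"
    by (intro exI[of _ "N + k"]) (simp add: u(2) F_pow_arc_param[OF u(1)] dist_real_def)
qed

text \<open>A point with backward histories of every length in the arc is within
  \<open>(1/2) ^ K\<close> of the finite cycle for every \<open>K\<close>, because the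
  synchronisation time is uniform.\<close>

lemma arc_persistent:
  assumes "\<And>n. \<exists>w\<in>arc. (f ^^ n) w = z" shows "z \<in> forward_orbit f (arc_param p0)"
proof -
  have "z \<in> arc" using assms[of 0] by auto
  then obtain u where u: "u \<in> {0..<1}" "z = arc_param u" using arc_param_surj by blast
  define P where "P = forward_orbit c p0"
  have finP: "finite P" unfolding P_def periodic_orbit_finite[OF p0(2) m] by simp
  have "u \<in> P"
  proof (rule ccontr)
    assume "u \<notin> P"
    define e where "e = Min ((\<lambda>y. \<bar>u - y\<bar>) ` P)"
    have ne: "P \<noteq> {}" unfolding P_def using orbit_self by (metis empty_iff)
    have "e > 0" unfolding e_def using finP ne \<open>u \<notin> P\<close> by (subst Min_gr_iff) auto
    obtain N where N: "\<And>u. u \<in> {0..<1} \<Longrightarrow> \<exists>i. \<forall>k. \<bar>(c ^^ (N + k)) u - (c ^^ (i + k)) p0\<bar> \<le> (1/2) ^ k"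
      using p0_sync by blast
    obtain K where K: "(1/2::real) ^ K < e" using real_arch_pow_inv[of e "1/2"] \<open>e > 0\<close> by auto
    obtain v where v: "v \<in> {0..<1}" "(f ^^ (N + K)) (arc_param v) = z"
      using assms[of "N + K"] arc_param_surj by blast
    have "arc_param u = arc_param ((c ^^ (N + K)) v)" using v u(2) F_pow_arc_param[OF v(1)] by simp
    then have "u = (c ^^ (N + K)) v" using arc_param_inj u(1) rot.f_pow_in[OF v(1)] by blast
    then obtain i where "\<bar>u - (c ^^ (i + K)) p0\<bar> \<le> (1/2) ^ K" using N[OF v(1)] by blast
    moreover have "e \<le> \<bar>u - (c ^^ (i + K)) p0\<bar>"
      unfolding e_def using finP by (intro Min_le) (auto simp: P_def)
    ultimately show False using K by linarith
  qed
  then obtain k where "u = (c ^^ k) p0" unfolding P_def using orbitE by metis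
  then show ?thesis using u(2) F_pow_arc_param[OF p0(1)] orbit_funpow by metis
qed

end

end

text \<open>\<open>F_rot t\<close> contracts the arc around 0; its inverse, which is conjugate to \<open>F_rot (- t)\<close>, contracts the
  rotated arc. Every point outside the rotated arc is mapped into the arc.\<close>

lemma good_angle_arc:
  assumes t: "1/3 < t" "t < 2/3"
    and cyc: "attracting_cycle (3 * t / 2) p0 m" and cyc': "attracting_cycle (3 * (1 - t) / 2) p0' m'"
  shows "good_angle t"
proof -
  interpret A: arc_angle t by unfold_locales (use t in auto)
  interpret B: arc_angle "1 - t" by unfold_locales (use t in auto)
  let ?f = "F_rot t" and ?g = "F_rot_inv t" and ?h = "F_rot (- t)"
  interpret I: invertible_map ?f ?g D by (rule invertible_F_rot)
  interpret I': invertible_map ?h "F_rot_inv (- t)" D by (rule invertible_F_rot)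
  define p p' where "p = arc_param p0" and "p' = arc_param p0'"
  note arcA = A.m[OF cyc] A.arc_periodic[OF cyc, folded p_def] A.arc_cocycle[OF cyc, folded p_def]
    A.arc_orbit_avoids[OF cyc, folded p_def]
  note convA = A.arc_approaches[OF cyc, folded p_def] A.arc_persistent[OF cyc, folded p_def]
  have h: "F_rot (1 - t) = ?h" using F_rot_add_of_int[of "- t" 1] by simp
  have hs: "F_slope (1 - t) = F_slope (- t)"
  proof
    fix x
    have "frac (x + (1 - t)) = frac (x + - t)" using frac_add_int[of "x - t" 1] by (simp add: algebra_simps)
    then show "F_slope (1 - t) x = F_slope (- t) x" unfolding F_slope_def by simp
  qed
  note arcB = B.m[OF cyc'] B.arc_periodic[OF cyc', folded p'_def, unfolded h]
    B.arc_cocycle[OF cyc', folded p'_def, unfolded h hs] B.arc_orbit_avoids[OF cyc', folded p'_def, unfolded h]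
  note convB = B.arc_approaches[OF cyc', folded p'_def, unfolded h] B.arc_persistent[OF cyc', folded p'_def, unfolded h]
  have arcD: "arc \<subseteq> D" by (auto simp: arc_def)
  have pD: "p \<in> D" "p' \<in> D"
    unfolding p_def p'_def using arc_param_in A.p0[OF cyc] B.p0[OF cyc'] arcD by blast+
  \<comment> \<open>The slope that results from inverting twice; on \<open>D\<close> it agrees with
    \<open>F_slope (- t)\<close>.\<close>
  define s where "s = (\<lambda>z. 1 / (1 / F_slope (- t) (F_rot_inv (- t) (?h z))))"
  interpret C: section_conjugacy ?h "F_rot_inv (- t)" D ?g ?f D s D "\<lambda>z. 1 / F_slope t (?g z)" D
      "rotation (- t)" "rotation t" breaks breaks
    using section_conjugacy.inverse[OF conjugate_F_rot_minus[of "- t"]] by (simp add: s_def)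
  have "cocycle ?h s m' p' = cocycle ?h (F_slope (- t)) m' p'"
    by (rule cocycle_cong[of D]) (simp_all add: s_def I'.f_in I'.gf pD)
  then have s1: "cocycle ?h s m' p' < 1" using arcB by simp
  obtain p1 n where p1: "p1 \<in> D" "p1 \<in> forward_orbit ?h p'" "0 < n" "(?g ^^ n) (rotation (- t) p1) = rotation (- t) p1"
    "cocycle ?g (\<lambda>z. 1 / F_slope t (?g z)) n (rotation (- t) p1) = cocycle ?h s m' p'"
    "forward_orbit ?g (rotation (- t) p1) \<inter> breaks = {}"
    using C.periodic_image[OF pD(2) arcB(1,2,4)] .
  define q where "q = rotation (- t) p1"
  have qD: "q \<in> D" by (simp add: q_def rotation_in_D)
  have qper: "(?f ^^ n) q = q" using I.f_pow_g_pow[OF qD, of n] p1(4) by (simp add: q_def)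
  have orb: "forward_orbit ?g q = forward_orbit ?f q" by (rule I.orbit_g_eq[OF qD qper p1(3)])
  have "1 / cocycle ?f (F_slope t) n q < 1"
    using p1(5) s1 I.cocycle_inverse_periodic[OF qD qper] by (simp add: q_def)
  moreover have "0 < cocycle ?f (F_slope t) n q"
    unfolding cocycle_def by (intro prod_pos) (simp add: F_slope_pos)
  ultimately have qexp: "1 < cocycle ?f (F_slope t) n q" by (simp add: field_simps)
  have orb': "forward_orbit ?h p1 = forward_orbit ?h p'" by (rule periodic_orbit_eq[OF arcB(2,1) p1(2)])
  have per1: "(?h ^^ m') p1 = p1" by (rule periodic_orbit_point[OF arcB(2) p1(2)])
  have outside: "?f x \<in> arc" if "x \<in> D" "rotation t x \<notin> arc" for x
    using that rotation_in_D[of t x] by (auto simp: F_rot_def arc_def D_def F_def field_simps)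
  have gpow: "(?g ^^ k) x = rotation (- t) ((?h ^^ k) (rotation t x))" if "x \<in> D" for k x
  proof (induction k)
    case 0
    then show ?case using that by (simp add: rotation_def frac_frac_diff frac_D)
  next
    case (Suc k)
    let ?y = "(?h ^^ k) (rotation t x)"
    have "?y \<in> D" by (simp add: I'.f_pow_in rotation_in_D)
    then have "?g (rotation (- t) ?y) = rotation (- t) (?h ?y)"
      by (simp add: F_rot_inv_def F_rot_eq rotation_def)
    then show ?case by (simp add: Suc)
  qed
  have forward: "z \<in> forward_orbit ?f q \<or> approaches ?f z (forward_orbit ?f p)" if z: "z \<in> D" for z
  proof (cases "\<exists>n. (?f ^^ n) z \<in> arc")
    case True
    then show ?thesis using convA(1) approaches_funpow by blast
  next
    case False
    \<comment> \<open>An orbit that never enters the arc stays, after rotation, in it. Read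
      backwards, \<open>rotation t z\<close> has histories of every length in the arc for
      \<open>F_rot (- t)\<close> and so lies on its cycle.\<close>
    have "\<exists>w\<in>arc. (?h ^^ n) w = rotation t z" for n
    proof
      let ?x = "(?f ^^ n) z"
      have x: "?x \<in> D" by (rule I.f_pow_in[OF z])
      have "(?f ^^ Suc n) z \<notin> arc" using False by blast
      then show "rotation t ?x \<in> arc" using outside[OF x] by auto
      have "z = rotation (- t) ((?h ^^ n) (rotation t ?x))"
        using gpow[OF x, of n] I.g_pow_f_pow[OF z, of n] by simp
      moreover have "(?h ^^ n) (rotation t ?x) \<in> D" by (simp add: I'.f_pow_in rotation_in_D)
      ultimately show "(?h ^^ n) (rotation t ?x) = rotation t z"
        by (metis C.\<psi>\<phi>)
    qed
    then have "rotation t z \<in> forward_orbit ?h p1" unfolding orb' by (rule convB(2))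
    then have "rotation (- t) (rotation t z) \<in> forward_orbit ?g (rotation (- t) p1)"
      using C.orbit_image p1(1) rotation_in_D by blast
    then show ?thesis using orb z by (simp add: q_def rotation_def frac_frac_diff frac_D)
  qed
  have backward: "z \<in> forward_orbit ?f p \<or> approaches ?g z (forward_orbit ?f q)" if z: "z \<in> D" for z
  proof (cases "\<exists>n. rotation t ((?g ^^ n) z) \<in> arc")
    case True
    then obtain n' where n': "rotation t ((?g ^^ n') z) \<in> arc" by blast
    let ?x = "(?g ^^ n') z"
    have x: "?x \<in> D" by (rule I.g_pow_in[OF z])
    have "approaches ?g ?x (forward_orbit ?g (rotation (- t) p1))"
    proof (rule C.approaches_image[OF p1(1) arcB(1) per1 _ p1(3,4,6)])
      show "rotation t ?x \<in> D" by (rule rotation_in_D)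
      show "approaches ?h (rotation t ?x) (forward_orbit ?h p1)" unfolding orb' by (rule convB(1)[OF n'])
      show "(?g ^^ 0) ?x = rotation (- t) (rotation t ?x)"
        using x by (simp add: rotation_def frac_frac_diff frac_D)
    qed (use orb' arcB(4) x in auto)
    then show ?thesis using approaches_funpow orb q_def by metis
  next
    case False
    have "\<exists>w\<in>arc. (?f ^^ n) w = z" for n
    proof
      show "(?f ^^ n) ((?g ^^ n) z) = z" by (rule I.f_pow_g_pow[OF z])
      have x: "(?g ^^ Suc n) z \<in> D" by (rule I.g_pow_in[OF z])
      have "?f ((?g ^^ Suc n) z) = (?g ^^ n) z" using I.fg[OF I.g_pow_in[OF z, of n]] by simp
      then show "(?g ^^ n) z \<in> arc" using outside[OF x] False by metis
    qed
    then show ?thesis using convA(2) by blast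
  qed
  have "sink_source ?f ?g D breaks (F_slope t) p q"
    unfolding sink_source_def
    using pD qD arcA qper p1(3) qexp p1(6) orb forward backward by (auto simp: q_def)
  then show ?thesis unfolding good_angle_def trivial_dynamics_def by blast
qed

text \<open>For \<open>t\<close> below \<open>1/3\<close> the cycles are the two fixed points \<open>t - 1/6\<close> and \<open>7/6 - 2 * t\<close>. Points of the
  zones \<open>over_2\<close> and \<open>over_0\<close> alternate between these zones and drift by \<open>3 * t - 2/3\<close> in each round.\<close>

locale fixed_point_angle =
  fixes t :: real
  assumes t: "2/9 < t" "t < 1/3"
begin

abbreviation "f \<equiv> F_rot t"
abbreviation "g \<equiv> F_rot_inv t"

definition p :: real where "p = t - 1/6"
definition q :: real where "q = 7/6 - 2 * t"

text \<open>The four zones are the preimages of the strips under rotation by \<open>t\<close>; the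
  trap is the one over strip 1, which wraps around 0.\<close>

definition trap :: "real set" where "trap = {x \<in> D. x < 1/2 - t \<or> 7/6 - t \<le> x}"
definition over_2 :: "real set" where "over_2 = {1/2 - t..<5/6 - t}"
definition over_3 :: "real set" where "over_3 = {5/6 - t..<1 - t}"
definition over_0 :: "real set" where "over_0 = {1 - t..<7/6 - t}"

sublocale I: invertible_map f g D by (rule invertible_F_rot)

lemma frac_add_t: "x \<in> D \<Longrightarrow> frac (x + t) = (if x + t < 1 then x + t else x + t - 1)"
  using t unfolding frac_unique_iff by (auto simp: D_def)

lemma zones: "x \<in> D \<Longrightarrow> x \<in> trap \<or> x \<in> over_2 \<or> x \<in> over_3 \<or> x \<in> over_0"
  by (auto simp: trap_def over_2_def over_3_def over_0_def)

lemma zones_subset: "trap \<subseteq> D" "over_2 \<subseteq> D" "over_3 \<subseteq> D" "over_0 \<subseteq> D"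
  using t by (auto simp: trap_def over_2_def over_3_def over_0_def D_def)

lemma F_eq:
  "x \<in> trap \<Longrightarrow> f x = ((if x < 1/2 - t then x else x - 1) + t - 1/6) / 2"
  "x \<in> over_2 \<Longrightarrow> f x = (x + t - 1/2) / 2 + 5/6"
  "x \<in> over_3 \<Longrightarrow> f x = 2 * x + 2 * t - 7/6"
  "x \<in> over_0 \<Longrightarrow> f x = 2 * (x + t - 1) + 1/6"
proof -
  have f: "f x = F (if x + t < 1 then x + t else x + t - 1)" if "x \<in> D"
    using that by (simp only: F_rot_eq frac_add_t)
  show "x \<in> trap \<Longrightarrow> f x = ((if x < 1/2 - t then x else x - 1) + t - 1/6) / 2"
    using f zones_subset t by (auto simp: F_def trap_def D_def)
  show "x \<in> over_2 \<Longrightarrow> f x = (x + t - 1/2) / 2 + 5/6"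
    using f zones_subset t by (auto simp: F_def over_2_def)
  show "x \<in> over_3 \<Longrightarrow> f x = 2 * x + 2 * t - 7/6"
    using f zones_subset t by (auto simp: F_def over_3_def)
  show "x \<in> over_0 \<Longrightarrow> f x = 2 * (x + t - 1) + 1/6"
    using f zones_subset t by (auto simp: F_def over_0_def)
qed

lemma fixed_points: "p \<in> D" "q \<in> D" "f p = p" "f q = q" "p \<notin> breaks" "q \<notin> breaks" "q \<in> over_3"
  using t by (auto simp: p_def q_def D_def F_rot_eq frac_add_t F_def breaks_def over_3_def field_simps)

lemma F_trap: "x \<in> trap \<Longrightarrow> f x \<in> {0..<1/6}" "{0..<1/6} \<subseteq> trap"
  using t by (auto simp: F_eq trap_def D_def field_simps)

lemma F_contracts: "x \<in> {0..<1/6} \<Longrightarrow> \<bar>f x - p\<bar> = \<bar>x - p\<bar> / 2"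
  using F_trap(2) t by (auto simp: F_eq p_def subset_iff abs_if field_simps)

lemma F_expands: "x \<in> over_3 \<Longrightarrow> \<bar>f x - q\<bar> = 2 * \<bar>x - q\<bar>"
  by (auto simp: F_eq q_def abs_if)

text \<open>Read backwards: a backward orbit in \<open>over_3\<close> stays there, where the inverse
  contracts towards \<open>q\<close>.\<close>

lemma F_not_over_3: "x \<in> D \<Longrightarrow> x \<notin> over_3 \<Longrightarrow> f x \<notin> over_3"
  using zones[of x] F_trap(1)[of x] t
  by (auto simp: F_eq over_3_def) (auto simp: over_2_def over_0_def field_simps)

lemma F_over_2: "x \<in> over_2 \<Longrightarrow> f x \<in> trap \<or> f x \<in> over_0"
  using t by (auto simp: F_eq over_2_def over_0_def trap_def D_def field_simps)

lemma F_over_0: "x \<in> over_0 \<Longrightarrow> f x \<in> trap \<or> f x \<in> over_2"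
  using t by (auto simp: F_eq over_2_def over_0_def trap_def D_def field_simps)

text \<open>The slopes \<open>1/2\<close> and 2 cancel over a round. The drift is positive precisely
  for \<open>t > 2/9\<close>.\<close>

lemma F_round: "x \<in> over_2 \<Longrightarrow> f x \<in> over_0 \<Longrightarrow> f (f x) = x + (3 * t - 2/3)"
  using t by (simp add: F_eq field_simps)

lemma zones_disjoint: "trap \<inter> over_2 = {}" "trap \<inter> over_0 = {}" "over_2 \<inter> over_0 = {}"
  "trap \<inter> over_3 = {}"
  using t by (auto simp: over_2_def over_0_def over_3_def trap_def)

lemma trap_approaches: assumes "x \<in> trap" shows "approaches f x {p}"
  unfolding approaches_def
proof (intro ballI allI impI)
  fix y and \<epsilon> :: real assume "y \<in> {p}" "\<epsilon> > 0"
  have "(f ^^ Suc n) x \<in> {0..<1/6} \<and> \<bar>(f ^^ Suc n) x - p\<bar> \<le> (1/2) ^ n" for n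
  proof (induction n)
    case 0
    then show ?case using F_trap(1)[OF assms] t by (auto simp: p_def abs_le_iff)
  next
    case (Suc n)
    let ?y = "(f ^^ Suc n) x"
    have "f ?y \<in> {0..<1/6}" using Suc F_trap by blast
    then show ?case using F_contracts[of ?y] Suc by auto
  qed
  then have *: "\<bar>(f ^^ Suc n) x - p\<bar> \<le> (1/2) ^ n" for n by blast
  obtain n where "(1/2::real) ^ n < \<epsilon>" using real_arch_pow_inv[of \<epsilon> "1/2"] \<open>\<epsilon> > 0\<close> by auto
  then show "\<exists>n. dist ((f ^^ n) x) y < \<epsilon>"
    using *[of n] \<open>y \<in> {p}\<close> by (intro exI[of _ "Suc n"]) (simp only: dist_real_def, simp)
qed

text \<open>The bounded zone \<open>over_2\<close> allows only finitely many rounds with positive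
  drift.\<close>

lemma over_2_trap: assumes "x \<in> over_2" shows "\<exists>n. (f ^^ n) x \<in> trap"
proof -
  obtain N :: nat where "(5/6 - t - x) / (3 * t - 2/3) < N" using reals_Archimedean2 by blast
  then show ?thesis using assms
  proof (induction N arbitrary: x)
    case 0
    then show ?case using t by (auto simp: over_2_def divide_less_0_iff)
  next
    case (Suc N)
    show ?case
    proof (cases "f x \<in> trap")
      case True
      then show ?thesis by (intro exI[of _ 1]) simp
    next
      case False
      then have 0: "f x \<in> over_0" using F_over_2 Suc.prems(2) by blast
      show ?thesis
      proof (cases "f (f x) \<in> trap")
        case True
        then show ?thesis by (intro exI[of _ 2]) (simp add: numeral_2_eq_2)
      next
        case False
        then have "f (f x) \<in> over_2" using F_over_0[OF 0] by blast
        moreover have "(5/6 - t - f (f x)) / (3 * t - 2/3) < N"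
          using Suc.prems(1) F_round[OF Suc.prems(2) 0] t by (simp add: field_simps)
        ultimately obtain n where "(f ^^ n) (f (f x)) \<in> trap" using Suc.IH by blast
        then show ?thesis by (intro exI[of _ "Suc (Suc n)"]) (simp add: funpow_swap1)
      qed
    qed
  qed
qed

lemma escapes_over_3:
  assumes "x \<in> D" "x \<noteq> q" shows "\<exists>n. (f ^^ n) x \<notin> over_3"
proof (rule ccontr)
  assume *: "\<not> ?thesis"
  have "\<bar>(f ^^ n) x - q\<bar> = 2 ^ n * \<bar>x - q\<bar>" for n
    by (induction n) (use * F_expands in auto)
  moreover obtain n where "1 / \<bar>x - q\<bar> < 2 ^ n" using real_arch_pow[of 2 "1 / \<bar>x - q\<bar>"] by auto
  then have "1 < 2 ^ n * \<bar>x - q\<bar>" using assms(2) by (simp add: field_simps)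
  ultimately have "1 < \<bar>(f ^^ n) x - q\<bar>" by simp
  then show False using I.f_pow_in[OF assms(1), of n] fixed_points(2) by (auto simp: D_def)
qed

lemma forward: assumes "x \<in> D" "x \<noteq> q" shows "approaches f x {p}"
proof -
  obtain n where n: "(f ^^ n) x \<notin> over_3" using escapes_over_3[OF assms] by blast
  have "\<exists>k. (f ^^ k) ((f ^^ n) x) \<in> trap"
    using zones[OF I.f_pow_in[OF assms(1), of n]] n
  proof (elim disjE)
    assume "(f ^^ n) x \<in> trap"
    then show ?thesis by (intro exI[of _ 0]) simp
  next
    assume 0: "(f ^^ n) x \<in> over_0"
    show ?thesis
    proof (cases "f ((f ^^ n) x) \<in> trap")
      case True
      then show ?thesis by (intro exI[of _ 1]) simp
    next
      case False
      then obtain k where "(f ^^ k) (f ((f ^^ n) x)) \<in> trap" using F_over_0[OF 0] over_2_trap by blast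
      then show ?thesis by (intro exI[of _ "Suc k"]) (simp add: funpow_swap1)
    qed
  qed (use over_2_trap in auto)
  then show ?thesis using trap_approaches approaches_funpow by blast
qed

lemma over_3_approaches: assumes "x \<in> over_3" shows "approaches g x {q}"
  unfolding approaches_def
proof (intro ballI allI impI)
  fix y and \<epsilon> :: real assume "y \<in> {q}" "\<epsilon> > 0"
  have *: "(g ^^ n) x \<in> over_3 \<and> \<bar>(g ^^ n) x - q\<bar> \<le> (1/2) ^ n" for n
  proof (induction n)
    case 0
    then show ?case using assms t fixed_points(7) by (auto simp: over_3_def abs_le_iff)
  next
    case (Suc n)
    let ?y = "(g ^^ n) x"
    have "?y \<in> D" using Suc zones_subset by blast
    then have g: "g ?y \<in> D" "f (g ?y) = ?y" using I.g_in I.fg by auto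
    then have "g ?y \<in> over_3" using F_not_over_3 Suc by metis
    then show ?case using F_expands[of "g ?y"] g Suc by auto
  qed
  obtain n where "(1/2::real) ^ n < \<epsilon>" using real_arch_pow_inv[of \<epsilon> "1/2"] \<open>\<epsilon> > 0\<close> by auto
  then show "\<exists>n. dist ((g ^^ n) x) y < \<epsilon>"
    using *[of n] \<open>y \<in> {q}\<close> by (intro exI[of _ n]) (simp add: dist_real_def)
qed

text \<open>A backward orbit cannot stay in the trap, where it would recede from \<open>p\<close>
  exponentially, and cannot re-enter it after leaving. Without visiting \<open>over_3\<close> it
  would alternate between the other two zones, which the drift forbids.\<close>

lemma backward: assumes x: "x \<in> D" "x \<noteq> p" shows "approaches g x {q}"
proof (cases "\<exists>n. (g ^^ n) x \<in> over_3")
  case True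
  then show ?thesis using over_3_approaches approaches_funpow by blast
next
  case False
  have gD: "(g ^^ n) x \<in> D" for n by (rule I.g_pow_in[OF x(1)])
  have fg: "f ((g ^^ Suc n) x) = (g ^^ n) x" for n using I.fg[OF gD[of n]] by simp
  have "\<exists>n. (g ^^ n) x \<notin> trap"
  proof (rule ccontr)
    assume *: "\<not> ?thesis"
    have small: "(g ^^ n) x \<in> {0..<1/6}" for n using fg[of n] F_trap(1)[of "(g ^^ Suc n) x"] * by metis
    have "\<bar>(g ^^ n) x - p\<bar> = 2 ^ n * \<bar>x - p\<bar>" for n
    proof (induction n)
      case (Suc n)
      then show ?case using F_contracts[OF small[of "Suc n"]] unfolding fg by simp
    qed simp
    moreover obtain n where "1 / \<bar>x - p\<bar> < 2 ^ n" using real_arch_pow[of 2 "1 / \<bar>x - p\<bar>"] by auto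
    then have "1 < 2 ^ n * \<bar>x - p\<bar>" using x(2) by (simp add: field_simps)
    ultimately have "1 < \<bar>(g ^^ n) x - p\<bar>" by simp
    then show False using gD[of n] fixed_points(1) by (auto simp: D_def)
  qed
  then obtain n where n: "(g ^^ n) x \<notin> trap" by blast
  have not_trap: "(g ^^ k) x \<notin> trap" if "n \<le> k" for k
    using that
  proof (induction k rule: dec_induct)
    case (step k)
    then show ?case using fg[of k] F_trap by (metis subsetD)
  qed (rule n)
  have alt: "(g ^^ k) x \<in> over_2 \<or> (g ^^ k) x \<in> over_0" if "n \<le> k" for k
    using zones[OF gD[of k]] not_trap[OF that] False by blast
  have back_2: "(g ^^ Suc k) x \<in> over_0" if "n \<le> k" "(g ^^ k) x \<in> over_2" for k
    using alt[of "Suc k"] that F_over_2[of "(g ^^ Suc k) x"] zones_disjoint unfolding fg by auto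
  have back_0: "(g ^^ Suc k) x \<in> over_2" if "n \<le> k" "(g ^^ k) x \<in> over_0" for k
    using alt[of "Suc k"] that F_over_0[of "(g ^^ Suc k) x"] zones_disjoint unfolding fg by auto
  obtain k0 where k0: "n \<le> k0" "(g ^^ k0) x \<in> over_2"
    using alt[of n] back_0[of n] by (metis le_SucI order_refl)
  \<comment> \<open>Backward rounds move left by a fixed amount, so the orbit would become
    negative.\<close>
  have drift: "(g ^^ (k0 + 2 * i)) x \<in> over_2 \<and>
    (g ^^ (k0 + 2 * i)) x = (g ^^ k0) x - i * (3 * t - 2/3)" for i
  proof (induction i)
    case (Suc i)
    let ?k = "k0 + 2 * i"
    have le: "n \<le> ?k" using k0 by simp
    have 0: "(g ^^ Suc ?k) x \<in> over_0" by (rule back_2[OF le conjunct1[OF Suc]])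
    have 2: "(g ^^ Suc (Suc ?k)) x \<in> over_2" by (rule back_0[OF le_SucI[OF le] 0])
    have "(g ^^ ?k) x = (g ^^ Suc (Suc ?k)) x + (3 * t - 2/3)"
      using F_round[OF 2] 0 unfolding fg by simp
    then show ?case using 2 Suc by (simp add: field_simps)
  qed (use k0 in simp)
  obtain i :: nat where i: "1 / (3 * t - 2/3) < i" using reals_Archimedean2 by blast
  have "1 < i * (3 * t - 2/3)" using i t by (simp add: field_simps)
  then have "(g ^^ (k0 + 2 * i)) x < 0" using drift[of i] gD[of k0] by (auto simp: D_def)
  then show ?thesis using gD[of "k0 + 2 * i"] by (auto simp: D_def)
qed

lemma good: "good_angle t"
proof -
  have orb: "forward_orbit f p = {p}" "forward_orbit f q = {q}"
    using forward_orbit_fixed[of f p] forward_orbit_fixed[of f q] fixed_points(3,4) by blast+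
  have s: "F_slope t p < 1" "1 < F_slope t q"
    using fixed_points t by (auto simp: F_slope_def frac_add_t) (auto simp: p_def q_def)
  have "sink_source f g D breaks (F_slope t) p q"
    unfolding sink_source_def orb
  proof (intro conjI exI[of _ 1] ballI)
    show "z \<in> {q} \<or> approaches f z {p}" if "z \<in> D" for z using forward[OF that] by blast
    show "z \<in> {p} \<or> approaches g z {q}" if "z \<in> D" for z using backward[OF that] by blast
  qed (use fixed_points s in \<open>simp_all add: cocycle_def\<close>)
  then show ?thesis unfolding good_angle_def trivial_dynamics_def by blast
qed

end

section \<open>Exceptional angles in the fundamental interval\<close>

lemma negligible_affine_preimage:
  fixes S :: "real set"
  assumes "negligible S" "a \<noteq> 0" shows "negligible {t. a * t + b \<in> S}"
proof -
  have "negligible ((\<lambda>x. (x - b) / a) ` S)"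
  proof (intro negligible_differentiable_image_negligible)
    show "(\<lambda>x. (x - b) / a) differentiable_on S"
      unfolding differentiable_on_def
    proof
      fix x
      have "((\<lambda>x. (x - b) / a) has_real_derivative 1 / a) (at x within S)"
        using assms(2) by (auto intro!: derivative_eq_intros)
      then have "(\<lambda>x. (x - b) / a) field_differentiable (at x within S)"
        unfolding field_differentiable_def by blast
      then show "(\<lambda>x. (x - b) / a) differentiable (at x within S)"
        by (rule field_differentiable_imp_differentiable)
    qed
  qed (use assms in auto)
  moreover have "{t. a * t + b \<in> S} \<subseteq> (\<lambda>x. (x - b) / a) ` S"
  proof
    fix t assume "t \<in> {t. a * t + b \<in> S}"
    then show "t \<in> (\<lambda>x. (x - b) / a) ` S"
      using assms(2) by (intro image_eqI[of _ _ "a * t + b"]) auto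
  qed
  ultimately show ?thesis using negligible_subset by blast
qed

text \<open>Angles above \<open>2/3\<close> reflect to \<open>1 - t\<close> below
  \<open>1/3\<close>. In the middle, the sink needs a cycle for \<open>3 * t / 2\<close> and the
  source one for \<open>3 * (1 - t) / 2\<close>, so two affine preimages of the null set are
  removed.\<close>

lemma negligible_bad_fundamental: "negligible ({t. \<not> good_angle t} \<inter> {2/9<..<7/9})"
proof -
  define S where "S = {d. 1/2 < d \<and> d < 1 \<and> (\<nexists>p m. attracting_cycle d p m)}"
  have S: "negligible S" unfolding S_def by (rule negligible_no_attracting_cycle)
  have one_minus: "good_angle t" if "good_angle (1 - t)" for t
    using good_angle_minus[OF that] good_angle_add_int[of "t - 1" 1] by simp
  have sub: "{t. \<not> good_angle t} \<inter> {2/9<..<7/9} \<subseteq> {1/3, 2/3} \<union> {t. 3/2 * t + 0 \<in> S} \<union> {t. - 3/2 * t + 3/2 \<in> S}"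
  proof
    fix t assume t: "t \<in> {t. \<not> good_angle t} \<inter> {2/9<..<7/9}"
    then have bad: "\<not> good_angle t" "2/9 < t" "t < 7/9" by auto
    have "\<not> t < 1/3"
      using fixed_point_angle.good[of t] bad by (auto simp: fixed_point_angle_def)
    moreover have "\<not> 2/3 < t"
      using fixed_point_angle.good[of "1 - t"] one_minus bad by (auto simp: fixed_point_angle_def)
    moreover have "3/2 * t \<in> S \<or> - 3/2 * t + 3/2 \<in> S" if "1/3 < t" "t < 2/3"
    proof (rule ccontr)
      assume *: "\<not> ?thesis"
      have "3/2 * t = 3 * t / 2" "- 3/2 * t + 3/2 = 3 * (1 - t) / 2" by (simp_all add: field_simps)
      then have "3 * t / 2 \<notin> S" "3 * (1 - t) / 2 \<notin> S" using * by metis+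
      moreover have "1/2 < 3 * t / 2" "3 * t / 2 < 1" "1/2 < 3 * (1 - t) / 2" "3 * (1 - t) / 2 < 1"
        using that by auto
      ultimately have "\<exists>p m. attracting_cycle (3 * t / 2) p m" "\<exists>p m. attracting_cycle (3 * (1 - t) / 2) p m"
        unfolding S_def by blast+
      then show False using good_angle_arc[OF that] bad(1) by blast
    qed
    ultimately show "t \<in> {1/3, 2/3} \<union> {t. 3/2 * t + 0 \<in> S} \<union> {t. - 3/2 * t + 3/2 \<in> S}"
      by (cases "t = 1/3 \<or> t = 2/3") auto
  qed
  show ?thesis
    by (rule negligible_subset[OF _ sub], intro negligible_Un negligible_affine_preimage S) auto
qed

lemma negligible_bad_angles: "negligible {t. \<not> good_angle t}"
proof (rule negligible_if_invariant)
  show "negligible ({t. \<not> good_angle t} \<inter> {2/9<..<7/9})" by (rule negligible_bad_fundamental)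
  show "t + of_int n \<in> {t. \<not> good_angle t}" if "t \<in> {t. \<not> good_angle t}" for t n
    using that good_angle_add_int by simp
  show "t' \<in> {t. \<not> good_angle t}"
    if "t \<in> {t. \<not> good_angle t}" "t \<noteq> 0" "t' \<noteq> 0" "1 / t' = 1 / t + 9 * of_int n" for t t' n
    using that(1) good_angle_shear[OF that(2-4)] by simp
qed

section \<open>From cycles to dynamical triviality\<close>

text \<open>The neighbourhood is two-sided in the real line even at \<open>x = 0\<close>, since
  \<open>F_rot t\<close> is periodic there.\<close>

lemma F_rot_locally_affine:
  assumes "x \<in> D" "F_rot t x \<notin> breaks"
  shows "\<exists>\<delta>>0. \<forall>y. \<bar>y - x\<bar> < \<delta> \<longrightarrow> F_rot t y = F_rot t x + F_slope t x * (y - x)"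
proof -
  define z where "z = frac (x + t)"
  have "z \<notin> breaks" using F_breaks[of z] assms(2) by (auto simp: z_def F_rot_eq)
  then have "frac (x + t) \<noteq> 0" by (auto simp: z_def breaks_def)
  from frac_locally_translation[OF this] obtain d where d: "d > 0"
    "\<And>y. \<bar>y - (x + t)\<bar> < d \<Longrightarrow> frac y = z + (y - (x + t))" unfolding z_def by blast
  define e where "e = Min {\<bar>z - 1/6\<bar>, \<bar>z - 1/2\<bar>, \<bar>z - 5/6\<bar>}"
  have "e > 0" using \<open>z \<notin> breaks\<close> by (auto simp: e_def breaks_def)
  have aff: "F (z + h) = F z + (if z < 1/6 \<or> 5/6 \<le> z then 2 else 1/2) * h" if "\<bar>h\<bar> < e" for h
    using that by (auto simp: e_def F_def field_simps)
  show ?thesis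
  proof (intro exI[of _ "min d e"] conjI allI impI)
    fix y assume y: "\<bar>y - x\<bar> < min d e"
    then have "frac (y + t) = z + (y - x)" using d(2)[of "y + t"] by simp
    then show "F_rot t y = F_rot t x + F_slope t x * (y - x)"
      using aff[of "y - x"] y by (simp add: F_rot_eq F_slope_def flip: z_def)
  qed (use d \<open>e > 0\<close> in auto)
qed

lemma F_rot_pow_locally_affine:
  assumes x: "x \<in> D" "forward_orbit (F_rot t) x \<inter> breaks = {}"
  shows "\<exists>\<delta>>0. \<forall>y. \<bar>y - x\<bar> < \<delta> \<longrightarrow>
    (F_rot t ^^ n) y = (F_rot t ^^ n) x + cocycle (F_rot t) (F_slope t) n x * (y - x)"
proof (induction n)
  case 0
  then show ?case by (intro exI[of _ 1]) simp
next
  case (Suc n)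
  let ?f = "F_rot t"
  let ?x = "(?f ^^ n) x" and ?c = "cocycle ?f (F_slope t) n x"
  have "?x \<in> D" using invertible_map.f_pow_in[OF invertible_F_rot x(1)] .
  moreover have "?f ?x \<notin> breaks" using x(2) orbit_funpow[of "Suc n" ?f x] by auto
  ultimately obtain d where d: "d > 0"
    "\<And>y. \<bar>y - ?x\<bar> < d \<Longrightarrow> ?f y = ?f ?x + F_slope t ?x * (y - ?x)"
    using F_rot_locally_affine by blast
  obtain e where e: "e > 0" "\<And>y. \<bar>y - x\<bar> < e \<Longrightarrow> (?f ^^ n) y = ?x + ?c * (y - x)"
    using Suc.IH by blast
  define \<delta> where "\<delta> = min e (d / (\<bar>?c\<bar> + 1))"
  show ?case
  proof (intro exI[of _ \<delta>] conjI allI impI)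
    show "\<delta> > 0" using d(1) e(1) by (simp add: \<delta>_def)
    fix y assume y: "\<bar>y - x\<bar> < \<delta>"
    have *: "(?f ^^ n) y = ?x + ?c * (y - x)" using e(2) y by (simp add: \<delta>_def)
    have "\<bar>?c * (y - x)\<bar> \<le> (\<bar>?c\<bar> + 1) * \<bar>y - x\<bar>" by (simp add: abs_mult mult_right_mono)
    also have "\<dots> < d" using y by (simp add: \<delta>_def field_simps)
    finally show "(?f ^^ Suc n) y = (?f ^^ Suc n) x + cocycle ?f (F_slope t) (Suc n) x * (y - x)"
      using d(2)[of "(?f ^^ n) y"] * by (simp add: cocycle_Suc_right mult.assoc mult.left_commute)
  qed
qed

lemma minimal_period:
  assumes "(f ^^ m) x = x" "0 < m"
  obtains k where "periodic_of_order f k x" "k dvd m"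
proof -
  define k where "k = (LEAST k. 0 < k \<and> (f ^^ k) x = x)"
  have k: "0 < k \<and> (f ^^ k) x = x" unfolding k_def by (rule LeastI[of _ m]) (use assms in simp)
  have least: "(f ^^ j) x \<noteq> x" if "0 < j" "j < k" for j using not_less_Least that unfolding k_def by blast
  have "(f ^^ (m mod k)) x = x"
  proof -
    have "x = (f ^^ (m mod k + m div k * k)) x" using assms(1) by simp
    also have "\<dots> = (f ^^ (m mod k)) x" unfolding funpow_plus using periodic_mult[of k f x] k by simp
    finally show ?thesis by simp
  qed
  then have "m mod k = 0" using least[of "m mod k"] k by (cases "m mod k = 0") auto
  then show thesis using that[of k] k least by (auto simp: periodic_of_order_def)
qed

text \<open>The cocycle over \<open>m\<close> is a power of the cocycle over the exact order, hence
  on the same side of 1.\<close>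

lemma cocycle_minimal_period:
  assumes "periodic_of_order f k x" "k dvd m" "0 < m" and pos: "\<And>z. s z > 0"
  shows "cocycle f s m x < 1 \<Longrightarrow> cocycle f s k x < 1" "cocycle f s m x > 1 \<Longrightarrow> cocycle f s k x > 1"
proof -
  obtain i where i: "m = i * k" using assms(2) by (metis dvdE mult.commute)
  have c: "cocycle f s m x = cocycle f s k x ^ i"
    using cocycle_mult[of k f x s i] assms(1) by (simp add: i periodic_of_order_def)
  have p: "0 < cocycle f s k x" unfolding cocycle_def by (intro prod_pos) (use pos in auto)
  show "cocycle f s k x < 1" if "cocycle f s m x < 1"
    using that one_le_power[of "cocycle f s k x" i] unfolding c by (meson not_le)
  show "cocycle f s k x > 1" if "cocycle f s m x > 1"
    using that power_le_one[of "cocycle f s k x" i] p unfolding c by (meson less_imp_le not_le)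
qed

lemma pow_has_derivative:
  assumes "x \<in> D" "forward_orbit (F_rot t) x \<inter> breaks = {}"
  shows "((F_rot t ^^ n) has_real_derivative cocycle (F_rot t) (F_slope t) n x) (at x within D)"
proof -
  let ?c = "cocycle (F_rot t) (F_slope t) n x"
  obtain d where d: "d > 0" "\<And>y. \<bar>y - x\<bar> < d \<Longrightarrow> (F_rot t ^^ n) y = (F_rot t ^^ n) x + ?c * (y - x)"
    using F_rot_pow_locally_affine[OF assms] by blast
  have "((\<lambda>y. (F_rot t ^^ n) x + ?c * (y - x)) has_real_derivative ?c) (at x within D)"
    by (auto intro!: derivative_eq_intros)
  then show ?thesis
  proof (rule has_field_derivative_transform_within[OF _ d(1) assms(1)])
    fix y assume "dist y x < d"
    then show "(F_rot t ^^ n) x + ?c * (y - x) = (F_rot t ^^ n) y"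
      using d(2)[of y] by (simp add: dist_real_def)
  qed
qed

text \<open>One visit to the neighbourhood on which the period map is affine and contracting
  suffices: from then on, each residue class of times modulo \<open>m\<close> converges to its point
  of the cycle.\<close>

lemma omega_limit_eq_orbit:
  assumes p: "p \<in> D" "forward_orbit (F_rot t) p \<inter> breaks = {}"
    and m: "0 < m" "(F_rot t ^^ m) p = p" "cocycle (F_rot t) (F_slope t) m p < 1"
    and z: "approaches (F_rot t) z (forward_orbit (F_rot t) p)"
  shows "omega_limit (F_rot t) z = forward_orbit (F_rot t) p"
proof -
  let ?f = "F_rot t"
  define c where "c = cocycle ?f (F_slope t) m p"
  have c: "0 < c" "c < 1"
    using m(3) unfolding c_def cocycle_def by (auto intro!: prod_pos simp: F_slope_pos)
  obtain d where d: "d > 0" "\<And>y. \<bar>y - p\<bar> < d \<Longrightarrow> (?f ^^ m) y = p + c * (y - p)"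
    using F_rot_pow_locally_affine[OF p, of m] m(2) unfolding c_def by auto
  obtain n0 where n0: "\<bar>(?f ^^ n0) z - p\<bar> < d"
    using z[unfolded approaches_def, rule_format, OF orbit_self d(1)] by (auto simp: dist_real_def)
  define v where "v = (?f ^^ n0) z"
  have iter: "(?f ^^ (m * i)) v = p + c ^ i * (v - p)" for i
  proof (induction i)
    case (Suc i)
    have "\<bar>c ^ i * (v - p)\<bar> \<le> 1 * \<bar>v - p\<bar>"
      unfolding abs_mult using c by (intro mult_right_mono) (auto simp: power_le_one)
    then have "\<bar>(?f ^^ (m * i)) v - p\<bar> < d" using Suc n0 by (simp add: v_def)
    then have "(?f ^^ m) ((?f ^^ (m * i)) v) = p + c * (c ^ i * (v - p))" using d(2) Suc by simp
    then show ?case by (simp add: funpow_plus mult.assoc)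
  qed simp
  have lim0: "(\<lambda>i. (?f ^^ (m * i)) v) \<longlonglongrightarrow> p"
  proof -
    have "(\<lambda>i. c ^ i) \<longlonglongrightarrow> 0" by (rule LIMSEQ_power_zero) (use c in simp)
    then have "(\<lambda>i. p + c ^ i * (v - p)) \<longlonglongrightarrow> p + 0 * (v - p)"
      by (intro tendsto_add tendsto_mult tendsto_const)
    then show ?thesis unfolding iter by simp
  qed
  have lim: "(\<lambda>i. (?f ^^ (m * i + j)) v) \<longlonglongrightarrow> (?f ^^ j) p" for j
  proof -
    obtain e where e: "e > 0" "\<And>y. \<bar>y - p\<bar> < e \<Longrightarrow> (?f ^^ j) y = (?f ^^ j) p + cocycle ?f (F_slope t) j p * (y - p)"
      using F_rot_pow_locally_affine[OF p] by blast
    have "(\<lambda>i. (?f ^^ j) p + cocycle ?f (F_slope t) j p * ((?f ^^ (m * i)) v - p)) \<longlonglongrightarrow>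
        (?f ^^ j) p + cocycle ?f (F_slope t) j p * (p - p)" 
      by (intro tendsto_add tendsto_mult tendsto_diff tendsto_const lim0)
    moreover have "\<forall>\<^sub>F i in sequentially. (?f ^^ j) p + cocycle ?f (F_slope t) j p * ((?f ^^ (m * i)) v - p) =
        (?f ^^ (m * i + j)) v"
      using tendstoD[OF lim0 e(1)]
    proof eventually_elim
      case (elim i)
      then have "(?f ^^ j) ((?f ^^ (m * i)) v) = (?f ^^ j) p + cocycle ?f (F_slope t) j p * ((?f ^^ (m * i)) v - p)"
        by (intro e(2)) (simp only: dist_real_def)
      then show ?case unfolding add.commute[of "m * i" j] funpow_plus ..
    qed
    ultimately show ?thesis by (simp add: Lim_transform_eventually)
  qed
  define P where "P = forward_orbit ?f p"
  have P: "finite P" unfolding P_def periodic_orbit_finite[OF m(2,1)] by simp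
  have orbit_z: "(?f ^^ (m * i + j)) v = (?f ^^ (m * i + j + n0)) z" for i j
    unfolding v_def by (simp only: funpow_plus)
  have "y \<in> omega_limit ?f z" if y: "y \<in> P" for y
    unfolding omega_limit_def
  proof (intro CollectI allI impI)
    fix U assume U: "open U" "y \<in> U"
    obtain j where j: "y = (?f ^^ j) p" using orbitE[OF y[unfolded P_def]] .
    have "\<forall>\<^sub>F i in sequentially. (?f ^^ (m * i + j)) v \<in> U"
      by (rule topological_tendstoD[OF lim[of j] U(1) U(2)[unfolded j]])
    then obtain I where I: "\<And>i. i \<ge> I \<Longrightarrow> (?f ^^ (m * i + j + n0)) z \<in> U"
      unfolding eventually_sequentially orbit_z by blast
    show "\<exists>\<^sub>F n in sequentially. (?f ^^ n) z \<in> U"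
      unfolding frequently_sequentially
    proof
      fix N
      have "N \<le> m * (max I N) + j + n0"
        using m(1) by (metis le_add1 le_trans max.cobounded2 mult_le_mono1 nat_mult_1 One_nat_def Suc_leI)
      then show "\<exists>n\<ge>N. (?f ^^ n) z \<in> U" using I[of "max I N"] by auto
    qed
  qed
  moreover have "y \<in> P" if y: "y \<in> omega_limit ?f z" for y
  proof (rule ccontr)
    assume "y \<notin> P"
    have "open (- P)" using P by (simp add: finite_imp_closed open_Compl)
    then obtain e where e: "e > 0" "\<And>x. dist x y < e \<Longrightarrow> x \<notin> P"
      using \<open>y \<notin> P\<close> unfolding open_dist by (metis ComplD ComplI)
    have "\<forall>\<^sub>F i in sequentially. \<forall>j\<in>{..<m}. dist ((?f ^^ (m * i + j)) v) ((?f ^^ j) p) < e / 2"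
      using e(1) by (intro eventually_ball_finite ballI tendstoD[OF lim]) auto
    then obtain I where I: "\<And>i j. i \<ge> I \<Longrightarrow> j < m \<Longrightarrow> dist ((?f ^^ (m * i + j + n0)) z) ((?f ^^ j) p) < e / 2"
      unfolding eventually_sequentially orbit_z by blast
    have "\<exists>\<^sub>F n in sequentially. (?f ^^ n) z \<in> ball y (e / 2)"
      using y[unfolded omega_limit_def mem_Collect_eq, rule_format, of "ball y (e / 2)"] e(1) by simp
    then obtain n where n: "n \<ge> m * I + n0" "(?f ^^ n) z \<in> ball y (e / 2)"
      unfolding frequently_sequentially by blast
    \<comment> \<open>Splitting the time after \<open>n0\<close> modulo \<open>m\<close> compares a
      late iterate near \<open>y\<close> with one of the finitely many limits.\<close>
    define k where "k = n - n0"
    have "n = m * (k div m) + k mod m + n0" using n(1) by (simp add: k_def)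
    moreover have "I \<le> k div m" using n(1) m(1) by (simp add: k_def less_eq_div_iff_mult_less_eq mult.commute)
    ultimately have "dist ((?f ^^ n) z) ((?f ^^ (k mod m)) p) < e / 2"
      using I[of "k div m" "k mod m"] m(1) by simp
    moreover have "dist ((?f ^^ n) z) y < e / 2" using n(2) by (simp add: dist_commute)
    ultimately have "dist ((?f ^^ (k mod m)) p) y < e"
      using dist_triangle_half_r[of "(?f ^^ n) z" "(?f ^^ (k mod m)) p" e y] by (simp add: dist_commute)
    then have "(?f ^^ (k mod m)) p \<notin> P" by (rule e(2))
    then show False by (simp add: P_def)
  qed
  ultimately show ?thesis unfolding P_def by blast
qed

lemma dynamically_trivial_if_good_angle:
  assumes "good_angle t" shows "dynamically_trivial (F_rot t)"
proof -
  let ?f = "F_rot t"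
  obtain p q m n where p: "p \<in> D" "0 < m" "(?f ^^ m) p = p" "cocycle ?f (F_slope t) m p < 1"
      "forward_orbit ?f p \<inter> breaks = {}"
    and q: "q \<in> D" "0 < n" "(?f ^^ n) q = q" "cocycle ?f (F_slope t) n q > 1"
      "forward_orbit ?f q \<inter> breaks = {}"
    and conv: "\<And>z. z \<in> D \<Longrightarrow> z \<in> forward_orbit ?f q \<or> approaches ?f z (forward_orbit ?f p)"
    using assms unfolding good_angle_def trivial_dynamics_def sink_source_def by metis
  obtain k where k: "periodic_of_order ?f k p" "k dvd m" using minimal_period[OF p(3,2)] .
  obtain l where l: "periodic_of_order ?f l q" "l dvd n" using minimal_period[OF q(3,2)] .
  have "cocycle ?f (F_slope t) k p < 1" "cocycle ?f (F_slope t) l q > 1"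
    using cocycle_minimal_period(1)[OF k p(2) F_slope_pos p(4)]
      cocycle_minimal_period(2)[OF l q(2) F_slope_pos q(4)] by auto
  moreover note pow_has_derivative[OF p(1,5), of k] pow_has_derivative[OF q(1,5), of l]
  moreover have "omega_limit ?f z = forward_orbit ?f p" if "z \<in> D" "z \<notin> forward_orbit ?f q" for z
    using omega_limit_eq_orbit[OF p(1,5,2,3,4)] conv[OF that(1)] that(2) by blast
  ultimately show ?thesis
    unfolding dynamically_trivial_def using p(1) q(1) k(1) l(1) by blast
qed

theorem theorem2: "AE t in lebesgue_on {0..<1}. dynamically_trivial (F_rot t)"
proof -
  have "AE t in lebesgue. good_angle t"
    using negligible_bad_angles by (intro AE_I'[of "{t. \<not> good_angle t}"]) (auto simp: negligible_iff_null_sets)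
  then have "AE t in lebesgue. t \<in> {0..<1} \<longrightarrow> dynamically_trivial (F_rot t)"
    by eventually_elim (simp add: dynamically_trivial_if_good_angle)
  then show ?thesis by (subst AE_restrict_space_iff) auto
qed

end
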